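(* Let $N\geq 5$ and let $(M,g)$ be an $N$-dimensional Riemannian model with pole $o$ and metric $ds^2=dr^2+\psi^2(r)\,d\omega^2$, where $\psi$ is a $C^\infty$ nonnegative function on $[0,+\infty)$, positive on $(0,+\infty)$, with $\psi'(0)=1$, $\psi^{(2k)}(0)=0$ for all $k\geq0$, and such that for all $r>0$: $K_{\pi,r}^{rad}\leq -1$ and $K_{\pi,r}^{rad}\geq H_{\pi,r}^{tan}$. Then for all $u\in C_c^\infty(M)$, $$\int_M(\Delta_g u)^2dv_g-\Big(\frac{N-1}{2}\Big)^2\int_M|\nabla_g u|^2dv_g\geq\frac14\int_M\frac{|\nabla_g u|^2}{r^2}dv_g+\frac{N^2-1}{4}\int_M\frac{|\nabla_g u|^2}{\psi^2}dv_g.$$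
   Context: $d\omega^2$ is the standard metric on $\mathbb{S}^{N-1}$, $r$ the geodesic distance from $o$, $dv_g$ the Riemannian volume, $\nabla_g$ and $\Delta_g$ the Riemannian gradient and Laplace–Beltrami operator, $K_{\pi,r}^{rad}=-\frac{\psi''}{\psi}$, $H_{\pi,r}^{tan}=-\frac{(\psi')^2-1}{\psi^2}$. *)

theory Defs
  imports "HOL-Analysis.Analysis"
begin

text \<open>The N-dimensional Riemannian model with pole o is realised in normal
  (geodesic polar) coordinates as the vector space real^'n, N = CARD('n),
  with o = 0, r(x) = norm x, theta = x / r, and metric
  g_x = theta theta^T + (psi r / r)^2 (I - theta theta^T),
  i.e. ds^2 = dr^2 + psi(r)^2 dw^2.  All formulas below are used for x \<noteq> 0
  (the pole is a null set for every integral).\<close>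

fun dirderiv :: "('a::real_normed_vector \<Rightarrow> real) \<Rightarrow> 'a list \<Rightarrow> ('a \<Rightarrow> real)" where
  "dirderiv f [] = f"
| "dirderiv f (v # vs) = (\<lambda>x. frechet_derivative (dirderiv f vs) (at x) v)"

definition smooth_fun :: "('a::real_normed_vector \<Rightarrow> real) \<Rightarrow> bool" where
  "smooth_fun f \<longleftrightarrow> (\<forall>vs x. dirderiv f vs differentiable (at x))"

definition Cc_infty :: "('a::real_normed_vector \<Rightarrow> real) \<Rightarrow> bool" where
  "Cc_infty f \<longleftrightarrow> smooth_fun f \<and> compact (closure {x. f x \<noteq> 0})"

definition egrad :: "(real^'n \<Rightarrow> real) \<Rightarrow> real^'n \<Rightarrow> real^'n" where
  "egrad u x = (\<chi> i. frechet_derivative u (at x) (axis i 1))"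

definition ediv :: "(real^'n \<Rightarrow> real^'n) \<Rightarrow> real^'n \<Rightarrow> real" where
  "ediv F x = (\<Sum>i\<in>UNIV. frechet_derivative (\<lambda>y. F y $ i) (at x) (axis i 1))"

text \<open>Riemannian volume density sqrt(det g) = (psi(r)/r)^(N-1).\<close>
definition model_density :: "(real \<Rightarrow> real) \<Rightarrow> real^'n \<Rightarrow> real" where
  "model_density \<psi> x = (\<psi> (norm x) / norm x) ^ (CARD('n) - 1)"

definition model_int :: "(real \<Rightarrow> real) \<Rightarrow> (real^'n \<Rightarrow> real) \<Rightarrow> real" where
  "model_int \<psi> f = (\<integral>x. f x * model_density \<psi> x \<partial>lborel)"

text \<open>Riemannian gradient g^{-1} du (as a vector in coordinates).\<close>
definition model_grad :: "(real \<Rightarrow> real) \<Rightarrow> (real^'n \<Rightarrow> real) \<Rightarrow> real^'n \<Rightarrow> real^'n" where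
  "model_grad \<psi> u x =
     (let \<theta> = inverse (norm x) *\<^sub>R x; G = egrad u x in
      (G \<bullet> \<theta>) *\<^sub>R \<theta> + (norm x / \<psi> (norm x))\<^sup>2 *\<^sub>R (G - (G \<bullet> \<theta>) *\<^sub>R \<theta>))"

text \<open>|grad_g u|_g^2 = du(grad_g u).\<close>
definition model_gradnorm2 :: "(real \<Rightarrow> real) \<Rightarrow> (real^'n \<Rightarrow> real) \<Rightarrow> real^'n \<Rightarrow> real" where
  "model_gradnorm2 \<psi> u x = egrad u x \<bullet> model_grad \<psi> u x"

definition model_lap :: "(real \<Rightarrow> real) \<Rightarrow> (real^'n \<Rightarrow> real) \<Rightarrow> real^'n \<Rightarrow> real" where
  "model_lap \<psi> u x =
     ediv (\<lambda>y. model_density \<psi> y *\<^sub>R model_grad \<psi> u y) x / model_density \<psi> x"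

text \<open>Curvatures, with D k the k-th derivative of psi.\<close>
definition K_rad :: "(nat \<Rightarrow> real \<Rightarrow> real) \<Rightarrow> real \<Rightarrow> real" where
  "K_rad D r = - D 2 r / D 0 r"

definition H_tan :: "(nat \<Rightarrow> real \<Rightarrow> real) \<Rightarrow> real \<Rightarrow> real" where
  "H_tan D r = - ((D 1 r)\<^sup>2 - 1) / (D 0 r)\<^sup>2"

end

theory Submission
  imports Defs
begin

text \<open>No spherical harmonics are used. With \<open>x = r \<theta>\<close>, \<open>u' = \<partial>\<^sub>r u\<close>, the rotation fields
  \<open>L\<^sub>i\<^sub>j = x\<^sub>i \<partial>\<^sub>j - x\<^sub>j \<partial>\<^sub>i\<close> and the spherical Laplacian \<open>C = 1/2 \<Sum> L\<^sub>i\<^sub>j\<^sup>2\<close> one has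
  \<open>\<Delta>\<^sub>g u = R u + \<psi>\<^sup>-\<^sup>2 C u\<close>, where \<open>R\<close> is the radial part, and
  \<open>\<bar>\<nabla>\<^sub>g u\<bar>\<^sup>2 = u'\<^sup>2 + \<psi>\<^sup>-\<^sup>2 1/2 \<Sum> (L\<^sub>i\<^sub>j u)\<^sup>2\<close>. The operators \<open>\<partial>\<^sub>r\<close>, \<open>L\<^sub>i\<^sub>j\<close> and \<open>C\<close> commute as needed, so
  \<open>(\<Delta>\<^sub>g u)\<^sup>2\<close> minus the weighted gradient term is pointwise at least a sum of divergences:

  \<^item> \<open>(R u)\<^sup>2\<close> is completed to \<open>(u'' + g u')\<^sup>2\<close> with \<open>g = (N-1)/2 \<psi>'/\<psi> - 1/(2r)\<close>, the logarithmic
    derivative of the Hardy ground state up to sign;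
  \<^item> \<open>2 \<psi>\<^sup>-\<^sup>2 R u C u\<close> is moved onto \<open>v = L\<^sub>i\<^sub>j u\<close> and completed to \<open>(v' + k v)\<^sup>2\<close> with
    \<open>k = (N-3)/2 \<psi>'/\<psi> - 1/(2r)\<close>;
  \<^item> \<open>\<psi>\<^sup>-\<^sup>4 (C u)\<^sup>2\<close> is bounded below by Bochner's formula on the sphere, which gives the sharp first
    eigenvalue \<open>N - 1\<close>.

  All vector fields are \<open>O(1/r)\<close> at the pole, so their divergences integrate to zero.\<close>

subsection \<open>Functions smooth away from the origin\<close>

text \<open>Write \<open>Q = psi''/psi\<close>, \<open>S = psi'/psi\<close>,
  \<open>t = 1/psi^2\<close>, \<open>R = 1/r\<close>, \<open>m = N - 1\<close>. The curvature
  hypotheses say \<open>Q >= 1\<close> and \<open>S^2 >= Q + t\<close>. Completing the square in the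
  radial term leaves the coefficient \<open>(m^2/4 + m/2) S^2 - (m/2) Q + R^2/4\<close>; replacing
  \<open>S^2\<close> by \<open>Q + t\<close> and then \<open>Q\<close> by 1 gives
  \<open>m^2/4 + R^2/4 + m(m + 2)/4 t\<close>, the weight of the claim because
  \<open>m(m + 2) = N^2 - 1\<close>. The angular part of the gradient must reach the same weight.
  There the mixed term need not suffice, and the spectral gap of the sphere adds
  \<open>(m/2) t\<close>; in the decomposition used, the coefficient of \<open>t\<close> that
  remains is a positive multiple of \<open>N - 5\<close>. The obstacle is the pole, where the terms
  carry negative powers of \<open>r\<close>. So the calculus is turned into algebra: identities are
  checked in a ring of functions on the punctured space, and the analysis is reduced to counting
  powers of \<open>r\<close>, with one theorem saying which singular divergences integrate to
  zero.\<close>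

lemma line_deriv:
  fixes f :: "'a::real_normed_vector \<Rightarrow> real"
  assumes "f differentiable (at (a + s *\<^sub>R v))"
  shows "((\<lambda>s. f (a + s *\<^sub>R v)) has_real_derivative frechet_derivative f (at (a + s *\<^sub>R v)) v) (at s)"
proof -
  have f: "(f has_derivative frechet_derivative f (at (a + s *\<^sub>R v))) (at (a + s *\<^sub>R v))"
    using assms by (simp add: frechet_derivative_works)
  have "((\<lambda>s. a + s *\<^sub>R v) has_derivative (\<lambda>h. h *\<^sub>R v)) (at s)"
    by (auto intro!: derivative_eq_intros)
  from has_derivative_compose[OF this f]
  have "((\<lambda>s. f (a + s *\<^sub>R v)) has_derivative (\<lambda>h. frechet_derivative f (at (a + s *\<^sub>R v)) (h *\<^sub>R v))) (at s)" .
  then show ?thesis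
    unfolding has_field_derivative_def
    using linear_frechet_derivative[OF assms] by (simp add: linear_scale mult.commute[of _ "frechet_derivative _ _ _"])
qed

text \<open>The mean value theorem, once along \<open>v\<close> and once along \<open>w\<close>, on
  the second difference over a parallelogram. That difference is symmetric in \<open>v\<close> and
  \<open>w\<close>, which is what makes it useful for exchanging derivatives.\<close>

lemma double_difference:
  fixes f :: "'a::real_normed_vector \<Rightarrow> real"
  assumes h: "0 < h"
    and S: "\<And>s t. 0 \<le> s \<Longrightarrow> s \<le> h \<Longrightarrow> 0 \<le> t \<Longrightarrow> t \<le> h \<Longrightarrow> x + s *\<^sub>R v + t *\<^sub>R w \<in> S"
    and f: "\<And>y. y \<in> S \<Longrightarrow> f differentiable (at y)"
    and g: "\<And>y. y \<in> S \<Longrightarrow> (\<lambda>y. frechet_derivative f (at y) v) differentiable (at y)"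
  shows "\<exists>s t. 0 < s \<and> s < h \<and> 0 < t \<and> t < h \<and>
      f (x + h *\<^sub>R v + h *\<^sub>R w) - f (x + h *\<^sub>R v) - f (x + h *\<^sub>R w) + f x
      = h * h * frechet_derivative (\<lambda>y. frechet_derivative f (at y) v) (at (x + s *\<^sub>R v + t *\<^sub>R w)) w"
proof -
  let ?g = "\<lambda>y. frechet_derivative f (at y) v"
  have "((\<lambda>s. f (x + h *\<^sub>R w + s *\<^sub>R v) - f (x + s *\<^sub>R v)) has_real_derivative
      ?g (x + h *\<^sub>R w + s *\<^sub>R v) - ?g (x + s *\<^sub>R v)) (at s)" if "0 \<le> s" "s \<le> h" for s
  proof (intro DERIV_diff line_deriv f)
    show "x + h *\<^sub>R w + s *\<^sub>R v \<in> S" "x + s *\<^sub>R v \<in> S"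
      using S[of s h] S[of s 0] that h by (simp_all add: algebra_simps)
  qed
  from MVT2[OF h this] obtain s where s: "0 < s" "s < h" and
    1: "f (x + h *\<^sub>R w + h *\<^sub>R v) - f (x + h *\<^sub>R v) - (f (x + h *\<^sub>R w + 0 *\<^sub>R v) - f (x + 0 *\<^sub>R v))
        = (h - 0) * (?g (x + h *\<^sub>R w + s *\<^sub>R v) - ?g (x + s *\<^sub>R v))" by blast
  have "((\<lambda>t. ?g (x + s *\<^sub>R v + t *\<^sub>R w)) has_real_derivative
      frechet_derivative ?g (at (x + s *\<^sub>R v + t *\<^sub>R w)) w) (at t)" if "0 \<le> t" "t \<le> h" for t
    by (intro line_deriv g S) (use s that in auto)
  from MVT2[OF h this] obtain t where t: "0 < t" "t < h" and
    2: "?g (x + s *\<^sub>R v + h *\<^sub>R w) - ?g (x + s *\<^sub>R v + 0 *\<^sub>R w)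
        = (h - 0) * frechet_derivative ?g (at (x + s *\<^sub>R v + t *\<^sub>R w)) w" by blast
  show ?thesis
    using s t 1 2 by (intro exI[of _ s] exI[of _ t]) (simp add: algebra_simps)
qed

text \<open>If the mixed derivatives differed at \<open>x\<close>, continuity would keep them apart
  on a small parallelogram. But the second difference over it is \<open>h * h\<close> times a value
  of either one.\<close>

lemma frechet_derivative_commute:
  fixes f :: "'a::real_normed_vector \<Rightarrow> real"
  assumes S: "open S" "x \<in> S"
    and f: "\<And>y. y \<in> S \<Longrightarrow> f differentiable (at y)"
    and gv: "\<And>y. y \<in> S \<Longrightarrow> (\<lambda>y. frechet_derivative f (at y) v) differentiable (at y)"
    and gw: "\<And>y. y \<in> S \<Longrightarrow> (\<lambda>y. frechet_derivative f (at y) w) differentiable (at y)"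
    and cv: "isCont (\<lambda>y. frechet_derivative (\<lambda>y. frechet_derivative f (at y) v) (at y) w) x"
    and cw: "isCont (\<lambda>y. frechet_derivative (\<lambda>y. frechet_derivative f (at y) w) (at y) v) x"
  shows "frechet_derivative (\<lambda>y. frechet_derivative f (at y) v) (at x) w
       = frechet_derivative (\<lambda>y. frechet_derivative f (at y) w) (at x) v"
proof (rule ccontr)
  let ?a = "\<lambda>y. frechet_derivative (\<lambda>y. frechet_derivative f (at y) v) (at y) w"
  let ?b = "\<lambda>y. frechet_derivative (\<lambda>y. frechet_derivative f (at y) w) (at y) v"
  assume "?a x \<noteq> ?b x"
  define e where "e = \<bar>?a x - ?b x\<bar> / 2"
  have e: "e > 0" using \<open>?a x \<noteq> ?b x\<close> by (simp add: e_def)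
  obtain d0 where d0: "d0 > 0" "ball x d0 \<subseteq> S" using S openE by blast
  obtain d1 where d1: "d1 > 0" "\<And>y. dist y x < d1 \<Longrightarrow> dist (?a y) (?a x) < e"
    using cv e unfolding continuous_at_eps_delta by blast
  obtain d2 where d2: "d2 > 0" "\<And>y. dist y x < d2 \<Longrightarrow> dist (?b y) (?b x) < e"
    using cw e unfolding continuous_at_eps_delta by blast
  define d where "d = Min {d0, d1, d2}"
  have d: "d > 0" "d \<le> d0" "d \<le> d1" "d \<le> d2" using d0 d1 d2 by (auto simp: d_def)
  \<comment> \<open>The \<open>1\<close> keeps \<open>K\<close> positive when both vectors vanish;
    with \<open>h = d / (2 * K)\<close> the whole parallelogram stays within \<open>d / 2\<close> of
    \<open>x\<close>.\<close>
  define K where "K = norm v + norm w + 1"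
  have K: "K > 0" by (simp add: K_def add_nonneg_pos)
  define h where "h = d / (2 * K)"
  have h: "h > 0" using d K by (simp add: h_def)
  have near: "dist (x + s *\<^sub>R v + t *\<^sub>R w) x < d" if "0 \<le> s" "s \<le> h" "0 \<le> t" "t \<le> h" for s t
  proof -
    have "dist (x + s *\<^sub>R v + t *\<^sub>R w) x = norm (s *\<^sub>R v + t *\<^sub>R w)" by (simp add: dist_norm)
    also have "\<dots> \<le> s * norm v + t * norm w" using norm_triangle_ineq[of "s *\<^sub>R v" "t *\<^sub>R w"] that by simp
    also have "\<dots> \<le> h * norm v + h * norm w" using that by (intro add_mono mult_right_mono) auto
    also have "\<dots> \<le> h * K" using h by (simp add: K_def algebra_simps)
    also have "\<dots> = d / 2" using K by (simp add: h_def)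
    finally show ?thesis using d by simp
  qed
  have inS: "x + s *\<^sub>R v + t *\<^sub>R w \<in> S" if "0 \<le> s" "s \<le> h" "0 \<le> t" "t \<le> h" for s t
    using near[OF that] d d0 by (auto simp: subset_eq dist_commute)
  have inS': "x + s *\<^sub>R w + t *\<^sub>R v \<in> S" if "0 \<le> s" "s \<le> h" "0 \<le> t" "t \<le> h" for s t
    using inS[of t s] that by (simp add: algebra_simps)
  obtain s t where st: "0 < s" "s < h" "0 < t" "t < h"
    "f (x + h *\<^sub>R v + h *\<^sub>R w) - f (x + h *\<^sub>R v) - f (x + h *\<^sub>R w) + f x = h * h * ?a (x + s *\<^sub>R v + t *\<^sub>R w)"
    using double_difference[of h x v w S f, OF h inS f gv] by blast
  obtain s' t' where st': "0 < s'" "s' < h" "0 < t'" "t' < h"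
    "f (x + h *\<^sub>R w + h *\<^sub>R v) - f (x + h *\<^sub>R w) - f (x + h *\<^sub>R v) + f x = h * h * ?b (x + s' *\<^sub>R w + t' *\<^sub>R v)"
    using double_difference[of h x w v S f, OF h inS' f gw] by blast
  have "h * h * ?a (x + s *\<^sub>R v + t *\<^sub>R w) = h * h * ?b (x + s' *\<^sub>R w + t' *\<^sub>R v)"
    using st(5) st'(5) by (simp add: algebra_simps)
  then have eq: "?a (x + s *\<^sub>R v + t *\<^sub>R w) = ?b (x + s' *\<^sub>R w + t' *\<^sub>R v)" using h by simp
  have "dist (x + s' *\<^sub>R w + t' *\<^sub>R v) x < d" using near[of t' s'] st' by (simp add: algebra_simps)
  then have "dist (?b (x + s' *\<^sub>R w + t' *\<^sub>R v)) (?b x) < e" using d2(2) d(4) by (meson order_less_le_trans)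
  moreover have "dist (?a (x + s *\<^sub>R v + t *\<^sub>R w)) (?a x) < e"
    using d1(2)[of "x + s *\<^sub>R v + t *\<^sub>R w"] near[of s t] st d by linarith
  moreover have "\<bar>A - B\<bar> \<le> \<bar>p - A\<bar> + \<bar>p - B\<bar>" for A B p :: real by arith
  ultimately show False using eq unfolding e_def dist_real_def
    by (metis add_strict_mono field_sum_of_halves not_less)
qed

section \<open>Differentiability classes on the punctured space\<close>

definition pdiff :: "'n \<Rightarrow> (real^'n \<Rightarrow> real) \<Rightarrow> real^'n \<Rightarrow> real" where
  "pdiff i f x = (if x = 0 then 0 else frechet_derivative f (at x) (axis i 1))"

text \<open>Full differentiability, not only existence of partials, is asked at each level, so that
  the product and chain rules apply without further argument.\<close>

fun Ck_off0 :: "nat \<Rightarrow> (real^'n \<Rightarrow> real) \<Rightarrow> bool" where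
  "Ck_off0 0 f \<longleftrightarrow> continuous_on (- {0}) f"
| "Ck_off0 (Suc m) f \<longleftrightarrow> (\<forall>x. x \<noteq> 0 \<longrightarrow> f differentiable (at x)) \<and> (\<forall>i. Ck_off0 m (pdiff i f))"

lemma frechet_derivative_cong_open:
  assumes "open S" "x \<in> S" "\<And>y. y \<in> S \<Longrightarrow> f y = g y"
  shows "frechet_derivative f (at x) = frechet_derivative g (at x)"
proof -
  have "(f has_derivative D) (at x) \<longleftrightarrow> (g has_derivative D) (at x)" for D
    using assms has_derivative_transform_within_open by metis
  then show ?thesis unfolding frechet_derivative_def by simp
qed

lemma differentiable_cong_open:
  assumes "open S" "x \<in> S" "\<And>y. y \<in> S \<Longrightarrow> f y = g y" "f differentiable (at x)"
  shows "g differentiable (at x)"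
  using assms has_derivative_transform_within_open unfolding differentiable_def by metis

text \<open>The value 0 that \<open>pdiff\<close> takes at the pole pays off here: the conclusion is
  an equality of functions, although nothing is known at the pole.\<close>

lemma pdiff_cong:
  assumes "\<And>y. y \<noteq> 0 \<Longrightarrow> f y = g y"
  shows "pdiff i f = pdiff i g"
proof
  fix x :: "real^'a"
  show "pdiff i f x = pdiff i g x"
    using frechet_derivative_cong_open[of "- {0}" x f g, OF open_Compl[OF closed_singleton]] assms
    by (auto simp: pdiff_def)
qed

lemma Ck_off0_cong:
  assumes "\<And>y. y \<noteq> 0 \<Longrightarrow> f y = g y" "Ck_off0 m f"
  shows "Ck_off0 m g"
proof (cases m)
  case 0
  then show ?thesis using assms by (auto cong: continuous_on_cong_simp)
next
  case (Suc m')
  have "g differentiable (at x)" if "x \<noteq> 0" for x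
    using assms that Suc differentiable_cong_open[of "-{0}" x f g, OF open_Compl[OF closed_singleton]] by auto
  then show ?thesis using Suc assms pdiff_cong[of f g] by auto
qed

lemma Ck_off0_SucD: "Ck_off0 (Suc m) f \<Longrightarrow> Ck_off0 m f"
proof (induction m arbitrary: f)
  case 0
  then show ?case
    by (auto intro!: differentiable_imp_continuous_on simp: differentiable_on_def differentiable_at_withinI)
next
  case (Suc m)
  then show ?case by (metis Ck_off0.simps(2))
qed

lemma pdiff_eq:
  assumes "x \<noteq> 0" "(f has_derivative F) (at x)"
  shows "pdiff i f x = F (axis i 1)"
  using assms frechet_derivative_at by (fastforce simp: pdiff_def)

lemma Ck_off0_add:
  "Ck_off0 m f \<Longrightarrow> Ck_off0 m g \<Longrightarrow> Ck_off0 m (\<lambda>x. f x + g x)"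
proof (induction m arbitrary: f g)
  case 0
  then show ?case by (auto intro!: continuous_intros)
next
  case (Suc m)
  have "pdiff i (\<lambda>x. f x + g x) x = pdiff i f x + pdiff i g x" for i x
  proof (cases "x = 0")
    case False
    have "((\<lambda>x. f x + g x) has_derivative (\<lambda>h. frechet_derivative f (at x) h + frechet_derivative g (at x) h)) (at x)"
      using Suc.prems False by (intro has_derivative_add) (auto simp: frechet_derivative_works)
    from pdiff_eq[OF False this] False show ?thesis by (auto simp: pdiff_def)
  qed (simp add: pdiff_def)
  then have "pdiff i (\<lambda>x. f x + g x) = (\<lambda>x. pdiff i f x + pdiff i g x)" for i by auto
  then show ?case using Suc by auto
qed

lemma pdiff_mult:
  assumes "Ck_off0 (Suc m) f" "Ck_off0 (Suc m) g"
  shows "pdiff i (\<lambda>x. f x * g x) = (\<lambda>x. pdiff i f x * g x + f x * pdiff i g x)"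
proof
  fix x
  show "pdiff i (\<lambda>x. f x * g x) x = pdiff i f x * g x + f x * pdiff i g x"
  proof (cases "x = 0")
    case False
    have "((\<lambda>x. f x * g x) has_derivative (\<lambda>h. f x * frechet_derivative g (at x) h + frechet_derivative f (at x) h * g x)) (at x)"
      using assms False by (intro has_derivative_mult) (auto simp: frechet_derivative_works)
    from pdiff_eq[OF False this] False show ?thesis by (auto simp: pdiff_def)
  qed (simp add: pdiff_def)
qed

lemma Ck_off0_mult:
  "Ck_off0 m f \<Longrightarrow> Ck_off0 m g \<Longrightarrow> Ck_off0 m (\<lambda>x. f x * g x)"
proof (induction m arbitrary: f g)
  case 0
  then show ?case by (auto intro!: continuous_intros)
next
  case (Suc m)
  then show ?case using Ck_off0_SucD[OF Suc.prems(1)] Ck_off0_SucD[OF Suc.prems(2)]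
    by (auto simp: pdiff_mult intro!: Ck_off0_add)
qed

lemma Ck_off0_const: "Ck_off0 m (\<lambda>x. c)"
proof (induction m arbitrary: c)
  case (Suc m)
  have "pdiff i (\<lambda>x. c) = (\<lambda>x::real^'a. 0)" for i by (auto simp: pdiff_def fun_eq_iff)
  then show ?case using Suc by simp
qed auto

lemma Ck_off0_linear:
  assumes "bounded_linear f" shows "Ck_off0 m f"
proof (cases m)
  case 0
  then show ?thesis using assms by (auto intro: linear_continuous_on)
next
  case (Suc m')
  have D: "(f has_derivative f) (at x)" for x using assms by (simp add: bounded_linear_imp_has_derivative)
  have "Ck_off0 m' (pdiff i f)" for i
    by (rule Ck_off0_cong[OF _ Ck_off0_const[of m' "f (axis i 1)"]]) (simp add: pdiff_eq[OF _ D])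
  then show ?thesis using Suc D by (auto simp: differentiable_def)
qed

lemma Ck_off0_inverse:
  assumes nz: "\<And>x. x \<noteq> 0 \<Longrightarrow> f x \<noteq> 0"
  shows "Ck_off0 m f \<Longrightarrow> Ck_off0 m (\<lambda>x. inverse (f x))"
proof (induction m)
  case 0
  then show ?case using nz by (auto intro!: continuous_intros)
next
  case (Suc m)
  have fd: "f differentiable (at x)" if "x \<noteq> 0" for x using Suc.prems that by simp
  have "Ck_off0 m (pdiff i (\<lambda>x. inverse (f x)))" for i
  proof (rule Ck_off0_cong)
    show "Ck_off0 m (\<lambda>x. (-1) * (pdiff i f x * (inverse (f x) * inverse (f x))))"
      using Suc Ck_off0_SucD[OF Suc.prems] by (intro Ck_off0_mult Ck_off0_const) auto
    fix x :: "real^'a" assume x: "x \<noteq> 0"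
    have "((\<lambda>x. inverse (f x)) has_derivative (\<lambda>h. - (inverse (f x) * frechet_derivative f (at x) h * inverse (f x)))) (at x)"
      using nz[OF x] fd[OF x] by (intro Deriv.has_derivative_inverse) (auto simp: frechet_derivative_works)
    from pdiff_eq[OF x this] show "-1 * (pdiff i f x * (inverse (f x) * inverse (f x))) = pdiff i (\<lambda>x. inverse (f x)) x"
      using x by (simp add: pdiff_def)
  qed
  moreover have "(\<lambda>x. inverse (f x)) differentiable (at x)" if "x \<noteq> 0" for x
    using nz[OF that] fd[OF that] by (intro differentiable_inverse) auto
  ultimately show ?case by simp
qed

lemma pdiff_norm:
  assumes "x \<noteq> 0"
  shows "pdiff i norm x = x $ i * inverse (norm x)"
  using pdiff_eq[OF assms has_derivative_norm[OF assms]] assms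
  by (simp add: sgn_div_norm inner_axis inner_axis' field_simps)

text \<open>The induction feeds itself: the partials of the norm are \<open>x $ i / norm x\<close>,
  as smooth as the norm was already shown to be.\<close>

lemma Ck_off0_norm: "Ck_off0 m (norm :: real^'n \<Rightarrow> real)"
proof (induction m)
  case (Suc m)
  have "Ck_off0 m (pdiff i (norm :: real^'n \<Rightarrow> real))" for i
    by (rule Ck_off0_cong[OF _ Ck_off0_mult[OF Ck_off0_linear[OF bounded_linear_vec_nth[of i]] Ck_off0_inverse[OF _ Suc]]])
      (auto simp: pdiff_norm)
  then show ?case by (auto intro: differentiable_norm_at)
qed (auto intro!: continuous_intros)

lemma pdiff_radial:
  fixes x :: "real^'n"
  assumes "x \<noteq> 0" "(h has_real_derivative h') (at (norm x))"
  shows "((\<lambda>x. h (norm x)) has_derivative (\<lambda>y. h' * (y \<bullet> sgn x))) (at x)"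
    "pdiff i (\<lambda>x. h (norm x)) x = h' * (x $ i * inverse (norm x))"
proof -
  show 1: "((\<lambda>x. h (norm x)) has_derivative (\<lambda>y. h' * (y \<bullet> sgn x))) (at x)"
    using has_derivative_compose[OF has_derivative_norm[OF assms(1)] assms(2)[unfolded has_field_derivative_def]]
    by (simp add: inner_commute)
  show "pdiff i (\<lambda>x. h (norm x)) x = h' * (x $ i * inverse (norm x))"
    using pdiff_eq[OF assms(1) 1] by (simp add: sgn_div_norm inner_axis' field_simps)
qed

text \<open>Taking the whole sequence of derivatives \<open>h\<close> lets the induction pass from
  \<open>k\<close> to \<open>Suc k\<close>.\<close>

lemma Ck_off0_radial:
  assumes h: "\<And>k r. r > 0 \<Longrightarrow> (h k has_real_derivative h (Suc k) r) (at r)"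
  shows "Ck_off0 m (\<lambda>x::real^'n. h k (norm x))"
proof (induction m arbitrary: k)
  case 0
  have "continuous_on {0<..} (h k)"
    using h by (intro continuous_at_imp_continuous_on) (auto intro: DERIV_isCont)
  then have "continuous_on (-{0}) (\<lambda>x::real^'n. h k (norm x))"
    by (rule continuous_on_compose2) (auto intro!: continuous_intros)
  then show ?case by simp
next
  case (Suc m)
  have "Ck_off0 m (pdiff i (\<lambda>x::real^'n. h k (norm x)))" for i
    by (rule Ck_off0_cong[OF _ Ck_off0_mult[OF Suc[of "Suc k"]
          Ck_off0_mult[OF Ck_off0_linear[OF bounded_linear_vec_nth[of i]] Ck_off0_inverse[OF _ Ck_off0_norm]]]])
      (auto simp: pdiff_radial(2)[OF _ h])
  then show ?case using pdiff_radial(1)[OF _ h, of _ k] by (auto simp: differentiable_def)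
qed

lemma Ck_off0_smooth_fun:
  assumes "smooth_fun f"
  shows "Ck_off0 m (dirderiv f vs)"
proof (induction m arbitrary: vs)
  case 0
  have "dirderiv f vs differentiable_on (-{0})" 
    using assms by (auto simp: smooth_fun_def differentiable_on_def differentiable_at_withinI)
  then show ?case by (simp add: differentiable_imp_continuous_on)
next
  case (Suc m)
  have "Ck_off0 m (pdiff i (dirderiv f vs))" for i
    by (rule Ck_off0_cong[OF _ Suc[of "axis i 1 # vs"]]) (auto simp: pdiff_def)
  then show ?case using assms by (auto simp: smooth_fun_def)
qed

lemma pdiff_commute:
  assumes "\<And>m. Ck_off0 m f"
  shows "pdiff i (pdiff j f) = pdiff j (pdiff i f)"
proof
  fix x
  show "pdiff i (pdiff j f) x = pdiff j (pdiff i f) x"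
  proof (cases "x = 0")
    case False
    have eq: "frechet_derivative (\<lambda>y. frechet_derivative f (at y) (axis j 1)) (at x) = frechet_derivative (pdiff j f) (at x)" 
      if "x \<noteq> 0" for x j
      using that by (intro frechet_derivative_cong_open[of "-{0}"]) (auto simp: pdiff_def)
    have d: "(\<lambda>y. frechet_derivative f (at y) (axis i 1)) differentiable (at x)" if "x \<noteq> 0" for x i
    proof (rule differentiable_cong_open[of "-{0}" x "pdiff i f"])
      show "pdiff i f differentiable (at x)" using that assms[of "Suc (Suc 0)"] by simp
    qed (use that in \<open>auto simp: pdiff_def\<close>)
    have c: "isCont (\<lambda>y. frechet_derivative (\<lambda>y. frechet_derivative f (at y) (axis i 1)) (at y) (axis j 1)) x" for i j
    proof -
      have "continuous_on (-{0}) (pdiff j (pdiff i f))" using assms[of "Suc (Suc 0)"] by auto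
      then have "continuous_on (-{0}) (\<lambda>y. frechet_derivative (\<lambda>y. frechet_derivative f (at y) (axis i 1)) (at y) (axis j 1))"
        by (rule continuous_on_eq) (simp add: pdiff_def[of j] eq)
      then show ?thesis using False by (simp add: continuous_on_eq_continuous_at open_Compl)
    qed
    show ?thesis using False frechet_derivative_commute[of "-{0}" x f "axis i 1" "axis j 1", OF open_Compl[OF closed_singleton] _ _ d d c c] assms[of "Suc 0"]
      by (simp add: pdiff_def[of _ "pdiff _ _"] eq)
  qed (simp add: pdiff_def)
qed

subsection \<open>The ring of functions smooth away from the origin\<close>

text \<open>Setting every function to \<open>0\<close> at the pole turns identities valid off the pole into
  equations between ring elements; the unit of the ring is the indicator function of \<open>- {0}\<close>.\<close>

typedef (overloaded) 'n sfun = "{f :: real^'n::finite \<Rightarrow> real. (\<forall>m. Ck_off0 m f) \<and> f 0 = 0}"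
  morphisms ev Abs_sfun
proof
  show "(\<lambda>x. 0) \<in> {f :: real^'n \<Rightarrow> real. (\<forall>m. Ck_off0 m f) \<and> f 0 = 0}" by (simp add: Ck_off0_const)
qed

setup_lifting type_definition_sfun

text \<open>Arguments that are not smooth off the pole are sent to 0 only to make the operation
  total; \<open>ev_cut0\<close> recovers the values once smoothness is known.\<close>

lift_definition cut0 :: "(real^'n::finite \<Rightarrow> real) \<Rightarrow> 'n sfun" is
  "\<lambda>f x. if (\<forall>m. Ck_off0 m f) \<and> x \<noteq> 0 then f x else 0"
proof -
  fix f :: "real^'n \<Rightarrow> real"
  show "(\<forall>m. Ck_off0 m (\<lambda>x. if (\<forall>m. Ck_off0 m f) \<and> x \<noteq> 0 then f x else 0)) \<and>
     (if (\<forall>m. Ck_off0 m f) \<and> (0::real^'n) \<noteq> 0 then f 0 else 0) = 0"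
  proof (cases "\<forall>m. Ck_off0 m f")
    case True
    then show ?thesis using Ck_off0_cong[of f "\<lambda>x. if (\<forall>m. Ck_off0 m f) \<and> x \<noteq> 0 then f x else 0"] by auto
  next
    case False
    then have "(\<lambda>x. if (\<forall>m. Ck_off0 m f) \<and> x \<noteq> 0 then f x else 0) = (\<lambda>x. 0)" by (simp only: if_False simp_thms)
    then show ?thesis by (simp only: Ck_off0_const) simp
  qed
qed

instantiation sfun :: (finite) "{comm_ring_1, real_algebra_1}"
begin

lift_definition zero_sfun :: "'a sfun" is "\<lambda>x. 0" by (simp add: Ck_off0_const)
lift_definition one_sfun :: "'a sfun" is "\<lambda>x. if x = 0 then 0 else 1"
  by (auto intro: Ck_off0_cong[OF _ Ck_off0_const[of _ 1]])
lift_definition plus_sfun :: "'a sfun \<Rightarrow> 'a sfun \<Rightarrow> 'a sfun" is "\<lambda>f g x. f x + g x"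
  by (simp add: Ck_off0_add)
lift_definition times_sfun :: "'a sfun \<Rightarrow> 'a sfun \<Rightarrow> 'a sfun" is "\<lambda>f g x. f x * g x"
  by (simp add: Ck_off0_mult)
lift_definition scaleR_sfun :: "real \<Rightarrow> 'a sfun \<Rightarrow> 'a sfun" is "\<lambda>c f x. c * f x"
  by (simp add: Ck_off0_mult Ck_off0_const)
lift_definition uminus_sfun :: "'a sfun \<Rightarrow> 'a sfun" is "\<lambda>f x. - f x"
  using Ck_off0_mult[OF Ck_off0_const[of _ "-1"]] by auto
definition minus_sfun :: "'a sfun \<Rightarrow> 'a sfun \<Rightarrow> 'a sfun" where "minus_sfun f g = f + - g"

instance
proof
  have "axis undefined 1 \<noteq> (0 :: real^'a)" by (simp add: axis_eq_0_iff)
  then show "(0::'a sfun) \<noteq> 1" by transfer (auto simp: fun_eq_iff)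
qed ((simp only: minus_sfun_def; fail) | (transfer, simp add: algebra_simps fun_eq_iff; fail))+

end

lemma ev_simps [simp]:
  "ev 0 x = 0" "ev (f + g) x = ev f x + ev g x" "ev (f * g) x = ev f x * ev g x" "ev (- f) x = - ev f x"
  "ev (f - g) x = ev f x - ev g x" "ev (c *\<^sub>R f) x = c * ev f x"
  "x \<noteq> 0 \<Longrightarrow> ev 1 x = 1" "ev f 0 = 0"
  unfolding minus_sfun_def by (transfer; simp)+

lemma ev_of_real [simp]: "x \<noteq> 0 \<Longrightarrow> ev (of_real c) x = c"
  by (simp add: of_real_def)

lemma ev_numeral [simp]: "x \<noteq> 0 \<Longrightarrow> ev (numeral w) x = numeral w"
  by (metis ev_of_real of_real_numeral)

lemma ev_of_nat [simp]: "x \<noteq> 0 \<Longrightarrow> ev (of_nat n) x = of_nat n"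
  by (metis ev_of_real of_real_of_nat_eq)

lemma ev_sum [simp]: "ev (sum f A) x = (\<Sum>a\<in>A. ev (f a) x)"
  by (induction A rule: infinite_finite_induct) auto

lemma ev_power [simp]: "x \<noteq> 0 \<Longrightarrow> ev (f ^ n) x = ev f x ^ n"
  by (induction n) auto

lemma sfun_eqI: "(\<And>x. x \<noteq> 0 \<Longrightarrow> ev f x = ev g x) \<Longrightarrow> f = g"
  by (rule ev_inject[THEN iffD1], rule ext) (metis ev_simps(8))

lemma Ck_off0_ev: "Ck_off0 m (ev f)"
  using ev[of f] by simp

lemma ev_cut0: "(\<And>m. Ck_off0 m f) \<Longrightarrow> x \<noteq> 0 \<Longrightarrow> ev (cut0 f) x = f x"
  by transfer auto

lift_definition pd :: "'n::finite \<Rightarrow> 'n sfun \<Rightarrow> 'n sfun" is pdiff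
  by (metis (no_types, lifting) Ck_off0.simps(2) pdiff_def)

lemma ev_pd: "ev (pd i f) x = pdiff i (ev f) x"
  by transfer simp

lemma has_derivative_ev:
  "x \<noteq> 0 \<Longrightarrow> (ev f has_derivative frechet_derivative (ev f) (at x)) (at x)"
  using Ck_off0_ev[of "Suc 0" f] by (simp add: frechet_derivative_works)

lemma pd_mult [simp]: "pd i (f * g) = pd i f * g + f * pd i g"
  by transfer (rule pdiff_mult[of 0]; blast)

lemma pd_add [simp]: "pd i (f + g) = pd i f + pd i g"
proof (rule sfun_eqI)
  fix x :: "real^'a" assume x: "x \<noteq> 0"
  have "((\<lambda>y. ev f y + ev g y) has_derivative (\<lambda>h. frechet_derivative (ev f) (at x) h + frechet_derivative (ev g) (at x) h)) (at x)"
    using x by (intro has_derivative_add has_derivative_ev)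
  moreover have "ev (f + g) = (\<lambda>y. ev f y + ev g y)" by auto
  ultimately have "(ev (f + g) has_derivative (\<lambda>h. frechet_derivative (ev f) (at x) h + frechet_derivative (ev g) (at x) h)) (at x)"
    by simp
  from pdiff_eq[OF x this] x show "ev (pd i (f + g)) x = ev (pd i f + pd i g) x"
    by (simp add: ev_pd pdiff_def)
qed

lemma pd_commute: "pd i (pd j f) = pd j (pd i f)"
  by transfer (simp add: pdiff_commute)

lemma pd_of_real [simp]: "pd i (of_real c) = 0"
proof (rule sfun_eqI)
  fix x :: "real^'a" assume x: "x \<noteq> 0"
  have "(ev (of_real c) has_derivative (\<lambda>h. 0)) (at x)"
    by (rule has_derivative_transform_within_open[of "\<lambda>x. c" _ _ _ "-{0}"]) (use x in auto)
  from pdiff_eq[OF x this] show "ev (pd i (of_real c)) x = ev 0 x" by (simp add: ev_pd)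
qed

lemma pd_0 [simp]: "pd i 0 = 0" and pd_1 [simp]: "pd i 1 = 0" and pd_numeral [simp]: "pd i (numeral w) = 0"
  and pd_of_nat [simp]: "pd i (of_nat n) = 0"
  using pd_of_real[of i 0] pd_of_real[of i 1] pd_of_real[of i "numeral w"] pd_of_real[of i "of_nat n"]
  by (simp_all del: pd_of_real)

lemma pd_minus [simp]: "pd i (- f) = - pd i f"
  using pd_mult[of i "-1" f] pd_add[of i 1 "-1"] by simp

lemma pd_diff [simp]: "pd i (f - g) = pd i f - pd i g"
  using pd_add[of i f "- g"] by simp

lemma pd_sum [simp]: "pd i (sum f A) = (\<Sum>a\<in>A. pd i (f a))"
  by (induction A rule: infinite_finite_induct) auto

lemma pd_power: "pd i (f ^ n) = of_nat n * f ^ (n - 1) * pd i f"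
proof (induction n)
  case (Suc n)
  then show ?case by (cases n) (simp_all add: algebra_simps)
qed simp

definition coord :: "'n::finite \<Rightarrow> 'n sfun" where "coord i = cut0 (\<lambda>x. x $ i)"

lemma ev_coord: "ev (coord i) x = x $ i"
  by (cases "x = 0") (auto simp: coord_def ev_cut0 Ck_off0_linear bounded_linear_vec_nth)

lemma pd_coord [simp]: "pd i (coord j) = (if i = j then 1 else 0)"
proof (rule sfun_eqI)
  fix x :: "real^'a" assume x: "x \<noteq> 0"
  have "ev (coord j) = (\<lambda>x. x $ j)" by (auto simp: ev_coord)
  then have "(ev (coord j) has_derivative (\<lambda>x. x $ j)) (at x)"
    by (simp add: bounded_linear_imp_has_derivative bounded_linear_vec_nth)
  from pdiff_eq[OF x this] show "ev (pd i (coord j)) x = ev (if i = j then 1 else 0) x"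
    using x by (simp add: ev_pd axis_def)
qed

definition radial :: "(real \<Rightarrow> real) \<Rightarrow> 'n::finite sfun" where
  "radial h = cut0 (\<lambda>x. h (norm x))"

definition nrm :: "'n::finite sfun" where "nrm = cut0 norm"
definition nrmi :: "'n::finite sfun" where "nrmi = cut0 (\<lambda>x. inverse (norm x))"

lemma ev_nrm: "ev nrm x = norm x"
  by (cases "x = 0") (auto simp: nrm_def ev_cut0 Ck_off0_norm)

lemma ev_nrmi: "ev nrmi x = inverse (norm x)"
  by (cases "x = 0") (auto simp: nrmi_def ev_cut0 Ck_off0_inverse Ck_off0_norm)

lemma nrm_nrmi [simp]: "nrm * nrmi = 1"
  by (rule sfun_eqI) (simp add: ev_nrm ev_nrmi)

lemma nrm_sq: "nrm * nrm = (\<Sum>i\<in>UNIV. coord i * coord i)"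
  by (rule sfun_eqI) (simp add: ev_nrm ev_coord norm_vec_def L2_set_def real_sqrt_mult_self sum_nonneg power2_eq_square)

lemma pd_nrm [simp]: "pd i nrm = coord i * nrmi"
proof (rule sfun_eqI)
  fix x :: "real^'a" assume x: "x \<noteq> 0"
  have "ev nrm = (norm :: real^'a \<Rightarrow> real)" by (auto simp: ev_nrm)
  then show "ev (pd i nrm) x = ev (coord i * nrmi) x" using x by (simp add: ev_pd pdiff_norm ev_coord ev_nrmi)
qed

text \<open>The ring is not a field, so an inverse is always an explicit partner \<open>g\<close>
  with \<open>f * g = 1\<close>. Differentiating this equation and multiplying by \<open>g\<close>
  gives the quotient rule.\<close>

lemma pd_inverse:
  assumes "f * g = (1 :: 'n::finite sfun)"
  shows "pd i g = - (g * g * pd i f)"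
proof -
  have "pd i f * g + f * pd i g = 0" using arg_cong[OF assms, of "pd i"] by simp
  then have "g * (pd i f * g + f * pd i g) = 0" by simp
  then have "g * g * pd i f + (f * g) * pd i g = 0" by (simp add: algebra_simps)
  then show ?thesis using assms by (simp add: eq_neg_iff_add_eq_0 add.commute)
qed

lemma pd_nrmi [simp]: "pd i nrmi = - (coord i * (nrmi * nrmi * nrmi))"
  using pd_inverse[OF nrm_nrmi, of i] by (simp add: algebra_simps)

lemma sfun_inverse_ex:
  assumes "\<And>x. x \<noteq> 0 \<Longrightarrow> ev f x \<noteq> 0"
  shows "f * cut0 (\<lambda>x. inverse (ev f x)) = 1"
  by (rule sfun_eqI) (simp add: ev_cut0 Ck_off0_inverse Ck_off0_ev assms)

subsection \<open>Order of vanishing at the origin\<close>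

text \<open>The bound is required on every ball, not only near the pole: for compact support it then
  becomes global, and in \<open>growth_mono\<close> the constant can absorb surplus powers of the
  norm.\<close>

definition growth :: "int \<Rightarrow> 'n::finite sfun \<Rightarrow> bool" where
  "growth k f \<longleftrightarrow> (\<forall>R>0. \<exists>C. \<forall>x. x \<noteq> 0 \<longrightarrow> norm x \<le> R \<longrightarrow> \<bar>ev f x\<bar> \<le> C * norm x powi k)"

lemma growthI:
  assumes "\<And>R. R > 0 \<Longrightarrow> \<exists>C. \<forall>x. x \<noteq> 0 \<longrightarrow> norm x \<le> R \<longrightarrow> \<bar>ev f x\<bar> \<le> C * norm x powi k"
  shows "growth k f"
  using assms by (auto simp: growth_def)

lemma growthE:
  assumes "growth k f" "R > 0"
  obtains C where "C \<ge> 0" "\<And>x. x \<noteq> 0 \<Longrightarrow> norm x \<le> R \<Longrightarrow> \<bar>ev f x\<bar> \<le> C * norm x powi k"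
proof -
  obtain C where C: "\<And>x. x \<noteq> 0 \<Longrightarrow> norm x \<le> R \<Longrightarrow> \<bar>ev f x\<bar> \<le> C * norm x powi k"
    using assms by (auto simp: growth_def)
  have "\<bar>ev f x\<bar> \<le> \<bar>C\<bar> * norm x powi k" if "x \<noteq> 0" "norm x \<le> R" for x
    by (rule order_trans[OF C[OF that]]) (auto intro!: mult_right_mono)
  then show ?thesis using that[of "\<bar>C\<bar>"] by auto
qed

lemma growth_add: "growth k f \<Longrightarrow> growth k g \<Longrightarrow> growth k (f + g)"
proof (rule growthI)
  fix R :: real assume k: "growth k f" "growth k g" and R: "R > 0"
  obtain C where C: "\<And>x. x \<noteq> 0 \<Longrightarrow> norm x \<le> R \<Longrightarrow> \<bar>ev f x\<bar> \<le> C * norm x powi k" using growthE[OF k(1) R] by metis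
  obtain D where D: "\<And>x. x \<noteq> 0 \<Longrightarrow> norm x \<le> R \<Longrightarrow> \<bar>ev g x\<bar> \<le> D * norm x powi k" using growthE[OF k(2) R] by metis
  have "\<bar>ev (f + g) x\<bar> \<le> (C + D) * norm x powi k" if "x \<noteq> 0" "norm x \<le> R" for x
    using C[OF that] D[OF that] by (simp add: distrib_right)
  then show "\<exists>C. \<forall>x. x \<noteq> 0 \<longrightarrow> norm x \<le> R \<longrightarrow> \<bar>ev (f + g) x\<bar> \<le> C * norm x powi k" by blast
qed

lemma growth_mult: "growth k f \<Longrightarrow> growth l g \<Longrightarrow> growth (k + l) (f * g)"
proof (rule growthI)
  fix R :: real assume k: "growth k f" "growth l g" and R: "R > 0"
  obtain C where C: "C \<ge> 0" "\<And>x. x \<noteq> 0 \<Longrightarrow> norm x \<le> R \<Longrightarrow> \<bar>ev f x\<bar> \<le> C * norm x powi k" using growthE[OF k(1) R] by metis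
  obtain D where D: "D \<ge> 0" "\<And>x. x \<noteq> 0 \<Longrightarrow> norm x \<le> R \<Longrightarrow> \<bar>ev g x\<bar> \<le> D * norm x powi l" using growthE[OF k(2) R] by metis
  have "\<bar>ev (f * g) x\<bar> \<le> (C * D) * norm x powi (k + l)" if "x \<noteq> 0" "norm x \<le> R" for x
    using mult_mono[OF C(2)[OF that] D(2)[OF that]] C D that
    by (simp add: abs_mult power_int_add mult_ac)
  then show "\<exists>C. \<forall>x. x \<noteq> 0 \<longrightarrow> norm x \<le> R \<longrightarrow> \<bar>ev (f * g) x\<bar> \<le> C * norm x powi (k + l)" by blast
qed

lemma growth_mono: "growth k f \<Longrightarrow> l \<le> k \<Longrightarrow> growth l f"
proof (rule growthI)
  fix R :: real assume k: "growth k f" "l \<le> k" and R: "R > 0"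
  obtain C where C: "C \<ge> 0" "\<And>x. x \<noteq> 0 \<Longrightarrow> norm x \<le> R \<Longrightarrow> \<bar>ev f x\<bar> \<le> C * norm x powi k" using growthE[OF k(1) R] by metis
  have "\<bar>ev f x\<bar> \<le> (C * R powi (k - l)) * norm x powi l" if x: "x \<noteq> 0" "norm x \<le> R" for x
  proof -
    have "norm x powi k = norm x powi (k - l) * norm x powi l" using x by (simp flip: power_int_add)
    also have "\<dots> \<le> R powi (k - l) * norm x powi l"
      using x k by (intro mult_right_mono power_int_mono) auto
    finally have "C * norm x powi k \<le> C * (R powi (k - l) * norm x powi l)" using C by (intro mult_left_mono)
    then show ?thesis using C(2)[OF x] by (simp add: mult_ac)
  qed
  then show "\<exists>C. \<forall>x. x \<noteq> 0 \<longrightarrow> norm x \<le> R \<longrightarrow> \<bar>ev f x\<bar> \<le> C * norm x powi l" by blast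
qed

lemma growth_const: "growth 0 (of_real c)"
  by (auto simp: growth_def)

text \<open>Behaviour like a homogeneous function of degree \<open>k\<close>: each derivative may
  cost one power of the norm. This is stable under products and inverses, so the order of a
  composite term is found by adding exponents.\<close>

fun ordn :: "nat \<Rightarrow> int \<Rightarrow> 'n::finite sfun \<Rightarrow> bool" where
  "ordn 0 k f = growth k f"
| "ordn (Suc m) k f = (growth k f \<and> (\<forall>i. ordn m (k - 1) (pd i f)))"

definition ord :: "int \<Rightarrow> 'n::finite sfun \<Rightarrow> bool" where
  "ord k f \<longleftrightarrow> (\<forall>m. ordn m k f)"

lemma ord_growth: "ord k f \<Longrightarrow> growth k f"
  unfolding ord_def by (metis ordn.simps(1))

lemma ord_pd: "ord k f \<Longrightarrow> ord (k - 1) (pd i f)"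
  unfolding ord_def by (metis ordn.simps(2))

lemma ordn_SucD: "ordn (Suc m) k f \<Longrightarrow> ordn m k f"
  by (induction m arbitrary: k f) auto

lemma ordn_add: "ordn m k f \<Longrightarrow> ordn m k g \<Longrightarrow> ordn m k (f + g)"
  by (induction m arbitrary: k f g) (auto simp: growth_add)

lemma ordn_mono: "ordn m k f \<Longrightarrow> l \<le> k \<Longrightarrow> ordn m l f"
proof (induction m arbitrary: k l f)
  case (Suc m)
  have "ordn m (l - 1) (pd i f)" for i using Suc.IH[of "k - 1" "pd i f" "l - 1"] Suc.prems by auto
  then show ?case using Suc.prems by (auto intro: growth_mono)
qed (auto intro: growth_mono)

lemma ordn_mult: "ordn m k f \<Longrightarrow> ordn m l g \<Longrightarrow> ordn m (k + l) (f * g)"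
proof (induction m arbitrary: k l f g)
  case (Suc m)
  have "ordn m (k + l - 1) (pd i f * g + f * pd i g)" for i
    using Suc.IH[of "k - 1" "pd i f" l g] Suc.IH[of k f "l - 1" "pd i g"] Suc.prems
      ordn_SucD[OF Suc.prems(1)] ordn_SucD[OF Suc.prems(2)]
    by (intro ordn_add) (auto simp: algebra_simps)
  then show ?case using Suc.prems by (auto intro: growth_mult)
qed (auto intro: growth_mult)

lemma ordn_0: "ordn m k 0"
  by (induction m arbitrary: k) (auto simp: growth_def intro!: exI[of _ 0])

lemma ordn_const: "ordn m 0 (of_real c)"
  by (cases m) (auto simp: growth_const ordn_0)

text \<open>Only the size of \<open>g\<close> has to be known. Its derivatives follow from
  \<open>- (g * g * pd i f)\<close>, whose order is \<open>-2k + (k - 1) = -k - 1\<close>.\<close>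

lemma ordn_inverse:
  assumes "f * g = 1" "growth (- k) g" "\<And>m. ordn m k f"
  shows "ordn m (- k) g"
proof (induction m)
  case (Suc m)
  have "ordn m (0 + ((- k + - k) + (k - 1))) (of_real (-1) * ((g * g) * pd i f))" for i
    using assms(3)[of "Suc m"] by (intro ordn_mult ordn_const Suc) simp
  then have "ordn m (- k - 1) (pd i g)" for i using pd_inverse[OF assms(1), of i] by simp
  then show ?case using assms by simp
qed (use assms in auto)

lemma ord_0 [intro!]: "ord k 0" by (simp add: ord_def ordn_0)
lemma ord_const: "ord 0 (of_real c)" by (simp add: ord_def ordn_const)
lemma ord_add [intro]: "ord k f \<Longrightarrow> ord k g \<Longrightarrow> ord k (f + g)" by (simp add: ord_def ordn_add)
lemma ord_mult: "ord k f \<Longrightarrow> ord l g \<Longrightarrow> ord (k + l) (f * g)" by (simp add: ord_def ordn_mult)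
lemma ord_mono: "ord k f \<Longrightarrow> l \<le> k \<Longrightarrow> ord l f" unfolding ord_def by (blast intro: ordn_mono)
lemma ord_inverse: "f * g = 1 \<Longrightarrow> growth (- k) g \<Longrightarrow> ord k f \<Longrightarrow> ord (- k) g"
  unfolding ord_def by (blast intro: ordn_inverse)

lemma ord_minus [intro]: "ord k f \<Longrightarrow> ord k (- f)"
  using ord_mult[OF ord_const[of "-1"], of k f] by simp

lemma ord_diff [intro]: "ord k f \<Longrightarrow> ord k g \<Longrightarrow> ord k (f - g)"
  by (subst diff_conv_add_uminus) (intro ord_add ord_minus)

lemma ord_sum [intro]: "(\<And>a. a \<in> A \<Longrightarrow> ord k (f a)) \<Longrightarrow> ord k (sum f A)"
  by (induction A rule: infinite_finite_induct) auto

lemma ord_1: "ord 0 1" using ord_const[of 1] by simp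
lemma ord_numeral: "ord 0 (numeral w)" using ord_const[of "numeral w"] by simp

lemma ord_power_0: "ord 0 f \<Longrightarrow> ord 0 (f ^ n)"
  by (induction n) (auto simp: ord_1 intro: ord_mult[of 0 _ 0, simplified])

lemma ord_coord: "ord 1 (coord i)"
proof -
  have "growth 1 (coord i)" by (auto intro!: growthI exI[of _ 1] simp: ev_coord component_le_norm_cart)
  moreover have "ord 0 (pd j (coord i))" for j by (auto simp: ord_1)
  ultimately have "ordn m 1 (coord i)" for m by (cases m) (auto simp: ord_def)
  then show ?thesis by (simp add: ord_def)
qed

lemma growth_nrmi: "growth (-1) nrmi"
  by (auto intro!: growthI exI[of _ 1] simp: ev_nrmi power_int_minus)

text \<open>The norm and its inverse appear in each other's derivatives, hence the simultaneous
  induction.\<close>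

lemma ord_nrm: "ord 1 (nrm :: 'n::finite sfun)"
proof -
  have gr: "growth 1 (nrm :: 'n sfun)" by (auto intro!: growthI exI[of _ 1] simp: ev_nrm)
  have "ordn m 1 (nrm :: 'n sfun) \<and> ordn m (-1) (nrmi :: 'n sfun)" for m
  proof (induction m)
    case 0
    then show ?case using gr growth_nrmi by simp
  next
    case (Suc m)
    have coord: "ordn m 1 (coord i)" for i :: 'n using ord_coord by (auto simp: ord_def)
    have "ordn m 0 (pd i nrm)" for i :: 'n using ordn_mult[OF coord conjunct2[OF Suc], of i] by simp
    moreover have "ordn m (-2) (pd i nrmi)" for i :: 'n
      using ordn_mult[OF ordn_mult[OF ordn_const[of m "-1"] coord[of i]]
          ordn_mult[OF ordn_mult[OF conjunct2[OF Suc] conjunct2[OF Suc]] conjunct2[OF Suc]]] by simp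
    ultimately show ?case using gr growth_nrmi by simp
  qed
  then show ?thesis by (simp add: ord_def)
qed

lemma ord_nrmi: "ord (-1) nrmi"
  using ord_inverse[OF nrm_nrmi _ ord_nrm] growth_nrmi by blast

subsection \<open>Integration by parts across the origin\<close>

lemma integral_lborel_translate:
  fixes f :: "'a::euclidean_space \<Rightarrow> real"
  assumes "integrable lborel f"
  shows "integrable lborel (\<lambda>x. f (x + c))" "(\<integral>x. f (x + c) \<partial>lborel) = (\<integral>x. f x \<partial>lborel)"
proof -
  have m: "(\<lambda>x. c + x) \<in> lborel \<rightarrow>\<^sub>M borel" by simp
  have f: "f \<in> borel_measurable borel" using assms by auto
  have "integrable (distr lborel borel (\<lambda>x. c + x)) f" using assms lborel_distr_plus[of c] by simp
  then show "integrable lborel (\<lambda>x. f (x + c))" using integrable_distr_eq[OF m f] by (simp add: add.commute)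
  show "(\<integral>x. f (x + c) \<partial>lborel) = (\<integral>x. f x \<partial>lborel)"
    using integral_distr[OF m f] unfolding lborel_distr_plus by (simp add: add.commute)
qed

text \<open>Difference quotients have integral 0 by translation invariance of Lebesgue measure. The
  mean value theorem bounds them by \<open>B\<close> on a fixed ball, and dominated convergence
  passes to the derivative.\<close>

lemma integral_directional_derivative_eq_0:
  fixes f :: "'a::euclidean_space \<Rightarrow> real"
  assumes d: "\<And>x. f differentiable (at x)"
    and B: "\<And>x. \<bar>frechet_derivative f (at x) v\<bar> \<le> B"
    and R: "\<And>x. norm x > R \<Longrightarrow> f x = 0"
  shows "(\<integral>x. frechet_derivative f (at x) v \<partial>lborel) = 0"
proof -
  let ?s = "\<lambda>n x. (f (x + inverse (real (Suc n)) *\<^sub>R v) - f x) * real (Suc n)"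
  have cont: "continuous_on UNIV f"
    using d by (auto intro!: continuous_at_imp_continuous_on differentiable_imp_continuous_within)
  then have meas: "f \<in> borel_measurable borel" by (rule borel_measurable_continuous_onI)
  have meas': "(\<lambda>x. f (x + c)) \<in> borel_measurable borel" for c
    by (intro borel_measurable_continuous_onI continuous_on_compose2[OF cont]) (auto intro!: continuous_intros)
  have int: "integrable lborel f"
  proof -
    obtain M where M: "\<And>x. x \<in> cball 0 R \<Longrightarrow> \<bar>f x\<bar> \<le> M"
      using compact_continuous_image[OF continuous_on_subset[OF cont] compact_cball[of 0 R]]
      by (fastforce dest!: compact_imp_bounded simp: bounded_iff)
    show ?thesis
    proof (rule Bochner_Integration.integrable_bound)
      show "integrable lborel (\<lambda>x::'a. M * indicat_real (cball 0 R) x)"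
        by (intro integrable_mult_right integrable_real_indicator) (auto simp: emeasure_lborel_cball_finite[unfolded infinity_ennreal_def])
      show "AE x in lborel. norm (f x) \<le> norm (M * indicat_real (cball 0 R) x)"
        using M R by (intro AE_I2) (fastforce simp: indicator_def)
    qed (use meas in simp)
  qed
  have lim: "(\<lambda>n. ?s n x) \<longlonglongrightarrow> frechet_derivative f (at x) v" for x
  proof -
    have "((\<lambda>h. (f (x + h *\<^sub>R v) - f x) / h) \<longlongrightarrow> frechet_derivative f (at x) v) (at 0)"
      using line_deriv[of f x 0 v] d by (simp add: DERIV_def)
    moreover have "filterlim (\<lambda>n. inverse (real (Suc n))) (at 0) sequentially"
      using LIMSEQ_inverse_real_of_nat by (auto simp: filterlim_at)
    ultimately have "(\<lambda>n. (f (x + inverse (real (Suc n)) *\<^sub>R v) - f x) / inverse (real (Suc n)))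
        \<longlonglongrightarrow> frechet_derivative f (at x) v" by (rule filterlim_compose)
    then show ?thesis by (simp add: divide_inverse)
  qed
  \<comment> \<open>The steps have length at most \<open>norm v\<close>, so outside the radius
    enlarged by \<open>norm v\<close> both the point and its translate miss the support.\<close>
  have bound: "\<bar>?s n x\<bar> \<le> B * indicat_real (cball 0 (R + norm v)) x" for n x
  proof (cases "norm x \<le> R + norm v")
    case True
    define h where "h = inverse (real (Suc n))"
    have h: "h > 0" by (simp add: h_def)
    obtain z where z: "f (x + h *\<^sub>R v) - f (x + 0 *\<^sub>R v) = (h - 0) * frechet_derivative f (at (x + z *\<^sub>R v)) v"
      using MVT2[OF h line_deriv[OF d]] by blast
    have "?s n x = frechet_derivative f (at (x + z *\<^sub>R v)) v"
      using z by (simp add: h_def field_simps)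
    then show ?thesis using B True by (simp add: indicator_def)
  next
    case False
    have "norm (inverse (real (Suc n)) *\<^sub>R v) \<le> 1 * norm v"
      unfolding norm_scaleR by (intro mult_right_mono) (auto simp: inverse_eq_divide)
    moreover have "norm x \<le> norm (x + inverse (real (Suc n)) *\<^sub>R v) + norm (inverse (real (Suc n)) *\<^sub>R v)"
      by (metis add_diff_cancel norm_triangle_ineq4)
    ultimately have "norm (x + inverse (real (Suc n)) *\<^sub>R v) > R" using False by linarith
    moreover have "norm x > R" using False norm_ge_zero[of v] by linarith
    ultimately show ?thesis using R False by (simp add: indicator_def)
  qed
  have "(\<lambda>n. \<integral>x. ?s n x \<partial>lborel) \<longlonglongrightarrow> (\<integral>x. frechet_derivative f (at x) v \<partial>lborel)"
  proof (rule integral_dominated_convergence)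
    show "integrable lborel (\<lambda>x. B * indicat_real (cball 0 (R + norm v)) x)"
      by (intro integrable_mult_right integrable_real_indicator) (auto simp: emeasure_lborel_cball_finite[unfolded infinity_ennreal_def])
    show sm: "?s n \<in> borel_measurable lborel" for n using meas meas' by auto
    show "(\<lambda>x. frechet_derivative f (at x) v) \<in> borel_measurable lborel"
      by (rule borel_measurable_LIMSEQ_real[OF lim sm])
  qed (use lim bound in auto)
  moreover have "(\<integral>x. ?s n x \<partial>lborel) = 0" for n
    using integral_lborel_translate[OF int] int by simp
  ultimately show ?thesis by (simp add: LIMSEQ_const_iff)
qed

text \<open>Dyadic comparison: on the shell of outer radius \<open>R / 2 ^ k\<close> the integrand
  is at most \<open>4 ^ Suc k / R^2\<close>. Bounding each shell by its whole ball leaves a series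
  with ratio \<open>4 / 2 ^ DIM('a)\<close>, which is at most 1/2 from dimension 3 on.\<close>

lemma integrable_norm_power_neg2:
  assumes N: "DIM('a::euclidean_space) \<ge> 3"
  shows "integrable lborel (\<lambda>x::'a. indicator (cball 0 R) x * inverse ((norm x)\<^sup>2))"
proof (cases "R > 0")
  case False
  then have "(\<lambda>x::'a. indicator (cball 0 R) x * inverse ((norm x)\<^sup>2)) = (\<lambda>x. 0)"
  proof (intro ext)
    fix x :: 'a
    have "x = 0" if "norm x \<le> R" using that False norm_ge_zero[of x] by (metis norm_le_zero_iff not_less order.trans)
    then show "indicator (cball 0 R) x * inverse ((norm x)\<^sup>2) = 0" by (auto simp: indicator_def)
  qed
  then show ?thesis by simp
next
  case R: True
  let ?B = "\<lambda>k. cball (0::'a) (R / 2 ^ k)"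
  let ?c = "\<lambda>k. 4 ^ Suc k / R\<^sup>2 :: real"
  let ?V = "unit_ball_vol (real DIM('a)) :: real"
  have le: "ennreal (indicator (cball 0 R) x * inverse ((norm x)\<^sup>2)) \<le> (\<Sum>k. ennreal (?c k) * indicator (?B k) x)" for x :: 'a
  proof (cases "x \<noteq> 0 \<and> norm x \<le> R")
    case True
    have "\<exists>n. R / 2 ^ n < norm x"
    proof -
      obtain n where "R / norm x < 2 ^ n" using real_arch_pow[of 2 "R / norm x"] by auto
      then show ?thesis using True by (auto simp: field_simps)
    qed
    \<comment> \<open>Since \<open>norm x\<close> is at most \<open>R\<close>, the least such
      \<open>n\<close> is not 0; with \<open>n = Suc k\<close> the point lies in the shell between
      the radii \<open>R / 2 ^ Suc k\<close> and \<open>R / 2 ^ k\<close>.\<close>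
    then obtain n where n: "R / 2 ^ n < norm x" "\<And>m. m < n \<Longrightarrow> \<not> R / 2 ^ m < norm x"
      using exists_least_iff[of "\<lambda>n. R / 2 ^ n < norm x"] by blast
    then obtain k where k: "n = Suc k" using True by (cases n) auto
    have "norm x \<le> R / 2 ^ k" using n(2)[of k] k by simp
    have "(R / 2 ^ n)\<^sup>2 \<le> (norm x)\<^sup>2" using n(1) R by (intro power_mono) auto
    then have "inverse ((norm x)\<^sup>2) \<le> inverse ((R / 2 ^ n)\<^sup>2)" using R by (intro le_imp_inverse_le) auto
    also have "\<dots> = ?c k"
    proof -
      have "(2 ^ k)\<^sup>2 = (4::real) ^ k" by (simp add: power2_eq_square flip: power_mult_distrib)
      then show ?thesis using R by (simp add: k power_divide power_mult_distrib field_simps)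
    qed
    finally have "ennreal (indicator (cball 0 R) x * inverse ((norm x)\<^sup>2)) \<le> ennreal (?c k) * indicator (?B k) x"
      using True \<open>norm x \<le> R / 2 ^ k\<close> by (auto simp: indicator_def intro!: ennreal_leI)
    also have "\<dots> \<le> (\<Sum>k. ennreal (?c k) * indicator (?B k) x)"
    proof -
      define g where "g k = ennreal (?c k) * indicator (?B k) x" for k
      have "g k \<le> suminf g" using sum_le_suminf[of g "{k}"] by auto
      then show ?thesis unfolding g_def .
    qed
    finally show ?thesis .
  qed (auto simp: indicator_def)
  have "(\<integral>\<^sup>+x. ennreal (indicator (cball (0::'a) R) x * inverse ((norm x)\<^sup>2)) \<partial>lborel)
      \<le> (\<integral>\<^sup>+x. (\<Sum>k. ennreal (?c k) * indicator (?B k) x) \<partial>lborel)"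
    by (intro nn_integral_mono le)
  also have "\<dots> = (\<Sum>k. ennreal (?c k) * emeasure lborel (?B k))"
  proof -
    have "(\<lambda>x. ennreal c * indicator (cball (0::'a) s) x) \<in> borel_measurable lborel" for c s
      by (intro borel_measurable_times_ennreal borel_measurable_const borel_measurable_indicator) auto
    then show ?thesis by (simp add: nn_integral_suminf nn_integral_cmult_indicator del: power_Suc)
  qed
  also have "\<dots> = (\<Sum>k. ennreal (?c k * (?V * (R / 2 ^ k) ^ DIM('a))))"
    using R by (intro suminf_cong) (subst emeasure_cball, simp, subst ennreal_mult, simp_all)
  also have "\<dots> < \<infinity>"
  proof -
    have "summable (\<lambda>k. ?c k * (?V * (R / 2 ^ k) ^ DIM('a)))"
    proof (rule summable_comparison_test_ev)
      show "summable (\<lambda>k. (4 / R\<^sup>2 * ?V * R ^ DIM('a)) * (1/2) ^ k)"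
        by (intro summable_mult summable_geometric) auto
      have "?c k * (?V * (R / 2 ^ k) ^ DIM('a)) \<le> (4 / R\<^sup>2 * ?V * R ^ DIM('a)) * (1/2) ^ k" for k
      proof -
        have "(4::real) ^ k * inverse (2 ^ k) ^ DIM('a) \<le> 4 ^ k * inverse (2 ^ k) ^ 3"
          using N by (intro mult_left_mono power_decreasing) (auto simp: inverse_eq_divide)
        also have "\<dots> = (1/2) ^ k"
          by (simp add: power3_eq_cube power_mult_distrib[symmetric] power_inverse[symmetric])
        finally have *: "(4::real) ^ k * inverse (2 ^ k) ^ DIM('a) \<le> (1/2) ^ k" .
        have "?c k * (?V * (R / 2 ^ k) ^ DIM('a)) = (4 / R\<^sup>2 * ?V * R ^ DIM('a)) * (4 ^ k * inverse (2 ^ k) ^ DIM('a))"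
          by (simp add: divide_inverse power_mult_distrib)
        also have "\<dots> \<le> (4 / R\<^sup>2 * ?V * R ^ DIM('a)) * (1/2) ^ k"
          using R by (intro mult_left_mono *) auto
        finally show ?thesis .
      qed
      then show "\<forall>\<^sub>F k in sequentially. norm (?c k * (?V * (R / 2 ^ k) ^ DIM('a))) \<le> (4 / R\<^sup>2 * ?V * R ^ DIM('a)) * (1/2) ^ k"
        using R by (intro always_eventually) auto
    qed
    then have "(\<Sum>k. ennreal (?c k * (?V * (R / 2 ^ k) ^ DIM('a)))) \<noteq> top"
      using R by (intro ennreal_suminf_neq_top) auto
    then show ?thesis by (simp add: less_top)
  qed
  finally have "(\<integral>\<^sup>+x. ennreal (norm (indicator (cball (0::'a) R) x * inverse ((norm x)\<^sup>2))) \<partial>lborel) < \<infinity>"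
    by simp
  moreover have "(\<lambda>x::'a. indicator (cball 0 R) x * inverse ((norm x)\<^sup>2)) \<in> borel_measurable lborel"
    by (intro borel_measurable_times borel_measurable_indicator borel_measurable_inverse
        borel_measurable_power borel_measurable_norm) auto
  ultimately show ?thesis by (intro integrableI_bounded)
qed

definition csupp :: "'n::finite sfun \<Rightarrow> bool" where
  "csupp f \<longleftrightarrow> (\<exists>R. \<forall>x. norm x > R \<longrightarrow> ev f x = 0)"

lemma csupp_mult [intro]: "csupp g \<Longrightarrow> csupp (f * g)"
  by (auto simp: csupp_def)

lemma csupp_0 [intro!]: "csupp 0"
  by (auto simp: csupp_def)

lemma csupp_add [intro]: "csupp f \<Longrightarrow> csupp g \<Longrightarrow> csupp (f + g)"
proof -
  assume "csupp f" "csupp g"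
  then obtain R S where "\<And>x. norm x > R \<Longrightarrow> ev f x = 0" "\<And>x. norm x > S \<Longrightarrow> ev g x = 0"
    unfolding csupp_def by blast
  then show ?thesis unfolding csupp_def by (intro exI[of _ "max R S"]) auto
qed

lemma csupp_minus [intro]: "csupp f \<Longrightarrow> csupp (- f)"
  by (auto simp: csupp_def)

lemma csupp_diff [intro]: "csupp f \<Longrightarrow> csupp g \<Longrightarrow> csupp (f - g)"
  by (subst diff_conv_add_uminus) (intro csupp_add csupp_minus)

lemma csupp_sum [intro]: "(\<And>a. a \<in> A \<Longrightarrow> csupp (f a)) \<Longrightarrow> csupp (sum f A)"
  by (induction A rule: infinite_finite_induct) auto

lemma csupp_pd [intro]: "csupp f \<Longrightarrow> csupp (pd i f)"
proof -
  assume "csupp f"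
  then obtain R where R: "\<And>x. norm x > R \<Longrightarrow> ev f x = 0" unfolding csupp_def by blast
  have "ev (pd i f) x = 0" if x: "norm x > max R 0" for x
  proof -
    have op: "open {x::real^'a. norm x > R}" by (intro open_Collect_less continuous_intros)
    have "(ev f has_derivative (\<lambda>h. 0)) (at x)"
      by (rule has_derivative_transform_within_open[of "\<lambda>x. 0" _ _ _ "{x. norm x > R}"]) (use x R op in auto)
    from pdiff_eq[OF _ this] x show ?thesis by (auto simp: ev_pd)
  qed
  then show ?thesis unfolding csupp_def by blast
qed

definition integ :: "'n::finite sfun \<Rightarrow> real" where
  "integ f = (\<integral>x. ev f x \<partial>lborel)"

lemma ev_measurable [measurable]: "ev f \<in> borel_measurable borel"
proof -
  have "(\<lambda>x. indicator (-{0}) x *\<^sub>R ev f x) \<in> borel_measurable borel"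
    using Ck_off0_ev[of 0 f] by (intro borel_measurable_continuous_on_indicator) auto
  also have "(\<lambda>x. indicator (-{0}) x *\<^sub>R ev f x) = ev f" by (auto simp: indicator_def fun_eq_iff)
  finally show ?thesis .
qed

text \<open>Multiplying by the power of the norm instead of dividing keeps the estimate meaningful
  at the pole.\<close>

lemma growth_csupp_bound:
  assumes "growth (- int n) f" "csupp f"
  shows "\<exists>R C. C \<ge> 0 \<and> (\<forall>x. \<bar>ev f x\<bar> * norm x ^ n \<le> C * indicator (cball 0 R) x)"
proof -
  obtain R0 where R0: "\<And>x. norm x > R0 \<Longrightarrow> ev f x = 0" using assms unfolding csupp_def by blast
  obtain C where C: "C \<ge> 0" "\<And>x. x \<noteq> 0 \<Longrightarrow> norm x \<le> max R0 1 \<Longrightarrow> \<bar>ev f x\<bar> \<le> C * norm x powi (- int n)"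
    by (rule growthE[OF assms(1), of "max R0 1"]) auto
  have "\<bar>ev f x\<bar> * norm x ^ n \<le> C * indicator (cball 0 (max R0 1)) x" for x
  proof (cases "x \<noteq> 0 \<and> norm x \<le> max R0 1")
    case True
    have "\<bar>ev f x\<bar> * norm x ^ n \<le> (C * norm x powi (- int n)) * norm x ^ n"
      using C(2) True by (intro mult_right_mono) auto
    also have "\<dots> = C" using True by (simp add: power_int_minus)
    finally show ?thesis using True by (simp add: indicator_def)
  next
    case False
    then have "ev f x = 0" using R0[of x] by auto
    then show ?thesis using C by (simp add: indicator_def)
  qed
  then show ?thesis using C by blast
qed

lemma growth_integrable:
  fixes f :: "'n::finite sfun"
  assumes N: "CARD('n) \<ge> 3" and f: "growth (-2) f" "csupp f"
  shows "integrable lborel (ev f)"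
proof -
  obtain R C where C: "C \<ge> 0" "\<And>x. \<bar>ev f x\<bar> * norm x ^ 2 \<le> C * indicator (cball 0 R) x"
    using growth_csupp_bound[of 2 f] f by auto
  have "integrable lborel (\<lambda>x::real^'n. C * (indicator (cball 0 R) x * inverse ((norm x)\<^sup>2)))"
    using N by (intro integrable_mult_right integrable_norm_power_neg2) simp
  then show ?thesis
  proof (rule Bochner_Integration.integrable_bound)
    have "norm (ev f x) \<le> norm (C * (indicator (cball 0 R) x * inverse ((norm x)\<^sup>2)))" for x
      using C(2)[of x] C(1) by (cases "x = 0") (auto simp: abs_mult field_simps indicator_def)
    then show "AE x in lborel. norm (ev f x) \<le> norm (C * (indicator (cball 0 R) x * inverse ((norm x)\<^sup>2)))" by auto
  qed simp
qed

text \<open>Needed to see that a regularised ring element is differentiable at the pole too, with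
  the derivative 0 that the ring assigns there.\<close>

lemma has_derivative_0_quadratic:
  fixes g :: "'a::real_normed_vector \<Rightarrow> real"
  assumes "\<And>x. \<bar>g x\<bar> \<le> K * (norm x)\<^sup>2"
  shows "(g has_derivative (\<lambda>h. 0)) (at 0)"
  unfolding has_derivative_at
proof (intro conjI)
  have g0: "g 0 = 0" using assms[of 0] by simp
  show "(\<lambda>h. norm (g (0 + h) - g 0 - 0) / norm h) \<midarrow>0\<rightarrow> 0"
  proof (rule Lim_null_comparison)
    show "\<forall>\<^sub>F h in at 0. norm (norm (g (0 + h) - g 0 - 0) / norm h) \<le> K * norm h"
      using assms g0 by (auto simp: eventually_at_filter power2_eq_square field_simps intro!: always_eventually)
    have "((\<lambda>h::'a. K * norm h) \<longlongrightarrow> K * norm (0::'a)) (at 0)" by (intro tendsto_intros)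
    then show "((\<lambda>h::'a. K * norm h) \<longlongrightarrow> 0) (at 0)" by simp
  qed
qed simp

text \<open>The singular integrand is multiplied by the cutoff \<open>\<bar>x\<bar>\<^sup>4 / (\<bar>x\<bar>\<^sup>4 + e)\<close>, whose gradient
  is bounded by \<open>4 / \<bar>x\<bar>\<close> uniformly in \<open>e\<close>, and then \<open>e \<rightarrow> 0\<close> by dominated convergence.\<close>

lemma integ_pd_eq_0:
  fixes f :: "'n::finite sfun"
  assumes N: "CARD('n) \<ge> 3" and f: "growth (-1) f" "growth (-2) (pd i f)" "csupp f"
  shows "integ (pd i f) = 0"
proof -
  obtain R1 C1 where C1: "C1 \<ge> 0" "\<And>x. \<bar>ev f x\<bar> * norm x ^ 1 \<le> C1 * indicator (cball 0 R1) x"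
    using growth_csupp_bound[of 1 f] f by auto
  obtain R2 C2 where C2: "C2 \<ge> 0" "\<And>x. \<bar>ev (pd i f) x\<bar> * (norm x)\<^sup>2 \<le> C2 * indicator (cball 0 R2) x"
    using growth_csupp_bound[of 2 "pd i f"] f csupp_pd[OF f(3)] by auto
  define R where "R = max (max R1 R2) 1"
  have R: "R > 0" by (simp add: R_def)
  have F: "\<bar>ev f x\<bar> * norm x \<le> C1 * indicator (cball 0 R) x" for x
    using C1(2)[of x] C1(1) by (rule_tac order_trans) (auto simp: R_def indicator_def)
  have DF: "\<bar>ev (pd i f) x\<bar> * (norm x)\<^sup>2 \<le> C2 * indicator (cball 0 R) x" for x
    using C2(2)[of x] C2(1) by (rule_tac order_trans) (auto simp: R_def indicator_def)
  define J :: "real \<Rightarrow> 'n sfun" where "J e = cut0 (\<lambda>x. inverse (ev (nrm ^ 4 + of_real e) x))" for e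
  define G where "G e = nrm ^ 4 * J e * f" for e
  define j where "j e x = inverse (norm x ^ 4 + e)" for e and x :: "real^'n"
  have j: "j e x > 0" "j e x \<le> inverse e" "norm x ^ 4 * j e x \<le> 1" "e * j e x \<le> 1" if "e > 0" for e x
  proof -
    have p: "norm x ^ 4 \<ge> 0" "norm x ^ 4 + e > 0" using that by (simp_all add: add_nonneg_pos)
    show "j e x > 0" "j e x \<le> inverse e" using p that by (auto simp: j_def intro!: le_imp_inverse_le)
    show "norm x ^ 4 * j e x \<le> 1" "e * j e x \<le> 1" 
      using p that by (simp_all add: j_def divide_le_eq_1 flip: divide_inverse)
  qed
  have rJ: "(nrm ^ 4 + of_real e) * J e = 1" if "e > 0" for e
    unfolding J_def
  proof (rule sfun_inverse_ex)
    fix x :: "real^'n" assume "x \<noteq> 0"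
    then show "ev (nrm ^ 4 + of_real e) x \<noteq> 0" using that by (simp add: ev_nrm add_nonneg_pos less_imp_neq[symmetric])
  qed
  have evJ: "ev (J e) x = j e x" if "e > 0" "x \<noteq> 0" for e x
  proof -
    have "(norm x ^ 4 + e) * ev (J e) x = 1" using arg_cong[OF rJ[OF that(1)], of "\<lambda>f. ev f x"] that by (simp add: ev_nrm)
    then show ?thesis using inverse_unique unfolding j_def by metis
  qed
  have pdJ: "pd i (J e) = - (J e * J e * (4 * nrm ^ 3 * (coord i * nrmi)))" if "e > 0" for e
    using pd_inverse[OF rJ[OF that], of i] by (simp add: pd_power)
  have pdr4: "pd i (nrm ^ 4) = 4 * nrm ^ 3 * (coord i * nrmi)" by (simp add: pd_power)
  have evG: "ev (G e) x = norm x ^ 4 * j e x * ev f x" if "e > 0" for e x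
    using that by (cases "x = 0") (simp_all add: G_def evJ ev_nrm)
  \<comment> \<open>The derivative of the cutoff collapses to one term,
    \<open>4 e norm(x)^3 j^2\<close> times \<open>x $ i / norm x\<close>, because
    \<open>(norm x ^ 4 + e) * j e x = 1\<close>.\<close>
  have evpdG: "ev (pd i (G e)) x = norm x ^ 4 * j e x * ev (pd i f) x
      + 4 * (e * norm x ^ 3 * j e x * j e x) * (x $ i * inverse (norm x)) * ev f x"
    if e: "e > 0" for e x
  proof (cases "x = 0")
    case False
    have "(norm x ^ 4 + e) * j e x = 1"
      using e by (simp add: j_def add_nonneg_pos less_imp_neq[symmetric])
    then have "j e x = e * j e x * j e x + norm x ^ 4 * j e x * j e x"
      by (metis (no_types) add.commute distrib_right mult_1)
    then have "4 * norm x ^ 3 * (x $ i * inverse (norm x)) * ev f x * j e x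
      = 4 * norm x ^ 3 * (x $ i * inverse (norm x)) * ev f x * (e * j e x * j e x + norm x ^ 4 * j e x * j e x)" by simp
    then show ?thesis using False e
      by (simp add: G_def pdr4 pdJ evJ ev_nrm ev_coord ev_nrmi algebra_simps)
  qed simp
  have xi: "\<bar>x $ i * inverse (norm x)\<bar> \<le> 1" for x :: "real^'n"
    using component_le_norm_cart[of x i] by (cases "x = 0") (simp_all add: abs_mult field_simps)
  have D: "ev (G e) differentiable (at x)" "frechet_derivative (ev (G e)) (at x) (axis i 1) = ev (pd i (G e)) x"
    if e: "e > 0" for e x
  proof -
    \<comment> \<open>The factor \<open>norm y ^ 4\<close> outweighs the singularity
      \<open>1 / norm y\<close> of \<open>f\<close> with room to spare, so \<open>G e\<close> is
      quadratically small at the pole.\<close>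
    have "\<bar>ev (G e) y\<bar> \<le> (R * inverse e * C1) * (norm y)\<^sup>2" for y
    proof -
      have "\<bar>ev (G e) y\<bar> = (norm y)\<^sup>2 * (norm y * (j e y * (\<bar>ev f y\<bar> * norm y)))"
        using e j(1)[OF e, of y] by (simp add: evG abs_mult power2_eq_square power4_eq_xxxx mult_ac)
      also have "\<dots> \<le> (norm y)\<^sup>2 * (R * (inverse e * C1))"
      proof (cases "norm y \<le> R")
        case True
        then show ?thesis using j[OF e, of y] F[of y] R e by (intro mult_left_mono mult_mono) auto
      next
        case False
        then have "\<bar>ev f y\<bar> * norm y \<le> 0" using F[of y] by (simp add: indicator_def)
        then have "ev f y = 0" using False R by (auto simp: mult_le_0_iff)
        then show ?thesis using R e C1 by simp
      qed
      finally show ?thesis by (simp add: mult_ac)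
    qed
    from has_derivative_0_quadratic[OF this] have 0: "(ev (G e) has_derivative (\<lambda>h. 0)) (at 0)" .
    show "ev (G e) differentiable (at x)"
      using 0 has_derivative_ev[of x "G e"] unfolding differentiable_def by (cases "x = 0") auto
    show "frechet_derivative (ev (G e)) (at x) (axis i 1) = ev (pd i (G e)) x"
      by (cases "x = 0") (simp_all add: ev_pd pdiff_def frechet_derivative_at[OF 0, symmetric])
  qed
  \<comment> \<open>This bound may blow up as \<open>e\<close> tends to 0; it only serves the
    vanishing of the integral for each fixed \<open>e\<close>.\<close>
  have B1: "\<bar>ev (pd i (G e)) x\<bar> \<le> R\<^sup>2 * inverse e * C2 + 4 * (R\<^sup>2 * inverse e * C1)" if e: "e > 0" for e x
  proof (cases "x \<noteq> 0 \<and> norm x \<le> R")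
    case True
    have "\<bar>norm x ^ 4 * j e x * ev (pd i f) x\<bar> = (norm x)\<^sup>2 * j e x * (\<bar>ev (pd i f) x\<bar> * (norm x)\<^sup>2)"
      using j(1)[OF e, of x] by (simp add: abs_mult power2_eq_square power4_eq_xxxx mult_ac)
    also have "\<dots> \<le> R\<^sup>2 * inverse e * C2"
      using j[OF e, of x] DF[of x] R e True by (intro mult_mono power_mono) auto
    finally have 1: "\<bar>norm x ^ 4 * j e x * ev (pd i f) x\<bar> \<le> R\<^sup>2 * inverse e * C2" .
    have "\<bar>4 * (e * norm x ^ 3 * j e x * j e x) * (x $ i * inverse (norm x)) * ev f x\<bar>
      = 4 * (\<bar>x $ i * inverse (norm x)\<bar> * ((norm x)\<^sup>2 * (e * j e x) * j e x * (\<bar>ev f x\<bar> * norm x)))"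
      using j(1)[OF e, of x] e by (simp add: abs_mult power2_eq_square power3_eq_cube mult_ac)
    also have "\<dots> \<le> 4 * (1 * (R\<^sup>2 * 1 * inverse e * C1))"
      using j[OF e, of x] F[of x] R e True xi[of x] by (intro mult_mono power_mono mult_left_mono mult_nonneg_nonneg) auto
    finally show ?thesis using 1 unfolding evpdG[OF e] by linarith
  next
    case False
    then have "x = 0 \<or> (\<bar>ev f x\<bar> * norm x \<le> 0 \<and> \<bar>ev (pd i f) x\<bar> * (norm x)\<^sup>2 \<le> 0 \<and> x \<noteq> 0)"
      using F[of x] DF[of x] by (auto simp: indicator_def)
    then have "ev (pd i (G e)) x = 0" unfolding evpdG[OF e] by (auto simp: mult_le_0_iff)
    then show ?thesis using R e C1 C2 by simp
  qed
  \<comment> \<open>Here \<open>e\<close> disappears: \<open>norm x ^ 4 * j e x\<close> and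
    \<open>e * j e x\<close> are each at most 1. The right-hand side is the dominating
    function.\<close>
  have B2: "\<bar>ev (pd i (G e)) x\<bar> \<le> (C2 + 4 * C1) * (indicator (cball 0 R) x * inverse ((norm x)\<^sup>2))" if e: "e > 0" for e x
  proof (cases "x = 0")
    case False
    have "\<bar>norm x ^ 4 * j e x * ev (pd i f) x\<bar> = (norm x ^ 4 * j e x) * \<bar>ev (pd i f) x\<bar>"
      using j(1)[OF e, of x] by (simp add: abs_mult)
    also have "\<dots> \<le> 1 * \<bar>ev (pd i f) x\<bar>" using j[OF e, of x] by (intro mult_right_mono) auto
    also have "\<dots> \<le> C2 * indicator (cball 0 R) x * inverse ((norm x)\<^sup>2)"
      using DF[of x] False by (simp add: field_simps)
    finally have 1: "\<bar>norm x ^ 4 * j e x * ev (pd i f) x\<bar> \<le> C2 * indicator (cball 0 R) x * inverse ((norm x)\<^sup>2)" .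
    have "\<bar>4 * (e * norm x ^ 3 * j e x * j e x) * (x $ i * inverse (norm x)) * ev f x\<bar>
      = 4 * (\<bar>x $ i * inverse (norm x)\<bar> * ((norm x ^ 4 * j e x) * (e * j e x) * (\<bar>ev f x\<bar> * norm x))) * inverse ((norm x)\<^sup>2)"
      using j(1)[OF e, of x] e False
      by (simp add: abs_mult power2_eq_square power3_eq_cube power4_eq_xxxx field_simps)
    also have "\<dots> \<le> 4 * (1 * (1 * 1 * (C1 * indicator (cball 0 R) x))) * inverse ((norm x)\<^sup>2)"
    proof -
      have "(norm x ^ 4 * j e x) * (e * j e x) \<le> 1 * 1" using j[OF e, of x] e by (intro mult_mono) auto
      then have "(norm x ^ 4 * j e x) * (e * j e x) * (\<bar>ev f x\<bar> * norm x) \<le> 1 * 1 * (C1 * indicator (cball 0 R) x)"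
        by (rule mult_mono[OF _ F]) auto
      then have "\<bar>x $ i * inverse (norm x)\<bar> * ((norm x ^ 4 * j e x) * (e * j e x) * (\<bar>ev f x\<bar> * norm x))
          \<le> 1 * (1 * 1 * (C1 * indicator (cball 0 R) x))"
        by (rule mult_mono[OF xi]) (use j(1)[OF e, of x] e in auto)
      then show ?thesis by (intro mult_right_mono mult_left_mono) auto
    qed
    finally show ?thesis using 1 unfolding evpdG[OF e] by (simp add: algebra_simps)
  qed simp
  have z: "(\<integral>x. ev (pd i (G e)) x \<partial>lborel) = 0" if e: "e > 0" for e
  proof -
    have "ev (G e) x = 0" if "norm x > R" for x
    proof -
      have "\<bar>ev f x\<bar> * norm x \<le> 0" using F[of x] that by (simp add: indicator_def)
      then show ?thesis using that R e by (auto simp: evG mult_le_0_iff)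
    qed
    from integral_directional_derivative_eq_0[OF D(1)[OF e] B1[OF e, folded D(2)[OF e]] this]
    show ?thesis by (simp add: D(2)[OF e])
  qed
  let ?e = "\<lambda>n. inverse (real (Suc n))"
  have "(\<lambda>n. \<integral>x. ev (pd i (G (?e n))) x \<partial>lborel) \<longlonglongrightarrow> (\<integral>x. ev (pd i f) x \<partial>lborel)"
  proof (rule integral_dominated_convergence)
    show "integrable lborel (\<lambda>x::real^'n. (C2 + 4 * C1) * (indicator (cball 0 R) x * inverse ((norm x)\<^sup>2)))"
      using N by (intro integrable_mult_right integrable_norm_power_neg2) simp
    have "(\<lambda>n. ev (pd i (G (?e n))) x) \<longlonglongrightarrow> ev (pd i f) x" for x
    proof (cases "x = 0")
      case False
      have "(\<lambda>n. norm x ^ 4 * inverse (norm x ^ 4 + ?e n) * ev (pd i f) x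
        + 4 * (?e n * norm x ^ 3 * inverse (norm x ^ 4 + ?e n) * inverse (norm x ^ 4 + ?e n)) * (x $ i * inverse (norm x)) * ev f x)
        \<longlonglongrightarrow> norm x ^ 4 * inverse (norm x ^ 4 + 0) * ev (pd i f) x
        + 4 * (0 * norm x ^ 3 * inverse (norm x ^ 4 + 0) * inverse (norm x ^ 4 + 0)) * (x $ i * inverse (norm x)) * ev f x"
        using False by (intro tendsto_intros LIMSEQ_inverse_real_of_nat) auto
      then show ?thesis using False by (simp add: evpdG j_def del: of_nat_Suc)
    qed simp
    then show "AE x in lborel. (\<lambda>n. ev (pd i (G (?e n))) x) \<longlonglongrightarrow> ev (pd i f) x" by simp
    show "AE x in lborel. norm (ev (pd i (G (?e n))) x) \<le> (C2 + 4 * C1) * (indicator (cball 0 R) x * inverse ((norm x)\<^sup>2))" for n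
      using B2[of "?e n"] by simp
  qed simp_all
  then show ?thesis using z by (simp add: integ_def LIMSEQ_const_iff)
qed

subsection \<open>Radial derivative, rotations and the spherical Laplacian\<close>

definition eul :: "'n::finite sfun \<Rightarrow> 'n sfun" where
  "eul f = (\<Sum>i\<in>UNIV. coord i * pd i f)"

definition rd :: "'n::finite sfun \<Rightarrow> 'n sfun" where
  "rd f = nrmi * eul f"

definition rot :: "'n::finite \<times> 'n \<Rightarrow> 'n sfun \<Rightarrow> 'n sfun" where
  "rot a f = coord (fst a) * pd (snd a) f - coord (snd a) * pd (fst a) f"

definition lap :: "'n::finite sfun \<Rightarrow> 'n sfun" where
  "lap f = (\<Sum>i\<in>UNIV. pd i (pd i f))"

text \<open>The Casimir operator of the rotations, that is, the spherical Laplacian: see \<open>sum_rot_rot\<close>.\<close>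

definition cas :: "'n::finite sfun \<Rightarrow> 'n sfun" where
  "cas f = nrm * nrm * lap f - eul (eul f) - of_real (real CARD('n) - 2) * eul f"

lemma eul_mult: "eul (f * g) = eul f * g + f * eul g"
  by (simp add: eul_def sum_distrib_left sum_distrib_right sum.distrib algebra_simps)

lemma eul_simps [simp]:
  "eul (f + g) = eul f + eul g" "eul (f - g) = eul f - eul g" "eul (- f) = - eul f"
  "eul (of_real c) = 0" "eul 0 = 0" "eul 1 = 0" "eul (numeral w) = 0" "eul (of_nat n) = 0"
  by (simp_all add: eul_def sum.distrib sum_subtractf sum_negf algebra_simps)

lemma delta_mult [simp]: "(if P then 1 else 0) * f = (if P then f else (0::'a::semiring_1))"
  "f * (if P then 1 else 0) = (if P then f else (0::'a::semiring_1))"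
  by simp_all

lemma eul_coord [simp]: "eul (coord i) = coord i"
  by (simp add: eul_def)

lemma eul_nrm [simp]: "eul nrm = nrm"
proof -
  have "eul nrm = nrm * nrm * nrmi" by (simp add: eul_def nrm_sq sum_distrib_left mult_ac)
  then show ?thesis by (simp add: mult.assoc)
qed

lemma pd_eul: "pd i (eul f) = pd i f + eul (pd i f)"
  by (simp add: eul_def sum.distrib pd_commute[of i])

lemma rd_mult: "rd (f * g) = rd f * g + f * rd g"
  by (simp add: rd_def eul_mult algebra_simps)

lemma rd_simps [simp]:
  "rd (f + g) = rd f + rd g" "rd (f - g) = rd f - rd g" "rd (- f) = - rd f"
  "rd (of_real c) = 0" "rd 0 = 0" "rd 1 = 0" "rd (numeral w) = 0" "rd (of_nat n) = 0" "rd nrm = 1"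
  using nrm_nrmi by (simp_all add: rd_def algebra_simps)

lemma rd_inverse: "f * g = 1 \<Longrightarrow> rd g = - (g * g * rd f)"
  using pd_inverse[of f g] by (simp add: rd_def eul_def sum_distrib_left sum_negf mult_ac)

lemma rd_nrmi [simp]: "rd nrmi = - (nrmi * nrmi)"
  using rd_inverse[OF nrm_nrmi] by simp

lemma rot_mult: "rot a (f * g) = rot a f * g + f * rot a g"
  by (simp add: rot_def algebra_simps)

lemma rot_simps [simp]:
  "rot a (f + g) = rot a f + rot a g" "rot a (f - g) = rot a f - rot a g" "rot a (- f) = - rot a f"
  "rot a (of_real c) = 0" "rot a 0 = 0" "rot a 1 = 0" "rot a (numeral w) = 0" "rot a (of_nat n) = 0"
  "rot a nrm = 0" "rot a nrmi = 0"
  by (simp_all add: rot_def algebra_simps)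

lemma rot_sum [simp]: "rot a (sum f A) = (\<Sum>b\<in>A. rot a (f b))"
  by (induction A rule: infinite_finite_induct) auto

text \<open>\<open>eul\<close> generates the dilations, which commute with rotations. Together with
  \<open>rot_lap\<close> below this makes \<open>cas\<close> commute with every rotation.\<close>

lemma rot_eul: "rot a (eul f) = eul (rot a f)"
  by (simp add: rot_def pd_eul eul_mult algebra_simps)

lemma rot_rd: "rot a (rd f) = rd (rot a f)"
  by (simp add: rd_def rot_mult rot_eul)

lemma pd_rot: "pd k (rot a f) = (if k = fst a then pd (snd a) f else 0) - (if k = snd a then pd (fst a) f else 0) + rot a (pd k f)"
  by (simp add: rot_def pd_commute[of k] algebra_simps)

lemma pd_if [simp]: "pd i (if P then f else 0) = (if P then pd i f else 0)"
  by simp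

lemma rot_lap: "rot a (lap f) = lap (rot a f)"
  by (simp add: lap_def pd_rot sum.distrib sum_subtractf pd_commute[of "fst a"])

lemma rot_cas: "rot a (cas f) = cas (rot a f)"
  by (simp add: cas_def rot_mult rot_lap rot_eul)

lemma sum_pairs: "(\<Sum>a\<in>UNIV. g a) = (\<Sum>i\<in>UNIV. \<Sum>j\<in>UNIV. g (i, j))"
  by (simp add: sum.cartesian_product)

lemma eul_eul: "eul (eul f) = eul f + (\<Sum>i\<in>UNIV. coord i * eul (pd i f))"
  by (subst eul_def) (simp add: pd_eul distrib_left sum.distrib, simp add: eul_def)

text \<open>Only the outer rotation is expanded. By antisymmetry of \<open>rot (i, j)\<close> in the
  indices its two terms contribute equally, each a full \<open>cas f\<close>. The sum runs over
  ordered pairs, so each coordinate plane counts twice.\<close>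

lemma sum_rot_rot: "(\<Sum>a\<in>UNIV. rot a (rot a f)) = 2 * cas (f :: 'n::finite sfun)"
proof -
  have 1: "(\<Sum>j\<in>UNIV. pd j (rot (i, j) f)) = pd i f + coord i * lap f - of_nat CARD('n) * pd i f - eul (pd i f)" for i
    by (simp add: rot_def lap_def eul_def sum.distrib sum_subtractf sum_distrib_left pd_commute[of _ i])
  have 2: "(\<Sum>i\<in>UNIV. \<Sum>j\<in>UNIV. coord i * pd j (rot (i, j) f)) = cas f"
    unfolding sum_distrib_left[symmetric] 1
    by (simp add: cas_def eul_eul algebra_simps sum.distrib sum_subtractf nrm_sq sum_distrib_left sum_distrib_right)
       (simp add: eul_def sum_distrib_left mult_ac)
  have "(\<Sum>i\<in>UNIV. \<Sum>j\<in>UNIV. coord j * pd i (rot (i, j) f)) = (\<Sum>j\<in>UNIV. \<Sum>i\<in>UNIV. coord j * pd i (rot (i, j) f))"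
    by (rule sum.swap)
  also have "\<dots> = (\<Sum>j\<in>UNIV. \<Sum>i\<in>UNIV. - (coord j * pd i (rot (j, i) f)))"
  proof (intro sum.cong refl)
    fix i j :: 'n
    have "rot (i, j) f = - rot (j, i) f" by (simp add: rot_def)
    then show "coord j * pd i (rot (i, j) f) = - (coord j * pd i (rot (j, i) f))" by simp
  qed
  also have "\<dots> = - cas f" unfolding 2[symmetric] by (simp add: sum_negf)
  finally have 3: "(\<Sum>i\<in>UNIV. \<Sum>j\<in>UNIV. coord j * pd i (rot (i, j) f)) = - cas f" .
  have "(\<Sum>a\<in>UNIV. rot a (rot a f)) = (\<Sum>i\<in>UNIV. \<Sum>j\<in>UNIV. coord i * pd j (rot (i, j) f) - coord j * pd i (rot (i, j) f))"
    unfolding sum_pairs by (simp add: rot_def)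
  also have "\<dots> = 2 * cas f" using 2 3 by (simp add: sum_subtractf)
  finally show ?thesis .
qed

section \<open>Sums of squares of rotations and Bochner's inequality on spheres\<close>

lemma lagrange_identity:
  fixes a b c d :: "'n::finite \<Rightarrow> 'a::comm_ring_1"
  shows "(\<Sum>i\<in>UNIV. \<Sum>j\<in>UNIV. (a i * b j - a j * b i) * (c i * d j - c j * d i))
    = 2 * ((\<Sum>i\<in>UNIV. a i * c i) * (\<Sum>i\<in>UNIV. b i * d i) - (\<Sum>i\<in>UNIV. a i * d i) * (\<Sum>i\<in>UNIV. b i * c i))"
proof -
  have p: "(\<Sum>i\<in>UNIV. \<Sum>j\<in>UNIV. (u i * v j :: 'a)) = (\<Sum>i\<in>UNIV. u i) * (\<Sum>j\<in>UNIV. v j)" for u v :: "'n \<Rightarrow> 'a"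
    by (simp add: sum_product)
  have "(\<Sum>i\<in>UNIV. \<Sum>j\<in>UNIV. (a i * b j - a j * b i) * (c i * d j - c j * d i))
     = (\<Sum>i\<in>UNIV. \<Sum>j\<in>UNIV. (a i * c i) * (b j * d j)) - (\<Sum>i\<in>UNIV. \<Sum>j\<in>UNIV. (a i * d i) * (b j * c j))
     - (\<Sum>i\<in>UNIV. \<Sum>j\<in>UNIV. (b i * c i) * (a j * d j)) + (\<Sum>i\<in>UNIV. \<Sum>j\<in>UNIV. (b i * d i) * (a j * c j))"
    by (simp add: sum_subtractf[symmetric] sum.distrib[symmetric] algebra_simps)
  then show ?thesis unfolding p by (simp add: algebra_simps)
qed

text \<open>The Binet-Cauchy identity for the vectors \<open>x\<close> and \<open>grad f\<close>:
  half of the sum is \<open>r^4\<close> times the squared Euclidean gradient along the sphere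
  through the point, divided by \<open>r^2\<close>.\<close>

lemma sum_rot_sq: "(\<Sum>a\<in>UNIV. rot a f * rot a f) = 2 * (nrm * nrm * (\<Sum>i\<in>UNIV. pd i f * pd i f) - eul f * eul f)"
  unfolding sum_pairs rot_def nrm_sq eul_def fst_conv snd_conv lagrange_identity
  by (simp add: mult.commute[of "pd _ f" "coord _"])

definition hess2 :: "'n::finite sfun \<Rightarrow> 'n sfun" where
  "hess2 f = (\<Sum>i\<in>UNIV. \<Sum>j\<in>UNIV. pd i (pd j f) * pd i (pd j f))"

text \<open>\<open>sum_rot_sq\<close> is applied to each \<open>rot a f\<close>. Moving
  \<open>pd m\<close> inside produces Kronecker terms with the gradient plus rotations of the
  Hessian row \<open>m\<close>; their squares and cross terms are three more Lagrange sums. Here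
  \<open>h\<close> is the Hessian applied to \<open>x\<close>.\<close>

lemma sum_rot_rot_sq:
  fixes f :: "'n::finite sfun"
  defines "h \<equiv> \<lambda>i. eul (pd i f)"
  shows "(\<Sum>a\<in>UNIV. \<Sum>b\<in>UNIV. rot b (rot a f) * rot b (rot a f))
    = 4 * (of_real (real CARD('n) - 2) * (nrm * nrm) * (\<Sum>i\<in>UNIV. pd i f * pd i f)
        + nrm * nrm * (nrm * nrm) * hess2 f - 2 * (nrm * nrm) * (\<Sum>i\<in>UNIV. h i * h i)
        - 2 * (nrm * nrm) * (lap f * eul f) + (eul f + (\<Sum>i\<in>UNIV. coord i * h i)) * (eul f + (\<Sum>i\<in>UNIV. coord i * h i)))"
proof -
  let ?p = "\<lambda>i. pd i f"
  let ?H = "\<lambda>i j. pd i (pd j f)"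
  let ?PP = "\<Sum>i\<in>UNIV. ?p i * ?p i" and ?hh = "\<Sum>i\<in>UNIV. h i * h i" and ?ph = "\<Sum>i\<in>UNIV. ?p i * h i"
  let ?d = "\<lambda>m k::'n. (if m = k then 1 else 0) :: 'n sfun"
  have hi: "eul (pd i f) = h i" for i by (simp add: h_def)
  have hH: "h m = (\<Sum>l\<in>UNIV. coord l * ?H m l)" for m
    by (simp add: h_def eul_def pd_commute[of _ m])
  have 1: "(\<Sum>a\<in>UNIV. pd m (rot a f) * pd m (rot a f))
      = 2 * (?PP - ?p m * ?p m) + 4 * (coord m * (\<Sum>l\<in>UNIV. ?p l * ?H m l) - ?H m m * eul f)
        + 2 * (nrm * nrm * (\<Sum>l\<in>UNIV. ?H m l * ?H m l) - h m * h m)" for m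
  proof -
    have "(\<Sum>a\<in>UNIV. pd m (rot a f) * pd m (rot a f))
      = (\<Sum>k\<in>UNIV. \<Sum>l\<in>UNIV. (?d m k * ?p l - ?d m l * ?p k) * (?d m k * ?p l - ?d m l * ?p k))
      + 2 * (\<Sum>k\<in>UNIV. \<Sum>l\<in>UNIV. (?d m k * ?p l - ?d m l * ?p k) * (coord k * ?H m l - coord l * ?H m k))
      + (\<Sum>k\<in>UNIV. \<Sum>l\<in>UNIV. (coord k * ?H m l - coord l * ?H m k) * (coord k * ?H m l - coord l * ?H m k))"
    proof -
      have e: "pd m (rot (k, l) f) = (?d m k * ?p l - ?d m l * ?p k) + (coord k * ?H m l - coord l * ?H m k)" for k l
        by (simp add: rot_def)
      show ?thesis unfolding sum_pairs e
        by (simp add: sum_distrib_left sum.distrib[symmetric] algebra_simps del: delta_mult)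
    qed
    also have "\<dots> = 2 * (?PP - ?p m * ?p m) + 2 * (2 * (coord m * (\<Sum>l\<in>UNIV. ?p l * ?H m l) - ?H m m * eul f))
        + 2 * (nrm * nrm * (\<Sum>l\<in>UNIV. ?H m l * ?H m l) - h m * h m)"
      unfolding lagrange_identity
      by (simp add: hH nrm_sq eul_def mult.commute[of "pd _ _" "coord _"])
    finally show ?thesis by simp
  qed
  have ph: "(\<Sum>m\<in>UNIV. coord m * (\<Sum>l\<in>UNIV. ?p l * ?H m l)) = ?ph"
    unfolding hH sum_distrib_left
    by (subst sum.swap) (intro sum.cong refl, simp add: pd_commute mult_ac)
  have 2: "(\<Sum>m\<in>UNIV. \<Sum>a\<in>UNIV. pd m (rot a f) * pd m (rot a f))
      = 2 * (of_nat CARD('n) * ?PP - ?PP) + 4 * (?ph - lap f * eul f) + 2 * (nrm * nrm * hess2 f - ?hh)"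
    unfolding 1 by (simp add: sum.distrib sum_subtractf sum_distrib_left[symmetric] sum_distrib_right[symmetric] ph hess2_def lap_def)
  have 3: "(\<Sum>a\<in>UNIV. eul (rot a f) * eul (rot a f))
      = 2 * (nrm * nrm * (?PP + 2 * ?ph + ?hh) - eul (eul f) * eul (eul f))"
  proof -
    have "(\<Sum>i\<in>UNIV. (?p i + h i) * (?p i + h i)) = (\<Sum>i\<in>UNIV. ?p i * ?p i + 2 * (?p i * h i) + h i * h i)"
      by (simp add: algebra_simps)
    also have "\<dots> = ?PP + 2 * ?ph + ?hh" by (simp only: sum.distrib sum_distrib_left)
    finally show ?thesis unfolding rot_eul[symmetric] sum_rot_sq pd_eul hi by simp
  qed
  have "(\<Sum>a\<in>UNIV. \<Sum>b\<in>UNIV. rot b (rot a f) * rot b (rot a f))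
     = 2 * (nrm * nrm * (\<Sum>m\<in>UNIV. \<Sum>a\<in>UNIV. pd m (rot a f) * pd m (rot a f)) - (\<Sum>a\<in>UNIV. eul (rot a f) * eul (rot a f)))"
    unfolding sum_rot_sq sum_distrib_left[symmetric] sum_subtractf
    by (subst sum.swap) simp
  then show ?thesis unfolding 2 3 eul_eul hi by (simp add: algebra_simps)
qed

text \<open>Cauchy--Schwarz for the trace of the Hessian compressed to the hyperplane orthogonal to \<open>x\<close>.\<close>

lemma tangential_trace_le:
  fixes H :: "'n::finite \<Rightarrow> 'n \<Rightarrow> real" and x :: "'n \<Rightarrow> real"
  assumes sym: "\<And>i j. H i j = H j i"
  defines "s \<equiv> \<Sum>i\<in>UNIV. x i * x i" and "h \<equiv> \<lambda>i. \<Sum>j\<in>UNIV. x j * H i j"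
  defines "xh \<equiv> \<Sum>i\<in>UNIV. x i * h i"
  assumes s: "s > 0" and N: "CARD('n) \<ge> 2"
  shows "(s * (\<Sum>i\<in>UNIV. H i i) - xh)\<^sup>2
    \<le> (real CARD('n) - 1) * (s * s * (\<Sum>i\<in>UNIV. \<Sum>j\<in>UNIV. H i j * H i j) - 2 * s * (\<Sum>i\<in>UNIV. h i * h i) + xh * xh)"
proof -
  let ?HH = "\<Sum>i\<in>UNIV. \<Sum>j\<in>UNIV. H i j * H i j" and ?hh = "\<Sum>i\<in>UNIV. h i * h i" and ?tr = "\<Sum>i\<in>UNIV. H i i"
  define t where "t = (s * ?tr - xh) / (real CARD('n) - 1)"
  define c where "c = (xh + t) / s"
  have cs: "c * s = xh + t" using s by (simp add: c_def)
  define b where "b i = c * x i - h i" for i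
  \<comment> \<open>With \<open>P\<close> the projection orthogonal to \<open>x\<close>, this is
    \<open>s P H P - t P\<close>: expanding \<open>b\<close> gives the terms
    \<open>- h x^T + c x x^T\<close>. By the choice of \<open>t\<close> it is trace-free, and its
    squared norm yields the Cauchy-Schwarz defect.\<close>
  let ?M = "\<lambda>i j. s * H i j - x i * h j + b i * x j - (if i = j then t else 0)"
  have row: "(\<Sum>j\<in>UNIV. ?M i j * ?M i j) = s * s * (\<Sum>j\<in>UNIV. H i j * H i j) + x i * x i * ?hh + b i * b i * s + t * t
      - 2 * s * (\<Sum>j\<in>UNIV. x i * H i j * h j) + 2 * s * b i * h i - 2 * s * t * H i i - 2 * x i * b i * xh + 2 * t * x i * h i - 2 * t * b i * x i" for i
  proof -
    have "?M i j * ?M i j = s * s * (H i j * H i j) + x i * x i * (h j * h j) + b i * b i * (x j * x j) + (if i = j then t * t else 0)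
      - 2 * s * (x i * H i j * h j) + 2 * s * b i * (x j * H i j) - (if i = j then 2 * s * t * H i i else 0)
      - 2 * x i * b i * (x j * h j) + (if i = j then 2 * t * x i * h i else 0) - (if i = j then 2 * t * b i * x i else 0)" for j
      by (simp add: algebra_simps)
    then show ?thesis
      by (simp add: sum.distrib sum_subtractf sum_distrib_left[symmetric])
         (simp add: s_def h_def xh_def)
  qed
  have xHh: "(\<Sum>i\<in>UNIV. \<Sum>j\<in>UNIV. x i * H i j * h j) = ?hh"
    by (subst sum.swap) (simp add: h_def sum_distrib_right sym)
  have bb: "(\<Sum>i\<in>UNIV. b i * b i) = c * c * s - 2 * c * xh + ?hh"
    by (simp add: b_def algebra_simps sum.distrib sum_subtractf)
       (simp add: s_def xh_def sum_distrib_left algebra_simps)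
  have bh: "(\<Sum>i\<in>UNIV. b i * h i) = c * xh - ?hh"
    by (simp add: b_def algebra_simps sum_subtractf) (simp add: xh_def sum_distrib_left algebra_simps)
  have xb: "(\<Sum>i\<in>UNIV. x i * b i) = c * s - xh"
    by (simp add: b_def algebra_simps sum_subtractf) (simp add: xh_def s_def sum_distrib_left algebra_simps)
  have "0 \<le> (\<Sum>i\<in>UNIV. \<Sum>j\<in>UNIV. ?M i j * ?M i j)" by (intro sum_nonneg) simp
  also have "\<dots> = s * s * ?HH + s * ?hh + s * (\<Sum>i\<in>UNIV. b i * b i) + real CARD('n) * (t * t)
      - 2 * s * ?hh + 2 * s * (\<Sum>i\<in>UNIV. b i * h i) - 2 * s * t * ?tr - 2 * xh * (\<Sum>i\<in>UNIV. x i * b i) + 2 * t * xh - 2 * t * (\<Sum>i\<in>UNIV. x i * b i)"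
  proof -
    have "(\<Sum>i\<in>UNIV. x i * x i * ?hh) = s * ?hh" by (simp add: s_def sum_distrib_right)
    moreover have "(\<Sum>i\<in>UNIV. b i * b i * s) = s * (\<Sum>i\<in>UNIV. b i * b i)" by (simp add: sum_distrib_left mult_ac)
    moreover have "(\<Sum>i\<in>UNIV. 2 * s * (\<Sum>j\<in>UNIV. x i * H i j * h j)) = 2 * s * ?hh"
      by (simp only: sum_distrib_left[symmetric] xHh)
    moreover have "(\<Sum>i\<in>UNIV. 2 * s * b i * h i) = 2 * s * (\<Sum>i\<in>UNIV. b i * h i)" by (simp add: sum_distrib_left mult_ac)
    moreover have "(\<Sum>i\<in>UNIV. 2 * s * t * H i i) = 2 * s * t * ?tr" by (simp add: sum_distrib_left)
    moreover have "(\<Sum>i\<in>UNIV. 2 * x i * b i * xh) = 2 * xh * (\<Sum>i\<in>UNIV. x i * b i)" by (simp add: sum_distrib_left mult_ac)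
    moreover have "(\<Sum>i\<in>UNIV. 2 * t * x i * h i) = 2 * t * xh" by (simp add: xh_def sum_distrib_left mult_ac)
    moreover have "(\<Sum>i\<in>UNIV. 2 * t * b i * x i) = 2 * t * (\<Sum>i\<in>UNIV. x i * b i)" by (simp add: sum_distrib_left mult_ac)
    moreover have "(\<Sum>i\<in>UNIV. s * s * (\<Sum>j\<in>UNIV. H i j * H i j)) = s * s * ?HH" by (simp only: sum_distrib_left)
    moreover have "sum (\<lambda>i. t * t) (UNIV :: 'n set) = real CARD('n) * (t * t)" by simp
    ultimately show ?thesis unfolding row by (simp only: sum.distrib sum_subtractf)
  qed
  also have "\<dots> = (s * s * ?HH - 2 * s * ?hh + xh * xh) - 2 * t * (s * ?tr - xh) + (real CARD('n) - 1) * (t * t)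
       + (c * s - (xh + t)) * (c * s - (xh + t))"
    unfolding bb bh xb by (simp add: algebra_simps)
  also have "\<dots> = (s * s * ?HH - 2 * s * ?hh + xh * xh) - 2 * t * (s * ?tr - xh) + (real CARD('n) - 1) * (t * t)"
    using cs by simp
  also have "\<dots> = (s * s * ?HH - 2 * s * ?hh + xh * xh) - (s * ?tr - xh)\<^sup>2 / (real CARD('n) - 1)"
  proof -
    define m where "m = real CARD('n) - 1"
    have m: "m > 0" using N by (simp add: m_def)
    then have "s * ?tr - xh = m * t" by (simp add: t_def m_def)
    then show ?thesis using m unfolding m_def[symmetric] by (simp add: power2_eq_square)
  qed
  finally show ?thesis using N by (simp add: field_simps)
qed

text \<open>On the unit sphere the bracket is four times the squared norm of the spherical Hessian
  of \<open>f\<close>: the subtracted term removes the Ricci curvature \<open>N - 2\<close>. Since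
  \<open>cas f\<close> is the trace of that Hessian on a space of dimension \<open>N - 1\<close>,
  this is Cauchy-Schwarz.\<close>

lemma bochner_pointwise:
  fixes f :: "'n::finite sfun"
  assumes x: "x \<noteq> 0" and N: "CARD('n) \<ge> 2"
  shows "4 * (ev (cas f) x)\<^sup>2 \<le> (real CARD('n) - 1) *
    (ev (\<Sum>a\<in>UNIV. \<Sum>b\<in>UNIV. rot b (rot a f) * rot b (rot a f)) x - 2 * (real CARD('n) - 2) * ev (\<Sum>a\<in>UNIV. rot a f * rot a f) x)"
proof -
  define n where "n = real CARD('n)"
  define s where "s = (\<Sum>i\<in>UNIV. ev (coord i) x * ev (coord i) x)"
  define h where "h i = (\<Sum>j\<in>UNIV. ev (coord j) x * ev (pd i (pd j f)) x)" for i
  define xh where "xh = (\<Sum>i\<in>UNIV. ev (coord i) x * h i)"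
  define c where "c = ev (eul f) x"
  define P where "P = (\<Sum>i\<in>UNIV. ev (pd i f) x * ev (pd i f) x)"
  define HH where "HH = (\<Sum>i\<in>UNIV. \<Sum>j\<in>UNIV. ev (pd i (pd j f)) x * ev (pd i (pd j f)) x)"
  define tr where "tr = (\<Sum>i\<in>UNIV. ev (pd i (pd i f)) x)"
  have rr: "ev nrm x * ev nrm x = s" using arg_cong[OF nrm_sq, of "\<lambda>f. ev f x"] by (simp add: s_def)
  have rr': "ev nrm x * (ev nrm x * z) = s * z" for z by (simp flip: rr)
  have s: "s > 0" using x by (simp add: ev_nrm flip: rr)
  have hh: "ev (eul (pd i f)) x = h i" for i
    by (simp add: eul_def h_def pd_commute[of i])
  have lap: "ev (lap f) x = tr" by (simp add: lap_def tr_def)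
  have ineq: "(s * tr - xh)\<^sup>2 \<le> (n - 1) * (s * s * HH - 2 * s * (\<Sum>i\<in>UNIV. h i * h i) + xh * xh)"
    using tangential_trace_le[of "\<lambda>i j. ev (pd i (pd j f)) x" "\<lambda>i. ev (coord i) x"] s N pd_commute[of _ _ f]
    unfolding s_def h_def xh_def HH_def tr_def n_def by metis
  have e1: "ev (cas f) x = (s * tr - xh) - (n - 1) * c"
    using x by (simp add: cas_def eul_eul hh rr lap xh_def[symmetric] c_def[symmetric] n_def) (simp add: algebra_simps)
  have e2: "ev (\<Sum>a\<in>UNIV. rot a f * rot a f) x = 2 * (s * P - c * c)"
    unfolding sum_rot_sq using x by (simp add: rr P_def c_def)
  have e3: "ev (\<Sum>a\<in>UNIV. \<Sum>b\<in>UNIV. rot b (rot a f) * rot b (rot a f)) x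
    = 4 * ((n - 2) * s * P + s * s * HH - 2 * s * (\<Sum>i\<in>UNIV. h i * h i) - 2 * s * (tr * c) + (c + xh) * (c + xh))"
    unfolding sum_rot_rot_sq using x
    by (simp add: rr rr' hh lap P_def c_def xh_def n_def HH_def hess2_def)
  \<comment> \<open>The radial derivative \<open>c\<close> drops out: it shifts the compressed
    Hessian by a multiple of the identity, which does not affect the defect in the trace
    inequality.\<close>
  have "(n - 1) * (4 * ((n - 2) * s * P + s * s * HH - 2 * s * H2 - 2 * s * (tr * c) + (c + xh) * (c + xh))
      - 2 * (n - 2) * (2 * (s * P - c * c))) - 4 * ((s * tr - xh) - (n - 1) * c)\<^sup>2
    = 4 * ((n - 1) * (s * s * HH - 2 * s * H2 + xh * xh) - (s * tr - xh)\<^sup>2)" for H2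
    by (simp add: power2_eq_square algebra_simps)
  with ineq show ?thesis unfolding e1 e2 e3 n_def[symmetric] by smt
qed

text \<open>Being radial is expressed by a differential equation rather than by a profile function,
  so that closure under products and inverses is pure algebra.\<close>

definition rad :: "'n::finite sfun \<Rightarrow> bool" where
  "rad h \<longleftrightarrow> (\<forall>i. pd i h = coord i * (nrmi * rd h))"

lemma rad_mult: "rad f \<Longrightarrow> rad g \<Longrightarrow> rad (f * g)"
  by (simp add: rad_def rd_mult algebra_simps)

lemma rad_const: "rad (of_real c)" "rad 1"
  by (simp_all add: rad_def)

lemma rad_nrm: "rad nrm" and rad_nrmi: "rad nrmi"
  by (simp_all add: rad_def algebra_simps)

lemma rad_inverse: "f * g = 1 \<Longrightarrow> rad f \<Longrightarrow> rad g"
  using pd_inverse[of f g] rd_inverse[of f g] by (simp add: rad_def algebra_simps)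

lemma rad_power: "rad f \<Longrightarrow> rad (f ^ n)"
  by (induction n) (auto simp: rad_const rad_mult)

lemma rot_rad: "rad h \<Longrightarrow> rot a h = 0"
  by (simp add: rad_def rot_def algebra_simps)

lemma rd_power: "rd (f ^ n) = of_nat n * f ^ (n - 1) * rd f"
proof (induction n)
  case (Suc n)
  then show ?case by (cases n) (simp_all add: rd_mult algebra_simps)
qed simp

lemma eul_rd: "eul f = nrm * rd f"
  by (simp add: rd_def mult.assoc[symmetric])

lemma sum_pd_coord: "(\<Sum>i\<in>UNIV. pd i (coord i * g)) = of_nat CARD('n) * g + eul (g :: 'n::finite sfun)"
  by (simp add: sum.distrib eul_def)

section \<open>Orders, supports and integrals under the operators\<close>

lemma ord_multI: "ord k f \<Longrightarrow> ord l g \<Longrightarrow> m \<le> k + l \<Longrightarrow> ord m (f * g)"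
  using ord_mult ord_mono by blast

lemma ord_cmult: "ord k f \<Longrightarrow> ord k (of_real c * f)"
  using ord_mult[OF ord_const, of k f c] by simp

lemma ord_eul: "ord k f \<Longrightarrow> ord k (eul f)"
  unfolding eul_def by (intro ord_sum ord_multI[OF ord_coord ord_pd]) auto

lemma ord_rd: "ord k f \<Longrightarrow> ord (k - 1) (rd f)"
  unfolding rd_def by (intro ord_multI[OF ord_nrmi ord_eul]) auto

lemma ord_rot: "ord k f \<Longrightarrow> ord k (rot a f)"
  unfolding rot_def by (intro ord_diff ord_multI[OF ord_coord ord_pd]) auto

lemma csupp_rd: "csupp f \<Longrightarrow> csupp (rd f)"
  unfolding rd_def eul_def by (intro csupp_mult csupp_sum csupp_pd)

lemma csupp_rot: "csupp f \<Longrightarrow> csupp (rot a f)"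
  unfolding rot_def by (intro csupp_diff csupp_mult csupp_pd)

lemma ord_csupp_integrable:
  "CARD('n) \<ge> 3 \<Longrightarrow> ord (-2) f \<Longrightarrow> csupp f \<Longrightarrow> integrable lborel (ev (f :: 'n::finite sfun))"
  using growth_integrable ord_growth by blast

lemma integ_cmult: "integ (of_real c * f) = c * integ f"
proof -
  have "ev (of_real c * f) = (\<lambda>x. c * ev f x)"
    by (rule ext) (metis ev_of_real ev_simps(3,8) mult_zero_right)
  then show ?thesis by (simp add: integ_def)
qed

lemma integ_add: "integrable lborel (ev f) \<Longrightarrow> integrable lborel (ev g) \<Longrightarrow> integ (f + g) = integ f + integ g"
  and integ_diff: "integrable lborel (ev f) \<Longrightarrow> integrable lborel (ev g) \<Longrightarrow> integ (f - g) = integ f - integ g"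
  by (simp_all add: integ_def)

lemma integ_sum: "(\<And>a. a \<in> A \<Longrightarrow> integrable lborel (ev (f a))) \<Longrightarrow> integ (sum f A) = (\<Sum>a\<in>A. integ (f a))"
  by (simp add: integ_def)

subsection \<open>Identities in the algebra of operators\<close>

text \<open>For \<open>q = \<psi>'/\<psi>\<close> and \<open>m = N - 1\<close>, \<open>rdiv m q A\<close> is the Riemannian divergence of \<open>A \<partial>\<^sub>r\<close>.\<close>

definition rdiv :: "real \<Rightarrow> 'n::finite sfun \<Rightarrow> 'n sfun \<Rightarrow> 'n sfun" where
  "rdiv m q A = rd A + of_real m * q * A"

definition rlap :: "real \<Rightarrow> 'n::finite sfun \<Rightarrow> 'n sfun \<Rightarrow> 'n sfun" where
  "rlap m q f = rdiv m q (rd f)"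

text \<open>For arbitrary \<open>g\<close>: the difference of the squares of
  \<open>u'' + m q u'\<close> and \<open>u'' + g u'\<close> contains
  \<open>2 (m q - g) u' u''\<close>, that is \<open>(m q - g)\<close> times the derivative of
  \<open>u'^2\<close>, which is integrated by parts.\<close>

lemma rlap_square:
  "rlap m q f * rlap m q f = rdiv m q ((of_real m * q - g) * (rd f * rd f))
    + rd f * rd f * (rd g + of_real m * q * g - g * g - of_real m * rd q)
    + (rd (rd f) + g * rd f) * (rd (rd f) + g * rd f)"
  by (simp add: rlap_def rdiv_def rd_mult algebra_simps)

lemma rot_rlap: "rad q \<Longrightarrow> rot a (rlap m q f) = rlap m q (rot a f)"
  by (simp add: rlap_def rdiv_def rot_mult rot_rad rot_rd)

text \<open>Since \<open>w' = - 2 q w\<close>, a factor \<open>w\<close> under the divergence lowers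
  \<open>m\<close> to \<open>m - 2\<close>. The leftover \<open>- 4 w q v v'\<close> is integrated
  by parts, giving the \<open>q\<close> terms, and completing \<open>v'^2\<close> to a square gives
  the \<open>k\<close> terms.\<close>

lemma rlap_hardy:
  assumes w: "rd w = - (2 * q * w)"
  shows "- (2 * (w * rlap m q v * v)) = rdiv m q (- (2 * (w * (v * rd v + (q + k) * (v * v)))))
    + 2 * (w * ((rd v + k * v) * (rd v + k * v)))
    + 2 * (w * (v * v) * (rd q + of_real (m - 2) * (q * q) + rd k + of_real (m - 2) * (q * k) - k * k))"
  by (simp add: rlap_def rdiv_def rd_mult w algebra_simps)

text \<open>Integration by parts in the rotations, using that they annihilate \<open>w\<close> and
  commute with the radial Laplacian: the mixed term becomes a one-dimensional quadratic form in each
  \<open>rot a f\<close>.\<close>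

lemma rlap_cas:
  assumes w: "rad w" and q: "rad q"
  shows "2 * (w * rlap m q f * cas f)
    = (\<Sum>a\<in>UNIV. rot a (w * rlap m q f * rot a f) - w * rlap m q (rot a f) * rot a f)"
proof -
  have "2 * (w * rlap m q f * cas f) = w * rlap m q f * (\<Sum>a\<in>UNIV. rot a (rot a f))"
    by (simp add: sum_rot_rot algebra_simps)
  then show ?thesis
    by (simp add: sum_distrib_left rot_mult rot_rad[OF w] rot_rlap[OF q])
qed

text \<open>Two integrations by parts; since rotations commute with \<open>cas\<close>, both
  divergences produce the same terms \<open>w * rot a f * cas (rot a f)\<close>, and these
  cancel.\<close>

lemma cas_square:
  assumes w: "rad w"
  shows "4 * (w * (cas f * cas f)) = (\<Sum>a\<in>UNIV. rot a (2 * w * cas f * rot a f))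
    - (\<Sum>a\<in>UNIV. \<Sum>b\<in>UNIV. rot b (w * rot a f * rot b (rot a f)))
    + w * (\<Sum>a\<in>UNIV. \<Sum>b\<in>UNIV. rot b (rot a f) * rot b (rot a f))"
proof -
  have 1: "(\<Sum>b\<in>UNIV. rot b (w * rot a f * rot b (rot a f))) = w * (\<Sum>b\<in>UNIV. rot b (rot a f) * rot b (rot a f))
     + 2 * (w * rot a f * cas (rot a f))" for a
  proof -
    have "(\<Sum>b\<in>UNIV. rot b (w * rot a f * rot b (rot a f)))
      = w * (\<Sum>b\<in>UNIV. rot b (rot a f) * rot b (rot a f)) + w * rot a f * (\<Sum>b\<in>UNIV. rot b (rot b (rot a f)))"
      by (simp add: rot_mult rot_rad[OF w] sum.distrib sum_distrib_left distrib_left mult.assoc)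
    then show ?thesis by (simp add: sum_rot_rot algebra_simps)
  qed
  have 2: "(\<Sum>a\<in>UNIV. rot a (2 * w * cas f * rot a f)) = 4 * (w * (cas f * cas f)) + (\<Sum>a\<in>UNIV. 2 * (w * rot a f * cas (rot a f)))"
  proof -
    have "(\<Sum>a\<in>UNIV. rot a (2 * w * cas f * rot a f))
      = 2 * w * cas f * (\<Sum>a\<in>UNIV. rot a (rot a f)) + (\<Sum>a\<in>UNIV. 2 * (w * rot a f * cas (rot a f)))"
      by (simp add: rot_mult rot_rad[OF w] rot_cas sum.distrib sum_distrib_left distrib_left mult_ac)
    then show ?thesis by (simp add: sum_rot_rot algebra_simps)
  qed
  show ?thesis unfolding 1 2 by (simp add: sum.distrib sum_distrib_left)
qed

text \<open>The field is orthogonal to \<open>x\<close>, so a radial factor passes through its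
  divergence.\<close>

lemma div_tangential:
  assumes "rad h"
  shows "(\<Sum>i\<in>UNIV. pd i (h * (nrm * nrm * pd i f - coord i * eul f))) = h * cas (f :: 'n::finite sfun)"
proof -
  have 1: "(\<Sum>i\<in>UNIV. coord i * (nrm * nrm * pd i f - coord i * eul f)) = 0"
  proof -
    have "(\<Sum>i\<in>UNIV. coord i * (nrm * nrm * pd i f - coord i * eul f))
      = nrm * nrm * (\<Sum>i\<in>UNIV. coord i * pd i f) - (\<Sum>i\<in>UNIV. coord i * coord i) * eul f"
      by (simp add: algebra_simps sum_subtractf sum_distrib_left sum_distrib_right)
    then show ?thesis by (simp add: eul_def nrm_sq)
  qed
  have 2: "(\<Sum>i\<in>UNIV. pd i (nrm * nrm * pd i f - coord i * eul f)) = cas f"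
  proof -
    have "(\<Sum>i\<in>UNIV. pd i (nrm * nrm * pd i f)) = (\<Sum>i\<in>UNIV. 2 * ((nrm * nrmi) * (coord i * pd i f)) + nrm * nrm * pd i (pd i f))"
      by (intro sum.cong refl) (simp del: nrm_nrmi add: algebra_simps)
    also have "\<dots> = 2 * eul f + nrm * nrm * lap f"
      by (simp add: sum.distrib sum_distrib_left eul_def lap_def)
    finally show ?thesis unfolding pd_diff sum_subtractf sum_pd_coord by (simp add: cas_def algebra_simps)
  qed
  have "(\<Sum>i\<in>UNIV. pd i (h * (nrm * nrm * pd i f - coord i * eul f)))
    = (\<Sum>i\<in>UNIV. nrmi * rd h * (coord i * (nrm * nrm * pd i f - coord i * eul f)) + h * pd i (nrm * nrm * pd i f - coord i * eul f))"
    using assms by (intro sum.cong refl) (simp only: pd_mult[of _ h], simp add: rad_def mult_ac)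
  also have "\<dots> = nrmi * rd h * (\<Sum>i\<in>UNIV. coord i * (nrm * nrm * pd i f - coord i * eul f)) + h * (\<Sum>i\<in>UNIV. pd i (nrm * nrm * pd i f - coord i * eul f))"
    by (simp only: sum.distrib sum_distrib_left)
  finally show ?thesis unfolding 1 2 by simp
qed

text \<open>The hypothesis is the logarithmic derivative of \<open>(psi / r) ^ (N - 1)\<close>. Its
  part \<open>- (N - 1) / r\<close> cancels the Euclidean divergence of
  \<open>x / r\<close>.\<close>

lemma div_radial:
  assumes "rd \<rho> = of_real (real CARD('n) - 1) * ((q - nrmi) * \<rho>)"
  shows "(\<Sum>i\<in>UNIV. pd i (coord i * (nrmi * (\<rho> * A)))) = \<rho> * rdiv (real CARD('n) - 1) q (A :: 'n::finite sfun)"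
proof -
  have "(\<Sum>i\<in>UNIV. pd i (coord i * (nrmi * (\<rho> * A))))
     = of_nat CARD('n) * (nrmi * (\<rho> * A)) - (nrm * nrmi) * (nrmi * \<rho> * A) + (nrm * nrmi) * (rd \<rho> * A + \<rho> * rd A)"
    unfolding sum_pd_coord eul_rd rd_mult by (simp only: rd_nrmi) (simp add: algebra_simps del: nrm_nrmi)
  then show ?thesis unfolding assms nrm_nrmi by (simp add: rdiv_def algebra_simps)
qed

subsection \<open>The model metric\<close>

text \<open>The last two assumptions are the curvature conditions \<open>K_rad <= -1\<close> and
  \<open>K_rad >= H_tan\<close> with denominators cleared.\<close>

locale warped_model =
  fixes D :: "nat \<Rightarrow> real \<Rightarrow> real"
  assumes Dk: "\<And>k r. r \<ge> 0 \<Longrightarrow> (D k has_real_derivative D (Suc k) r) (at r within {0..})"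
    and D0_pos: "\<And>r. r > 0 \<Longrightarrow> D 0 r > 0"
    and D0_0: "D 0 0 = 0"
    and D1_0: "D 1 0 = 1"
    and D2_ge: "\<And>r. r > 0 \<Longrightarrow> D 0 r \<le> D 2 r"
    and D1_ge: "\<And>r. r > 0 \<Longrightarrow> D 0 r * D 2 r + 1 \<le> (D 1 r)\<^sup>2"
begin

lemma D_deriv: "r > 0 \<Longrightarrow> (D k has_real_derivative D (Suc k) r) (at r)"
proof -
  assume r: "r > 0"
  have "at r within {0..} = at r" by (rule at_within_interior) (use r in simp)
  then show ?thesis using Dk[of r k] r by simp
qed

lemma D_cont: "continuous_on {0..} (D k)"
  using Dk by (meson DERIV_continuous atLeast_iff continuous_on_eq_continuous_within)

lemma D_bounded: "\<exists>C. \<forall>r. 0 \<le> r \<longrightarrow> r \<le> R \<longrightarrow> \<bar>D k r\<bar> \<le> C"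
proof -
  have "compact (D k ` {0..R})"
    by (intro compact_continuous_image continuous_on_subset[OF D_cont]) auto
  then show ?thesis by (fastforce dest!: compact_imp_bounded simp: bounded_iff)
qed

lemma D1_ge_1:
  assumes "r \<ge> 0"
  shows "D 1 r \<ge> 1"
proof (cases "r = 0")
  case False
  then have "r > 0" using assms by simp
  have "D 1 0 \<le> D 1 r"
  proof (rule DERIV_nonneg_imp_increasing_open[of 0 r "D 1"])
    show "\<exists>y. (D 1 has_real_derivative y) (at x) \<and> 0 \<le> y" if "0 < x" "x < r" for x
      using D_deriv[OF that(1), of 1] D2_ge[OF that(1)] D0_pos[OF that(1)]
      by (intro exI[of _ "D 2 x"]) (auto simp: numeral_2_eq_2)
  qed (use assms in \<open>auto intro: continuous_on_subset[OF D_cont]\<close>)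
  then show ?thesis using D1_0 by simp
qed (use D1_0 in simp)

text \<open>\<open>psi'' >= psi > 0\<close> and \<open>psi'(0) = 1\<close> gave
  \<open>psi' >= 1\<close>, which is integrated here. It controls \<open>1 / psi\<close> by
  \<open>1 / r\<close> and thus fixes the order of \<open>psi_inv\<close>.\<close>

lemma D0_ge:
  assumes "r \<ge> 0"
  shows "D 0 r \<ge> r"
proof -
  have "D 0 0 - 0 \<le> D 0 r - r"
  proof (rule DERIV_nonneg_imp_increasing_open[of 0 r "\<lambda>r. D 0 r - r"])
    show "\<exists>y. ((\<lambda>r. D 0 r - r) has_real_derivative y) (at x) \<and> 0 \<le> y" if "0 < x" "x < r" for x
      using D_deriv[OF that(1), of 0] D1_ge_1[of x] that
      by (intro exI[of _ "D 1 x - 1"]) (auto intro!: derivative_eq_intros)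
  qed (use assms in \<open>auto intro!: continuous_intros continuous_on_subset[OF D_cont]\<close>)
  then show ?thesis using D0_0 by simp
qed

lemma D0_le:
  assumes R: "R > 0"
  obtains C where "\<And>r. 0 \<le> r \<Longrightarrow> r \<le> R \<Longrightarrow> D 0 r \<le> C * r"
proof -
  obtain C where C: "\<And>r. 0 \<le> r \<Longrightarrow> r \<le> R \<Longrightarrow> \<bar>D 1 r\<bar> \<le> C" using D_bounded[of R 1] by blast
  have "D 0 r \<le> C * r" if r: "0 \<le> r" "r \<le> R" for r
  proof -
    have "C * 0 - D 0 0 \<le> C * r - D 0 r"
    proof (rule DERIV_nonneg_imp_increasing_open[of 0 r "\<lambda>r. C * r - D 0 r"])
      show "\<exists>y. ((\<lambda>r. C * r - D 0 r) has_real_derivative y) (at x) \<and> 0 \<le> y" if "0 < x" "x < r" for x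
        using D_deriv[OF that(1), of 0] C[of x] that r
        by (intro exI[of _ "C - D 1 x"]) (auto intro!: derivative_eq_intros)
    qed (use r in \<open>auto intro!: continuous_intros continuous_on_subset[OF D_cont]\<close>)
    then show ?thesis using D0_0 by simp
  qed
  then show ?thesis using that by blast
qed

section \<open>The profile, its derivatives and its reciprocal as ring elements\<close>

definition dpsi :: "nat \<Rightarrow> 'n::finite sfun" where "dpsi k = cut0 (\<lambda>x. D k (norm x))"

lemma ev_dpsi: "x \<noteq> 0 \<Longrightarrow> ev (dpsi k) x = D k (norm x)"
  unfolding dpsi_def by (rule ev_cut0[OF Ck_off0_radial]) (auto intro: D_deriv)

lemma pd_dpsi [simp]: "pd i (dpsi k) = dpsi (Suc k) * (coord i * nrmi)"
proof (rule sfun_eqI)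
  fix x :: "real^'a" assume x: "x \<noteq> 0"
  have "pdiff i (ev (dpsi k)) = pdiff i (\<lambda>x. D k (norm x))" by (rule pdiff_cong) (simp add: ev_dpsi)
  then show "ev (pd i (dpsi k)) x = ev (dpsi (Suc k) * (coord i * nrmi)) x"
    using x pdiff_radial(2)[OF x D_deriv, of i k] by (simp add: ev_pd ev_dpsi ev_coord ev_nrmi)
qed

lemma rd_dpsi [simp]: "rd (dpsi k :: 'n::finite sfun) = dpsi (Suc k)"
proof -
  have 1: "eul (dpsi k :: 'n sfun) = dpsi (Suc k) * nrmi * (nrm * nrm)"
    unfolding eul_def nrm_sq by (simp add: sum_distrib_left mult_ac)
  have "rd (dpsi k :: 'n sfun) = dpsi (Suc k) * ((nrm * nrmi) * (nrm * nrmi))"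
    unfolding rd_def 1 by (simp only: mult_ac)
  then show ?thesis by simp
qed

lemma rad_dpsi: "rad (dpsi k)"
  by (simp add: rad_def algebra_simps)

text \<open>Continuity on \<open>[0, R]\<close>, pole included, bounds every derivative of the
  profile. Differentiating in \<open>x\<close> only brings in the next derivative and the factor
  \<open>x $ i / r\<close> of order 0, so the induction stays in the family.\<close>

lemma ord_dpsi_Suc: "ord 0 (dpsi (Suc k) :: 'n::finite sfun)"
proof -
  have g: "growth 0 (dpsi (Suc k) :: 'n sfun)" for k
  proof (rule growthI)
    fix R :: real assume "R > 0"
    obtain C where "\<And>r. 0 \<le> r \<Longrightarrow> r \<le> R \<Longrightarrow> \<bar>D (Suc k) r\<bar> \<le> C" using D_bounded by blast
    then show "\<exists>C. \<forall>x. x \<noteq> 0 \<longrightarrow> norm x \<le> R \<longrightarrow> \<bar>ev (dpsi (Suc k) :: 'n sfun) x\<bar> \<le> C * norm x powi 0"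
      by (intro exI[of _ C]) (simp add: ev_dpsi)
  qed
  have "ordn m 0 (dpsi (Suc k) :: 'n sfun)" for m
  proof (induction m arbitrary: k)
    case (Suc m)
    have p: "ordn m (0 + (1 + -1)) (dpsi (Suc (Suc k)) * (coord i * nrmi))" for i :: 'n
      using ord_coord[of i] ord_nrmi unfolding ord_def by (intro ordn_mult Suc) blast+
    have "ordn m (-1) (dpsi (Suc (Suc k)) * (coord i * nrmi))" for i :: 'n
      by (rule ordn_mono[OF p]) simp
    then show ?case using g[of k] by simp
  qed (use g in simp)
  then show ?thesis by (simp add: ord_def)
qed

lemma ord_dpsi_0: "ord 1 (dpsi 0 :: 'n::finite sfun)"
proof -
  have g: "growth 1 (dpsi 0 :: 'n sfun)"
  proof (rule growthI)
    fix R :: real assume "R > 0"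
    then obtain C where C: "\<And>r. 0 \<le> r \<Longrightarrow> r \<le> R \<Longrightarrow> D 0 r \<le> C * r" using D0_le by blast
    show "\<exists>C. \<forall>x. x \<noteq> 0 \<longrightarrow> norm x \<le> R \<longrightarrow> \<bar>ev (dpsi 0 :: 'n sfun) x\<bar> \<le> C * norm x powi 1"
    proof (intro exI[of _ C] allI impI)
      fix x :: "real^'n" assume "x \<noteq> 0" "norm x \<le> R"
      then show "\<bar>ev (dpsi 0 :: 'n sfun) x\<bar> \<le> C * norm x powi 1"
        using C[of "norm x"] D0_pos[of "norm x"] by (simp add: ev_dpsi)
    qed
  qed
  have p: "ord (0 + (1 + -1)) (dpsi (Suc 0) * (coord i * nrmi))" for i :: 'n
    by (intro ord_mult ord_dpsi_Suc ord_coord ord_nrmi)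
  have "ordn m 1 (dpsi 0 :: 'n sfun)" for m
    using g p by (cases m) (auto simp: ord_def)
  then show ?thesis by (simp add: ord_def)
qed

definition psi_inv :: "'n::finite sfun" where "psi_inv = cut0 (\<lambda>x. inverse (ev (dpsi 0) x))"

lemma dpsi_psi_inv: "dpsi 0 * psi_inv = 1"
  unfolding psi_inv_def
proof (rule sfun_inverse_ex)
  fix x :: "real^'a" assume "x \<noteq> 0"
  then show "ev (dpsi 0) x \<noteq> 0" using D0_pos[of "norm x"] by (simp add: ev_dpsi)
qed

lemma ev_psi_inv: "x \<noteq> 0 \<Longrightarrow> ev psi_inv x = inverse (D 0 (norm x))"
  by (rule inverse_unique[symmetric]) (use arg_cong[OF dpsi_psi_inv, of "\<lambda>f. ev f x"] in \<open>simp add: ev_dpsi\<close>)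

lemma rad_psi_inv: "rad psi_inv"
  by (rule rad_inverse[OF dpsi_psi_inv rad_dpsi])

lemma ord_psi_inv: "ord (-1) (psi_inv :: 'n::finite sfun)"
proof (rule ord_inverse[OF dpsi_psi_inv _ ord_dpsi_0])
  show "growth (- 1) (psi_inv :: 'n sfun)"
  proof (rule growthI, intro exI[of _ 1] allI impI)
    fix R and x :: "real^'n" assume x: "x \<noteq> 0"
    then have "norm x > 0" by simp
    then have "inverse (D 0 (norm x)) \<le> inverse (norm x)" "D 0 (norm x) > 0"
      using D0_ge[of "norm x"] D0_pos by (auto intro!: le_imp_inverse_le)
    then show "\<bar>ev (psi_inv :: 'n sfun) x\<bar> \<le> 1 * norm x powi - 1" using x by (simp add: ev_psi_inv power_int_minus)
  qed
qed

definition q :: "'n::finite sfun" where "q = dpsi 1 * psi_inv"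

lemma rd_psi_inv [simp]: "rd psi_inv = - (q * psi_inv)"
  using rd_inverse[OF dpsi_psi_inv] by (simp add: q_def algebra_simps)

lemma rd_q: "rd q = dpsi 2 * psi_inv - q * q"
  by (simp add: q_def rd_mult numeral_2_eq_2 algebra_simps)

lemma rad_q: "rad q"
  unfolding q_def by (intro rad_mult rad_dpsi rad_psi_inv)

lemma ord_q: "ord (-1) q"
  unfolding q_def using ord_mult[OF ord_dpsi_Suc[of 0] ord_psi_inv] by simp

definition w :: "'n::finite sfun" where "w = psi_inv * psi_inv"

lemma rd_w: "rd w = - (2 * q * w)"
  by (simp add: w_def rd_mult algebra_simps)

lemma rad_w: "rad w"
  unfolding w_def by (intro rad_mult rad_psi_inv)

lemma ord_w: "ord (-2) w"
  unfolding w_def using ord_mult[OF ord_psi_inv ord_psi_inv] by simp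

section \<open>The volume density and divergences of integral zero\<close>

definition rho :: "'n::finite sfun" where "rho = (dpsi 0 * nrmi) ^ (CARD('n) - 1)"

lemma rad_rho: "rad rho"
  unfolding rho_def by (intro rad_power rad_mult rad_dpsi rad_nrmi)

lemma ord_rho: "ord 0 rho"
  unfolding rho_def using ord_mult[OF ord_dpsi_0 ord_nrmi] by (intro ord_power_0) simp

lemma rd_rho: "rd (rho :: 'n::finite sfun) = of_real (real CARD('n) - 1) * ((q - nrmi) * rho)"
proof -
  have 1: "rd (dpsi 0 * nrmi :: 'n sfun) = (q - nrmi) * (dpsi 0 * nrmi)"
  proof -
    have "q * (dpsi 0 * nrmi) = (dpsi 0 * psi_inv) * (dpsi 1 * nrmi :: 'n sfun)" by (simp add: q_def mult_ac)
    then show ?thesis unfolding dpsi_psi_inv by (simp add: rd_mult algebra_simps)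
  qed
  have c: "(of_nat (CARD('n) - 1) :: 'n sfun) = of_real (real CARD('n) - 1)"
    by (metis of_nat_diff of_real_of_nat_eq One_nat_def Suc_leI of_nat_1 zero_less_card_finite)
  have "rd (rho :: 'n sfun) = of_nat (CARD('n) - 1) * ((q - nrmi) * ((dpsi 0 * nrmi) ^ (CARD('n) - 1 - 1) * (dpsi 0 * nrmi)))"
    unfolding rho_def rd_power 1 by (simp only: mult_ac)
  also have "\<dots> = of_nat (CARD('n) - 1) * ((q - nrmi) * rho)"
    by (cases "CARD('n) - 1") (simp_all add: rho_def mult_ac)
  finally show ?thesis unfolding c .
qed

text \<open>Order and support are kept with the vanishing integral to guarantee integrability,
  without which sums of such terms could not be handled.\<close>

definition null :: "'n::finite sfun \<Rightarrow> bool" where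
  "null h \<longleftrightarrow> ord (-2) h \<and> csupp h \<and> integ (rho * h) = 0"

lemma integrable_rho:
  "CARD('n) \<ge> 3 \<Longrightarrow> ord (-2) h \<Longrightarrow> csupp h \<Longrightarrow> integrable lborel (ev (rho * (h :: 'n::finite sfun)))"
  by (intro ord_csupp_integrable ord_multI[OF ord_rho] csupp_mult) auto

lemma null_add: "CARD('n) \<ge> 3 \<Longrightarrow> null h \<Longrightarrow> null h' \<Longrightarrow> null (h + h' :: 'n::finite sfun)"
  by (auto simp: null_def distrib_left integ_add integrable_rho simp del: ev_simps)

lemma null_cmult: "null h \<Longrightarrow> null (of_real c * h)"
  by (auto simp: null_def ord_cmult mult.left_commute[of rho] integ_cmult)

lemma null_diff: "CARD('n) \<ge> 3 \<Longrightarrow> null h \<Longrightarrow> null h' \<Longrightarrow> null (h - h' :: 'n::finite sfun)"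
  using null_add[of h "of_real (-1) * h'"] null_cmult[of h' "-1"] by simp

lemma null_sum: "CARD('n) \<ge> 3 \<Longrightarrow> (\<And>a. a \<in> A \<Longrightarrow> null (f a :: 'n::finite sfun)) \<Longrightarrow> null (sum f A)"
proof (induction A rule: infinite_finite_induct)
  case (insert a A)
  then show ?case by (simp add: null_add)
qed (auto simp: null_def integ_def)

lemma integ_pd_ord:
  assumes "CARD('n) \<ge> 3" "ord (-1) f" "csupp (f :: 'n::finite sfun)"
  shows "integ (pd i f) = 0" "integrable lborel (ev (pd i f))"
proof -
  have o: "ord (-2) (pd i f)" using ord_pd[OF assms(2), of i] by simp
  show "integ (pd i f) = 0"
    by (rule integ_pd_eq_0[OF assms(1) ord_growth[OF assms(2)] ord_growth[OF o] assms(3)])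
  show "integrable lborel (ev (pd i f))"
    by (rule ord_csupp_integrable[OF assms(1) o csupp_pd[OF assms(3)]])
qed

lemma null_rdiv:
  fixes A :: "'n::finite sfun"
  assumes N: "CARD('n) \<ge> 3" and A: "ord (-1) A" "csupp A"
  shows "null (rdiv (real CARD('n) - 1) q A)"
  unfolding null_def
proof (intro conjI)
  have o: "ord (-1) (coord i * (nrmi * (rho * A)))" "csupp (coord i * (nrmi * (rho * A)))" for i
    using A by (auto intro!: ord_multI[OF ord_coord] ord_multI[OF ord_nrmi] ord_multI[OF ord_rho A(1)] order_refl csupp_mult)
  have "integ (rho * rdiv (real CARD('n) - 1) q A) = (\<Sum>i\<in>UNIV. integ (pd i (coord i * (nrmi * (rho * A)))))"
    unfolding div_radial[OF rd_rho, symmetric] by (rule integ_sum) (rule integ_pd_ord[OF N o])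
  also have "\<dots> = 0" using integ_pd_ord(1)[OF N o] by (intro sum.neutral) blast
  finally show "integ (rho * rdiv (real CARD('n) - 1) q A) = 0" .
  have "ord (-2) (rd A)" using ord_rd[OF A(1)] by simp
  then show "ord (-2) (rdiv (real CARD('n) - 1) q A)"
    unfolding rdiv_def by (intro ord_add ord_multI[OF ord_cmult[OF ord_q] A(1)]) auto
  show "csupp (rdiv (real CARD('n) - 1) q A)"
    unfolding rdiv_def by (intro csupp_add csupp_mult csupp_rd A)
qed

text \<open>\<open>B\<close> may be more singular by one power than the field in
  \<open>null_rdiv\<close>, because the rotation field itself vanishes to first order at the pole.
  The density is radial and slips inside the rotation.\<close>

lemma null_rot:
  fixes B :: "'n::finite sfun"
  assumes N: "CARD('n) \<ge> 3" and B: "ord (-2) B" "csupp B"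
  shows "null (rot a B)"
  unfolding null_def
proof (intro conjI)
  have o: "ord (-1) (coord i * (rho * B))" "csupp (coord i * (rho * B))" for i
    using B by (auto intro!: ord_multI[OF ord_coord] ord_multI[OF ord_rho B(1)] csupp_mult)
  have "rho * rot a B = pd (snd a) (coord (fst a) * (rho * B)) - pd (fst a) (coord (snd a) * (rho * B))"
  proof -
    have "rho * rot a B = rot a (rho * B)" by (simp add: rot_mult rot_rad[OF rad_rho])
    then show ?thesis by (simp add: rot_def algebra_simps)
  qed
  then show "integ (rho * rot a B) = 0"
    using integ_diff[OF integ_pd_ord(2)[OF N o] integ_pd_ord(2)[OF N o]] integ_pd_ord(1)[OF N o] by simp
  show "ord (-2) (rot a B)" "csupp (rot a B)" using B by (auto intro: ord_rot csupp_rot)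
qed

text \<open>Here \<open>D 2 * psi_inv\<close>, \<open>w\<close> and \<open>q\<close> stand for \<open>\<psi>''/\<psi>\<close>, \<open>1/\<psi>\<^sup>2\<close> and \<open>\<psi>'/\<psi>\<close>.\<close>

lemma curvature_bounds:
  assumes "x \<noteq> 0"
  shows "1 \<le> D 2 (norm x) * ev psi_inv x" "D 2 (norm x) * ev psi_inv x + ev w x \<le> (ev q x)\<^sup>2" "ev w x > 0"
proof -
  let ?d = "\<lambda>k. D k (norm x)"
  have n: "norm x > 0" using assms by simp
  have d: "?d 0 > 0" using D0_pos[OF n] .
  show "1 \<le> ?d 2 * ev psi_inv x" using D2_ge[OF n] d assms by (simp add: ev_psi_inv field_simps)
  show "ev w x > 0" using d assms by (simp add: w_def ev_psi_inv)
  have "?d 2 * inverse (?d 0) + inverse (?d 0) * inverse (?d 0) = (?d 0 * ?d 2 + 1) * (inverse (?d 0))\<^sup>2"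
    using d by (simp add: field_simps power2_eq_square)
  also have "\<dots> \<le> (?d 1)\<^sup>2 * (inverse (?d 0))\<^sup>2"
    using D1_ge[OF n] by (intro mult_right_mono) auto
  finally show "?d 2 * ev psi_inv x + ev w x \<le> (ev q x)\<^sup>2"
    using assms by (simp add: w_def q_def ev_psi_inv ev_dpsi power_mult_distrib)
qed

text \<open>The right-hand side is the coefficient of \<open>rlap_square\<close>, with
  \<open>q' = Q - S^2\<close>. For \<open>g = m/2 S - R/2\<close>, from the ground state
  \<open>sqrt r * psi^(-m/2)\<close>, the product \<open>g (m S - g)\<close> has no cross term in
  \<open>S R\<close>; \<open>R^2/2 - R^2/4\<close> is the Hardy term.\<close>

lemma rellich_radial_coefficient:
  fixes Q S t R m :: real
  assumes "1 \<le> Q" "Q + t \<le> S\<^sup>2" "t > 0" "m \<ge> 4"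
  defines "g \<equiv> m / 2 * S - R / 2"
  shows "m\<^sup>2 / 4 + R\<^sup>2 / 4 + m * (m + 2) / 4 * t
    \<le> m / 2 * (Q - S\<^sup>2) + R\<^sup>2 / 2 + m * S * g - g * g - m * (Q - S\<^sup>2)"
proof -
  have "(m\<^sup>2 / 4 + m / 2) * (Q + t) \<le> (m\<^sup>2 / 4 + m / 2) * S\<^sup>2"
    using assms by (intro mult_left_mono) auto
  moreover have "m\<^sup>2 / 4 * 1 \<le> m\<^sup>2 / 4 * Q" using assms by (intro mult_left_mono) auto
  moreover have "m / 2 * (Q - S\<^sup>2) + R\<^sup>2 / 2 + m * S * g - g * g - m * (Q - S\<^sup>2)
    = (m\<^sup>2 / 4 + m / 2) * S\<^sup>2 - m / 2 * Q + R\<^sup>2 / 4"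
    by (simp add: g_def power2_eq_square field_simps)
  ultimately show ?thesis by (simp add: power2_eq_square field_simps)
qed

text \<open>The coefficient of \<open>rlap_hardy\<close>, plus the spectral gap contribution
  \<open>m / 2 * t\<close>, must reach half the weight, as the angular energy carries a factor 1/2.
  The function \<open>k\<close> is the radial \<open>g\<close> with \<open>m - 2\<close> in place of
  \<open>m\<close>.\<close>

lemma rellich_angular_coefficient:
  fixes Q S t R m :: real
  assumes "1 \<le> Q" "Q + t \<le> S\<^sup>2" "t > 0" "m \<ge> 4"
  defines "k \<equiv> (m - 2) / 2 * S - R / 2"
  shows "(m\<^sup>2 / 4 + R\<^sup>2 / 4 + m * (m + 2) / 4 * t) / 2
    \<le> (Q - S\<^sup>2) + (m - 2) * S\<^sup>2 + ((m - 2) / 2 * (Q - S\<^sup>2) + R\<^sup>2 / 2) + (m - 2) * (S * k) - k * k + m / 2 * t"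
proof -
  define a where "a = (m - 2) / 2"
  have m: "m = 2 * a + 2" by (simp add: a_def field_simps)
  have a: "a \<ge> 1" using assms by (simp add: a_def)
  have aa: "a * a \<ge> 1 * 1" using a by (intro mult_mono) auto
  \<comment> \<open>The surplus is split into pieces governed by \<open>S^2 >= Q + t\<close>,
    \<open>Q >= 1\<close>, \<open>t > 0\<close> and \<open>a >= 1\<close> in turn. The last means
    \<open>N >= 5\<close>; at \<open>N = 5\<close> the \<open>t\<close> piece vanishes.\<close>
  have "((1 + a) * Q + (a * a + a - 1) * S\<^sup>2 + R\<^sup>2 / 4 + (a + 1) * t)
      - ((a + 1) * (a + 1) + R\<^sup>2 / 4 + (a + 1) * (a + 2) * t) / 2
    = (a * a + a - 1) * (S\<^sup>2 - (Q + t)) + (a * a + 2 * a) * (Q - 1) + (a + 2) * (a - 1) * t / 2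
      + (a * a + 2 * a - 1) / 2 + R\<^sup>2 / 8"
    by (simp add: field_simps)
  moreover have "0 \<le> (a * a + a - 1) * (S\<^sup>2 - (Q + t))" "0 \<le> (a * a + 2 * a) * (Q - 1)"
    "0 \<le> (a + 2) * (a - 1) * t / 2" "0 \<le> (a * a + 2 * a - 1) / 2" "0 \<le> R\<^sup>2 / 8"
    using assms a aa by simp_all
  ultimately have "((a + 1) * (a + 1) + R\<^sup>2 / 4 + (a + 1) * (a + 2) * t) / 2
      \<le> (1 + a) * Q + (a * a + a - 1) * S\<^sup>2 + R\<^sup>2 / 4 + (a + 1) * t"
    by linarith
  moreover have "(Q - S\<^sup>2) + (m - 2) * S\<^sup>2 + ((m - 2) / 2 * (Q - S\<^sup>2) + R\<^sup>2 / 2) + (m - 2) * (S * k) - k * k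
    = (1 + a) * Q + (a * a + a - 1) * S\<^sup>2 + R\<^sup>2 / 4"
    by (simp add: k_def m power2_eq_square field_simps)
  moreover have "(m\<^sup>2 / 4 + R\<^sup>2 / 4 + m * (m + 2) / 4 * t) / 2
    = ((a + 1) * (a + 1) + R\<^sup>2 / 4 + (a + 1) * (a + 2) * t) / 2"
    by (simp add: m power2_eq_square field_simps)
  moreover have "m / 2 * t = (a + 1) * t" by (simp add: m)
  ultimately show ?thesis by linarith
qed

section \<open>The pointwise inequality modulo divergences\<close>

definition energy :: "'n::finite sfun \<Rightarrow> 'n sfun" where
  "energy f = rd f * rd f + w * (of_real (1/2) * (\<Sum>a\<in>UNIV. rot a f * rot a f))"

definition mlap :: "'n::finite sfun \<Rightarrow> 'n sfun" where
  "mlap f = rlap (real CARD('n) - 1) q f + w * cas f"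

definition weight :: "'n::finite sfun" where
  "weight = of_real ((real CARD('n) - 1)\<^sup>2 / 4) + of_real (1/4) * (nrmi * nrmi)
     + of_real (((real CARD('n))\<^sup>2 - 1) / 4) * w"

lemma ev_weight:
  fixes x :: "real^'n::finite"
  defines "m \<equiv> real CARD('n) - 1"
  assumes "x \<noteq> 0"
  shows "ev weight x = m\<^sup>2 / 4 + (inverse (norm x))\<^sup>2 / 4 + m * (m + 2) / 4 * ev w x"
proof -
  have "(real CARD('n))\<^sup>2 - 1 = m * (m + 2)" by (simp add: m_def power2_eq_square algebra_simps)
  then show ?thesis using assms(2) unfolding weight_def m_def[symmetric]
    by (simp add: ev_nrmi power2_eq_square[of "inverse _"])
qed

definition div_radial_part :: "'n::finite sfun \<Rightarrow> 'n sfun" where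
  "div_radial_part f = (let m = real CARD('n) - 1 in
     rdiv m q ((of_real m * q - (of_real (m / 2) * q - of_real (1/2) * nrmi)) * (rd f * rd f)))"

definition div_mixed_part :: "'n::finite sfun \<Rightarrow> 'n sfun" where
  "div_mixed_part f = (let m = real CARD('n) - 1; k = of_real ((m - 2) / 2) * q - of_real (1/2) * nrmi in
     (\<Sum>a\<in>UNIV. rot a (w * rlap m q f * rot a f))
     + of_real (1/2) * (\<Sum>a\<in>UNIV. rdiv m q (- (2 * (w * (rot a f * rd (rot a f) + (q + k) * (rot a f * rot a f)))))))"

definition div_angular_part :: "'n::finite sfun \<Rightarrow> 'n sfun" where
  "div_angular_part f = (\<Sum>a\<in>UNIV. rot a (2 * (w * w) * cas f * rot a f))
     - (\<Sum>a\<in>UNIV. \<Sum>b\<in>UNIV. rot b (w * w * rot a f * rot b (rot a f)))"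

lemma radial_part_bound:
  fixes f :: "'n::finite sfun"
  assumes x: "x \<noteq> 0" and N: "CARD('n) \<ge> 5"
  shows "ev (div_radial_part f) x + ev weight x * (ev (rd f) x)\<^sup>2
    \<le> (ev (rlap (real CARD('n) - 1) q f) x)\<^sup>2"
proof -
  define m where "m = real CARD('n) - 1"
  define g :: "'n sfun" where "g = of_real (m / 2) * q - of_real (1/2) * nrmi"
  have m4: "m \<ge> 4" using N by (simp add: m_def)
  let ?Q = "D 2 (norm x) * ev psi_inv x" and ?S = "ev q x" and ?R = "inverse (norm x)"
  let ?K = "m / 2 * (?Q - ?S\<^sup>2) + ?R\<^sup>2 / 2 + m * ?S * (m / 2 * ?S - ?R / 2) - (m / 2 * ?S - ?R / 2) * (m / 2 * ?S - ?R / 2) - m * (?Q - ?S\<^sup>2)"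
  have eg: "ev g x = m / 2 * ?S - ?R / 2" using x by (simp add: g_def ev_nrmi)
  have K: "ev (rd g + of_real m * q * g - g * g - of_real m * rd q) x = ?K"
    unfolding ev_simps eg using x
    by (simp add: g_def rd_mult rd_q ev_dpsi ev_nrmi power2_eq_square)
  have W: "ev weight x \<le> ?K"
    using rellich_radial_coefficient[OF curvature_bounds[OF x] m4, of ?R]
    unfolding ev_weight[OF x] m_def[symmetric] .
  have "(ev (rlap m q f) x)\<^sup>2 = ev (rlap m q f * rlap m q f) x" by (simp add: power2_eq_square)
  also have "\<dots> = ev (div_radial_part f) x + (ev (rd f) x)\<^sup>2 * ?K + (ev (rd (rd f) + g * rd f) x)\<^sup>2"
    unfolding rlap_square[of m q f g] div_radial_part_def Let_def m_def[symmetric] g_def[symmetric] K[symmetric]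
    by (simp add: power2_eq_square)
  finally show ?thesis
    using mult_left_mono[OF W zero_le_power2[of "ev (rd f) x"]] zero_le_power2[of "ev (rd (rd f) + g * rd f) x"]
    unfolding m_def[symmetric] mult.commute[of "ev weight x"] by linarith
qed

text \<open>The angular weight is reached up to the deficit \<open>(N - 1) / 2 * ev w x\<close>,
  which \<open>angular_part_bound\<close> makes good.\<close>

lemma mixed_part_bound:
  fixes f :: "'n::finite sfun"
  assumes x: "x \<noteq> 0" and N: "CARD('n) \<ge> 5"
  defines "V \<equiv> ev (\<Sum>a\<in>UNIV. rot a f * rot a f) x"
  shows "ev (div_mixed_part f) x + ev w x * V * (ev weight x / 2 - (real CARD('n) - 1) / 2 * ev w x)
    \<le> 2 * (ev w x * ev (rlap (real CARD('n) - 1) q f) x * ev (cas f) x)"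
proof -
  define m where "m = real CARD('n) - 1"
  define k :: "'n sfun" where "k = of_real ((m - 2) / 2) * q - of_real (1/2) * nrmi"
  have m4: "m \<ge> 4" using N by (simp add: m_def)
  let ?Q = "D 2 (norm x) * ev psi_inv x" and ?S = "ev q x" and ?R = "inverse (norm x)"
  let ?K = "(?Q - ?S\<^sup>2) + (m - 2) * ?S\<^sup>2 + ((m - 2) / 2 * (?Q - ?S\<^sup>2) + ?R\<^sup>2 / 2)
    + (m - 2) * (?S * ((m - 2) / 2 * ?S - ?R / 2)) - ((m - 2) / 2 * ?S - ?R / 2) * ((m - 2) / 2 * ?S - ?R / 2)"
  define Kf where "Kf = rd q + of_real (m - 2) * (q * q) + rd k + of_real (m - 2) * (q * k) - k * k"
  have ek: "ev k x = (m - 2) / 2 * ?S - ?R / 2" using x by (simp add: k_def ev_nrmi del: of_real_diff of_real_divide)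
  have K: "ev Kf x = ?K"
    unfolding Kf_def ev_simps ek using x
    by (simp add: k_def rd_mult rd_q ev_dpsi ev_nrmi power2_eq_square del: of_real_diff of_real_divide)
  have W: "ev weight x / 2 - m / 2 * ev w x \<le> ?K"
    using rellich_angular_coefficient[OF curvature_bounds[OF x] m4, of ?R]
    unfolding ev_weight[OF x] m_def[symmetric] by linarith
  define SQ where "SQ a = (rd (rot a f) + k * rot a f) * (rd (rot a f) + k * rot a f)" for a
  define A where "A a = rdiv m q (- (2 * (w * (rot a f * rd (rot a f) + (q + k) * (rot a f * rot a f)))))" for a
  \<comment> \<open>Everything is doubled because \<open>rlap_hardy\<close> treats twice the term
    left over by \<open>rlap_cas\<close>.\<close>
  have 1: "2 * (2 * (w * rlap m q f * cas f))
      = 2 * (\<Sum>a\<in>UNIV. rot a (w * rlap m q f * rot a f)) + (\<Sum>a\<in>UNIV. A a) + 2 * (w * (\<Sum>a\<in>UNIV. SQ a))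
        + 2 * (w * (\<Sum>a\<in>UNIV. rot a f * rot a f) * Kf)"
  proof -
    have "2 * (\<Sum>a\<in>UNIV. rot a (w * rlap m q f * rot a f) - w * rlap m q (rot a f) * rot a f)
      = (\<Sum>a\<in>UNIV. 2 * rot a (w * rlap m q f * rot a f) + - (2 * (w * rlap m q (rot a f) * rot a f)))"
      by (simp add: sum_distrib_left algebra_simps)
    also have "\<dots> = (\<Sum>a\<in>UNIV. 2 * rot a (w * rlap m q f * rot a f)
        + (A a + 2 * (w * SQ a) + 2 * (w * (rot a f * rot a f) * Kf)))"
      unfolding rlap_hardy[OF rd_w, of m _ k] A_def SQ_def Kf_def ..
    finally show ?thesis unfolding rlap_cas[OF rad_w rad_q]
      by (simp only: sum.distrib sum_distrib_left sum_distrib_right add.assoc)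
  qed
  have "4 * (ev w x * ev (rlap m q f) x * ev (cas f) x) = ev (2 * (2 * (w * rlap m q f * cas f))) x"
    using x by simp
  also have "\<dots> = 2 * ev (div_mixed_part f) x + 2 * (ev w x * ev (\<Sum>a\<in>UNIV. SQ a) x) + 2 * (ev w x * V * ?K)"
    unfolding 1 div_mixed_part_def Let_def m_def[symmetric] k_def[symmetric] A_def[symmetric] V_def K[symmetric]
    using x by (simp only: ev_simps ev_numeral ev_of_real) simp
  finally have "2 * (ev w x * ev (rlap m q f) x * ev (cas f) x)
    = ev (div_mixed_part f) x + ev w x * ev (\<Sum>a\<in>UNIV. SQ a) x + ev w x * V * ?K" by simp
  moreover have "0 \<le> ev w x * ev (\<Sum>a\<in>UNIV. SQ a) x"
    using curvature_bounds(3)[OF x] by (simp add: SQ_def sum_nonneg)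
  moreover have "ev w x * V * (ev weight x / 2 - m / 2 * ev w x) \<le> ev w x * V * ?K"
    using curvature_bounds(3)[OF x] by (intro mult_left_mono[OF W]) (simp add: V_def sum_nonneg)
  ultimately show ?thesis unfolding m_def[symmetric] by linarith
qed

text \<open>\<open>cas_square\<close> replaces the double rotation sum in Bochner's inequality by
  \<open>4 (cas f)^2\<close> up to divergence. So \<open>(cas f)^2\<close> stands on both sides with
  net factor \<open>4 (N - 2)\<close>; dividing by it gives the constants.\<close>

lemma angular_part_bound:
  fixes f :: "'n::finite sfun"
  assumes x: "x \<noteq> 0" and N: "CARD('n) \<ge> 5"
  defines "n \<equiv> real CARD('n)"
  shows "(n - 1) / (4 * (n - 2)) * ev (div_angular_part f) x
      + (n - 1) / 2 * (ev w x * ev w x * ev (\<Sum>a\<in>UNIV. rot a f * rot a f) x)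
    \<le> (ev w x * ev (cas f) x)\<^sup>2"
proof -
  define T where "T = ev (\<Sum>a\<in>UNIV. \<Sum>b\<in>UNIV. rot b (rot a f) * rot b (rot a f)) x"
  define V where "V = ev (\<Sum>a\<in>UNIV. rot a f * rot a f) x"
  let ?w = "ev w x * ev w x" and ?c = "(ev (cas f) x)\<^sup>2"
  have n: "n \<ge> 5" using N by (simp add: n_def)
  have b: "4 * ?c \<le> (n - 1) * (T - 2 * (n - 2) * V)"
    using bochner_pointwise[OF x, of f] N unfolding n_def T_def V_def by simp
  have "ev (4 * (w * w * (cas f * cas f))) x = ev (div_angular_part f) x + ?w * T"
    unfolding cas_square[OF rad_mult[OF rad_w rad_w]] div_angular_part_def T_def by (simp only: ev_simps)
  then have T: "?w * T = 4 * (?w * ?c) - ev (div_angular_part f) x" using x by (simp add: power2_eq_square)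
  have "?w * (4 * ?c) \<le> ?w * ((n - 1) * (T - 2 * (n - 2) * V))"
    using b by (rule mult_left_mono) simp
  also have "\<dots> = (n - 1) * (?w * T - 2 * (n - 2) * (?w * V))" by (simp add: algebra_simps)
  finally have "(n - 1) * ev (div_angular_part f) x + 2 * (n - 1) * (n - 2) * (?w * V) \<le> 4 * (n - 2) * (?w * ?c)"
    unfolding T by (simp add: algebra_simps)
  then have "((n - 1) * ev (div_angular_part f) x + 2 * (n - 1) * (n - 2) * (?w * V)) / (4 * (n - 2)) \<le> ?w * ?c"
    using n by (simp add: divide_le_eq mult.commute)
  moreover have "((n - 1) * ev (div_angular_part f) x + 2 * (n - 1) * (n - 2) * (?w * V)) / (4 * (n - 2))
    = (n - 1) / (4 * (n - 2)) * ev (div_angular_part f) x + (n - 1) / 2 * (?w * V)"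
  proof -
    have gen: "(A * d + 2 * A * p * Y) / (4 * p) = A / (4 * p) * d + A / 2 * Y" if "p > 0" for A d p Y :: real
      using that by (simp add: field_simps)
    show ?thesis by (rule gen) (use n in simp)
  qed
  ultimately show ?thesis unfolding V_def by (simp add: power_mult_distrib power2_eq_square mult_ac)
qed

definition div_part :: "'n::finite sfun \<Rightarrow> 'n sfun" where
  "div_part f = div_radial_part f + div_mixed_part f
    + of_real ((real CARD('n) - 1) / (4 * (real CARD('n) - 2))) * div_angular_part f"

text \<open>\<open>mlap f\<close> is a sum of two terms; the three bounds estimate its two squares
  and its cross term, and the angular surplus cancels the mixed deficit.\<close>

lemma rellich_pointwise:
  fixes f :: "'n::finite sfun"
  assumes x: "x \<noteq> 0" and N: "CARD('n) \<ge> 5"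
  shows "ev (div_part f) x + ev weight x * ev (energy f) x \<le> (ev (mlap f) x)\<^sup>2"
proof -
  define V where "V = ev (\<Sum>a\<in>UNIV. rot a f * rot a f) x"
  have e: "ev (energy f) x = (ev (rd f) x)\<^sup>2 + ev w x * V / 2"
    unfolding energy_def V_def using x by (simp add: power2_eq_square del: ev_sum)
  have l: "ev (mlap f) x = ev (rlap (real CARD('n) - 1) q f) x + ev w x * ev (cas f) x"
    by (simp add: mlap_def)
  have d: "ev (div_part f) x = ev (div_radial_part f) x + ev (div_mixed_part f) x
    + (real CARD('n) - 1) / (4 * (real CARD('n) - 2)) * ev (div_angular_part f) x"
    unfolding div_part_def using x by (simp del: of_real_diff of_real_divide of_real_mult)
  show ?thesis
    using radial_part_bound[OF x N, of f] mixed_part_bound[OF x N, of f] angular_part_bound[OF x N, of f]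
    unfolding e l d V_def[symmetric] by (simp add: power2_eq_square algebra_simps)
qed

section \<open>Orders at the pole and integration of the inequality\<close>

lemma ord_rdiv: "ord 0 f \<Longrightarrow> ord (-1) (rdiv c q f)"
  unfolding rdiv_def using ord_rd[of 0 f] ord_mult[OF ord_cmult[OF ord_q], of 0 f] by (intro ord_add) auto

context
  fixes f :: "'n::finite sfun"
  assumes N: "CARD('n) \<ge> 3" and f: "csupp f" "\<And>i. ord 0 (pd i f)"
begin

text \<open>The order assumption is on the first derivatives of \<open>f\<close>: order 0 of
  \<open>f\<close> alone would give only order 0 here, too little to compensate the factors
  \<open>w\<close>.\<close>

lemma ord_rot_f: "ord 1 (rot a f)"
proof -
  have "ord (1 + 0) (rot a f)" unfolding rot_def by (intro ord_diff ord_mult ord_coord f)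
  then show ?thesis by simp
qed

lemma ord_rd_f: "ord 0 (rd f)"
proof -
  have "ord (-1 + (1 + 0)) (rd f)" unfolding rd_def eul_def by (intro ord_mult ord_sum ord_coord ord_nrmi f)
  then show ?thesis by simp
qed

lemma ord_rlap_f: "ord (-1) (rlap c q f)"
  unfolding rlap_def by (rule ord_rdiv[OF ord_rd_f])

lemma ord_cas_f: "ord 1 (cas f)"
proof -
  have eq: "cas f = of_real (1/2) * (2 * cas f)"
    by (rule sfun_eqI) simp
  have "ord 1 (of_real (1/2) * (2 * cas f))"
    unfolding sum_rot_rot[symmetric] by (intro ord_cmult ord_sum ord_rot ord_rot_f)
  then show ?thesis by (subst eq)
qed

lemma csupp_cas_f: "csupp (cas f)"
  unfolding cas_def lap_def eul_def by (intro csupp_diff csupp_sum csupp_mult csupp_pd f)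

lemma csupp_rlap_f: "csupp (rlap c q f)"
  unfolding rlap_def rdiv_def by (intro csupp_add csupp_mult csupp_rd f)

lemma null_div_radial_part: "null (div_radial_part f)"
  unfolding div_radial_part_def Let_def
proof (rule null_rdiv[OF N])
  have "ord (-1 + (0 + 0)) ((of_real (real CARD('n) - 1) * q - (of_real ((real CARD('n) - 1) / 2) * q - of_real (1 / 2) * nrmi)) * (rd f * rd f))"
    by (intro ord_mult ord_diff ord_cmult ord_q ord_nrmi ord_rd_f)
  then show "ord (-1) ((of_real (real CARD('n) - 1) * q - (of_real ((real CARD('n) - 1) / 2) * q - of_real (1 / 2) * nrmi)) * (rd f * rd f))"
    by simp
qed (intro csupp_mult csupp_rd f)

lemma null_div_mixed_part: "null (div_mixed_part f)"
  unfolding div_mixed_part_def Let_def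
proof (intro null_add null_cmult null_sum null_rot null_rdiv N)
  fix a :: "'n \<times> 'n"
  \<comment> \<open>Exactly the strongest singularity that \<open>null_rot\<close> admits.\<close>
  have "ord (-2 + -1 + 1) (w * rlap (real CARD('n) - 1) q f * rot a f)"
    by (intro ord_mult ord_w ord_rlap_f ord_rot_f)
  then show "ord (-2) (w * rlap (real CARD('n) - 1) q f * rot a f)" by simp
  show "csupp (w * rlap (real CARD('n) - 1) q f * rot a f)"
    by (intro csupp_mult csupp_rot f)
  define k :: "'n sfun" where "k = of_real ((real CARD('n) - 1 - 2) / 2) * q - of_real (1/2) * nrmi"
  have k: "ord (-1) (q + k)" unfolding k_def by (intro ord_add ord_diff ord_cmult ord_q ord_nrmi)
  have 1: "ord 1 (rot a f * rd (rot a f))" using ord_mult[OF ord_rot_f ord_rd[OF ord_rot_f]] by simp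
  have 2: "ord 1 ((q + k) * (rot a f * rot a f))" using ord_mult[OF k ord_mult[OF ord_rot_f ord_rot_f]] by simp
  have "ord (0 + (-2 + 1)) (2 * (w * (rot a f * rd (rot a f) + (q + k) * (rot a f * rot a f))))"
    by (intro ord_mult ord_numeral ord_w ord_add 1 2)
  then show "ord (-1) (- (2 * (w * (rot a f * rd (rot a f) + (q + (of_real ((real CARD('n) - 1 - 2) / 2) * q - of_real (1/2) * nrmi)) * (rot a f * rot a f)))))"
    unfolding k_def[symmetric] by (intro ord_minus) simp
  show "csupp (- (2 * (w * (rot a f * rd (rot a f) + (q + (of_real ((real CARD('n) - 1 - 2) / 2) * q - of_real (1/2) * nrmi)) * (rot a f * rot a f)))))"
    by (intro csupp_minus csupp_mult csupp_add csupp_rd csupp_rot f)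
qed

lemma null_div_angular_part: "null (div_angular_part f)"
  unfolding div_angular_part_def
proof (intro null_diff null_sum null_rot N)
  fix a b :: "'n \<times> 'n"
  have "ord (0 + (-2 + -2) + 1 + 1) (2 * (w * w) * cas f * rot a f)"
    by (intro ord_mult ord_numeral ord_w ord_cas_f ord_rot_f)
  then show "ord (-2) (2 * (w * w) * cas f * rot a f)" by simp
  show "csupp (2 * (w * w) * cas f * rot a f)" by (intro csupp_mult csupp_rot f)
  have "ord (-2 + -2 + 1 + 1) (w * w * rot a f * rot b (rot a f))"
    by (intro ord_mult ord_w ord_rot_f ord_rot)
  then show "ord (-2) (w * w * rot a f * rot b (rot a f))" by simp
  show "csupp (w * w * rot a f * rot b (rot a f))" by (intro csupp_mult csupp_rot f)
qed

lemma null_div_part: "null (div_part f)"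
  unfolding div_part_def
  by (intro null_add null_cmult null_div_radial_part null_div_mixed_part null_div_angular_part N)

lemma ord_energy: "ord 0 (energy f)"
proof -
  have "ord 0 (rd f * rd f)" using ord_mult[OF ord_rd_f ord_rd_f] by simp
  moreover have "ord (-2 + (1 + 1)) (w * (of_real (1/2) * (\<Sum>a\<in>UNIV. rot a f * rot a f)))"
    by (intro ord_mult ord_w ord_cmult ord_sum ord_rot_f)
  ultimately show ?thesis unfolding energy_def by (intro ord_add) auto
qed

lemma csupp_energy: "csupp (energy f)"
  unfolding energy_def by (intro csupp_add csupp_mult csupp_sum csupp_rd csupp_rot f)

lemma ord_mlap_sq: "ord (-2) (mlap f * mlap f)"
proof -
  have "ord (-2 + 1) (w * cas f)" by (intro ord_mult ord_w ord_cas_f)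
  then have "ord (-1) (mlap f)" unfolding mlap_def by (intro ord_add ord_rlap_f) simp
  from ord_mult[OF this this] show ?thesis by simp
qed

lemma csupp_mlap_sq: "csupp (mlap f * mlap f)"
  unfolding mlap_def by (intro csupp_mult csupp_add csupp_rlap_f csupp_cas_f)

end

lemma rellich_integrated:
  fixes f :: "'n::finite sfun"
  assumes N: "CARD('n) \<ge> 5" and f: "csupp f" "\<And>i. ord 0 (pd i f)"
  shows "(real CARD('n) - 1)\<^sup>2 / 4 * integ (rho * energy f) + 1 / 4 * integ (rho * (nrmi * nrmi * energy f))
      + ((real CARD('n))\<^sup>2 - 1) / 4 * integ (rho * (w * energy f))
    \<le> integ (rho * (mlap f * mlap f))"
proof -
  have N3: "CARD('n) \<ge> 3" using N by simp
  note o = ord_energy[OF N3 f] and c = csupp_energy[OF N3 f]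
  define h1 h2 h3 where h: "h1 = of_real ((real CARD('n) - 1)\<^sup>2 / 4) * (rho * energy f)"
    "h2 = of_real (1/4) * (rho * (nrmi * nrmi * energy f))"
    "h3 = of_real (((real CARD('n))\<^sup>2 - 1) / 4) * (rho * (w * energy f))"
  define h0 where "h0 = rho * (mlap f * mlap f)"
  define hd where "hd = rho * div_part f"
  have o1: "ord (-2) (energy f)" by (rule ord_mono[OF o]) simp
  have o2: "ord (-2) (nrmi * nrmi * energy f)" using ord_mult[OF ord_mult[OF ord_nrmi ord_nrmi] o] by simp
  have o3: "ord (-2) (w * energy f)" using ord_mult[OF ord_w o] by simp
  have nd: "ord (-2) (div_part f)" "csupp (div_part f)" "integ hd = 0"
    using null_div_part[OF N3 f] by (auto simp: null_def hd_def)
  have int: "integrable lborel (ev h0)" "integrable lborel (ev hd)"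
    unfolding h0_def hd_def
    by (intro integrable_rho[OF N3] ord_mlap_sq[OF N3 f] csupp_mlap_sq[OF N3 f] nd)+
  have int': "integrable lborel (ev h1)" "integrable lborel (ev h2)" "integrable lborel (ev h3)"
    unfolding h using o1 o2 o3 c
    by (auto intro!: ord_csupp_integrable[OF N3] ord_cmult ord_multI[OF ord_rho])
  have "0 \<le> integ (h0 - (hd + (h1 + h2 + h3)))"
    unfolding integ_def
  proof (rule Bochner_Integration.integral_nonneg)
    fix x :: "real^'n"
    show "0 \<le> ev (h0 - (hd + (h1 + h2 + h3))) x"
    proof (cases "x = 0")
      case False
      have eq: "h1 + h2 + h3 = rho * (weight * energy f)"
        unfolding h weight_def by (simp add: algebra_simps del: of_real_diff of_real_divide)
      have "0 \<le> ev rho x"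
        using False D0_pos[of "norm x"] by (simp add: rho_def ev_dpsi ev_nrmi)
      moreover have "0 \<le> (ev (mlap f) x)\<^sup>2 - (ev (div_part f) x + ev weight x * ev (energy f) x)"
        using rellich_pointwise[OF False N, of f] by simp
      ultimately have "0 \<le> ev rho x * ((ev (mlap f) x)\<^sup>2 - (ev (div_part f) x + ev weight x * ev (energy f) x))"
        by (rule mult_nonneg_nonneg)
      then show ?thesis unfolding eq h0_def hd_def by (simp add: power2_eq_square algebra_simps)
    qed simp
  qed
  also have "integ (h0 - (hd + (h1 + h2 + h3))) = integ h0 - (integ hd + (integ h1 + integ h2 + integ h3))"
  proof -
    have "ev (h0 - (hd + (h1 + h2 + h3))) = (\<lambda>x. ev h0 x - (ev hd x + (ev h1 x + ev h2 x + ev h3 x)))" by auto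
    then show ?thesis using int int' unfolding integ_def by simp
  qed
  finally show ?thesis unfolding nd(3) unfolding h h0_def integ_cmult by simp
qed

end

section \<open>Translation between the model in coordinates and the ring\<close>

lemma model_int_eq_integ:
  fixes h :: "real^'n::finite \<Rightarrow> real"
  assumes "\<And>x. x \<noteq> 0 \<Longrightarrow> h x * model_density \<psi> x = ev g x"
  shows "model_int \<psi> h = integ g"
proof -
  \<comment> \<open>The value at the pole is whatever division by zero yields; splitting it off
    shows measurability, and the point is a null set.\<close>
  have eq: "(\<lambda>x. h x * model_density \<psi> x) = (\<lambda>x. if x \<in> {0} then h 0 * model_density \<psi> (0 :: real^'n) else ev g x)"
    by (rule ext) (auto simp: assms)
  show ?thesis unfolding model_int_def integ_def
  proof (rule integral_cong_AE)
    show "(\<lambda>x. h x * model_density \<psi> x) \<in> borel_measurable lborel"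
      unfolding eq by (intro measurable_If_set) auto
    show "AE x in lborel. h x * model_density \<psi> x = ev g x"
      using AE_lborel_singleton[of 0] by eventually_elim (rule assms)
  qed simp
qed

context
  fixes u :: "real^'n::finite \<Rightarrow> real"
  assumes u: "smooth_fun u"
begin

lemma pd_dirderiv: "pd i (cut0 (dirderiv u vs)) = cut0 (dirderiv u (axis i 1 # vs))"
proof (rule sfun_eqI)
  fix x :: "real^'n" assume x: "x \<noteq> 0"
  have "pdiff i (ev (cut0 (dirderiv u vs))) = pdiff i (dirderiv u vs)"
    by (rule pdiff_cong) (simp add: ev_cut0 Ck_off0_smooth_fun u)
  then show "ev (pd i (cut0 (dirderiv u vs))) x = ev (cut0 (dirderiv u (axis i 1 # vs))) x"
    using x ev_cut0[OF Ck_off0_smooth_fun[OF u], of x "axis i 1 # vs"] by (simp add: ev_pd pdiff_def)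
qed

text \<open>Smoothness of \<open>u\<close> at the pole itself enters here: every iterated derivative
  is continuous on the whole space, hence bounded on balls.\<close>

lemma ord_dirderiv: "ord 0 (cut0 (dirderiv u vs))"
proof -
  have g: "growth 0 (cut0 (dirderiv u vs))" for vs
  proof (rule growthI)
    fix R :: real
    have "isCont (dirderiv u vs) x" for x
      using u differentiable_imp_continuous_within unfolding smooth_fun_def by blast
    then have "continuous_on UNIV (dirderiv u vs)" by (simp add: continuous_at_imp_continuous_on)
    then have "compact (dirderiv u vs ` cball 0 R)"
      by (rule compact_continuous_image[OF continuous_on_subset[OF _ subset_UNIV] compact_cball])
    then obtain C where "\<And>x. x \<in> cball 0 R \<Longrightarrow> \<bar>dirderiv u vs x\<bar> \<le> C"
      by (fastforce dest!: compact_imp_bounded simp: bounded_iff)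
    then show "\<exists>C. \<forall>x. x \<noteq> 0 \<longrightarrow> norm x \<le> R \<longrightarrow> \<bar>ev (cut0 (dirderiv u vs)) x\<bar> \<le> C * norm x powi 0"
      by (intro exI[of _ C]) (simp add: ev_cut0 Ck_off0_smooth_fun u)
  qed
  have "ordn m 0 (cut0 (dirderiv u vs))" for m
  proof (induction m arbitrary: vs)
    case (Suc m)
    have "ordn m (0 - 1) (pd i (cut0 (dirderiv u vs)))" for i
      unfolding pd_dirderiv by (rule ordn_mono[OF Suc]) simp
    then show ?case using g by simp
  qed (use g in simp)
  then show ?thesis by (simp add: ord_def)
qed

lemma ev_pd_cut0:
  assumes "x \<noteq> 0" shows "ev (pd i (cut0 u)) x = egrad u x $ i"
  using assms pd_dirderiv[of i "[]"] ev_cut0[OF Ck_off0_smooth_fun[OF u], of x "[axis i 1]"]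
  by (simp add: egrad_def)

lemma csupp_cut0:
  assumes "compact (closure {x. u x \<noteq> 0})"
  shows "csupp (cut0 u)"
proof -
  have "bounded {x. u x \<noteq> 0}" by (rule bounded_subset[OF compact_imp_bounded[OF assms] closure_subset])
  then obtain R where R: "\<And>x. u x \<noteq> 0 \<Longrightarrow> norm x \<le> R" by (auto simp: bounded_iff)
  have "ev (cut0 u) x = 0" if "norm x > R" for x
  proof (cases "x = 0")
    case False
    have "ev (cut0 u) x = u x" using ev_cut0[OF Ck_off0_smooth_fun[OF u], of x "[]"] False by simp
    then show ?thesis using R[of x] that by auto
  qed simp
  then show ?thesis unfolding csupp_def by blast
qed

end

context warped_model
begin

text \<open>The Riemannian gradient split into radial and tangential parts; the second bracket is
  \<open>r^2\<close> times the tangential Euclidean gradient, matching the factor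
  \<open>(r / psi)^2\<close> of \<open>model_grad\<close>.\<close>

definition grad_comp :: "'n::finite sfun \<Rightarrow> 'n \<Rightarrow> 'n sfun" where
  "grad_comp f i = coord i * (nrmi * rd f) + w * (nrm * nrm * pd i f - coord i * eul f)"

text \<open>The coordinate formula for the Laplace-Beltrami operator: the radial field contributes
  \<open>rlap\<close>, the tangential one \<open>w * cas f\<close>, as \<open>rho * w\<close> is
  radial.\<close>

lemma div_grad_comp: "(\<Sum>i\<in>UNIV. pd i (rho * grad_comp f i)) = rho * mlap (f :: 'n::finite sfun)"
proof -
  have e: "rho * grad_comp f i = coord i * (nrmi * (rho * rd f)) + (rho * w) * (nrm * nrm * pd i f - coord i * eul f)" for i
    by (simp add: grad_comp_def algebra_simps)
  have "(\<Sum>i\<in>UNIV. pd i (rho * grad_comp f i))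
    = (\<Sum>i\<in>UNIV. pd i (coord i * (nrmi * (rho * rd f)))) + (\<Sum>i\<in>UNIV. pd i ((rho * w) * (nrm * nrm * pd i f - coord i * eul f)))"
    unfolding e pd_add sum.distrib ..
  then show ?thesis
    unfolding div_radial[OF rd_rho] div_tangential[OF rad_mult[OF rad_rho rad_w]]
    by (simp add: mlap_def rlap_def algebra_simps)
qed

context
  fixes \<psi> :: "real \<Rightarrow> real" and u :: "real^'n::finite \<Rightarrow> real"
  assumes psi: "\<And>r. r \<ge> 0 \<Longrightarrow> D 0 r = \<psi> r" and u: "smooth_fun u"
begin

lemma model_density_eq: "x \<noteq> 0 \<Longrightarrow> model_density \<psi> x = ev rho (x :: real^'n)"
  by (simp add: model_density_def rho_def ev_dpsi ev_nrmi psi divide_inverse)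

lemma egrad_inner: 
  assumes x: "x \<noteq> 0"
  shows "egrad u x \<bullet> (inverse (norm x) *\<^sub>R x) = ev (rd (cut0 u)) x"
  unfolding rd_def eul_def
  by (simp add: inner_vec_def ev_pd_cut0[OF u x] ev_coord ev_nrmi sum_distrib_left mult_ac)

lemma model_grad_eq:
  assumes x: "x \<noteq> 0"
  shows "model_grad \<psi> u x $ i = ev (grad_comp (cut0 u) i) x"
proof -
  have "D 0 (norm x) > 0" using x by (intro D0_pos) simp
  then show ?thesis
    unfolding model_grad_def Let_def egrad_inner[OF x] grad_comp_def w_def eul_rd
    using x by (simp add: ev_pd_cut0[OF u x] ev_coord ev_nrmi ev_nrm ev_psi_inv psi power2_eq_square field_simps)
qed

lemma model_gradnorm2_eq:
  assumes x: "x \<noteq> 0"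
  shows "model_gradnorm2 \<psi> u x = ev (energy (cut0 u)) x"
proof -
  let ?U = "cut0 u :: 'n sfun"
  have "model_gradnorm2 \<psi> u x = ev (\<Sum>i\<in>UNIV. pd i ?U * grad_comp ?U i) x"
    unfolding model_gradnorm2_def inner_vec_def by (simp add: ev_pd_cut0[OF u x] model_grad_eq[OF x])
  also have "(\<Sum>i\<in>UNIV. pd i ?U * grad_comp ?U i) = nrmi * rd ?U * eul ?U + w * (nrm * nrm * (\<Sum>i\<in>UNIV. pd i ?U * pd i ?U) - eul ?U * eul ?U)"
  proof -
    have "(\<Sum>i\<in>UNIV. pd i ?U * grad_comp ?U i)
      = (\<Sum>i\<in>UNIV. nrmi * rd ?U * (coord i * pd i ?U) + w * (nrm * nrm) * (pd i ?U * pd i ?U) - w * eul ?U * (coord i * pd i ?U))"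
      unfolding grad_comp_def by (simp add: algebra_simps)
    also have "\<dots> = nrmi * rd ?U * eul ?U + w * (nrm * nrm) * (\<Sum>i\<in>UNIV. pd i ?U * pd i ?U) - w * eul ?U * eul ?U"
      unfolding sum.distrib sum_subtractf sum_distrib_left[symmetric] eul_def[symmetric] ..
    finally show ?thesis by (simp add: algebra_simps)
  qed
  also have "ev \<dots> x = ev (energy ?U) x"
    unfolding energy_def sum_rot_sq using x by (simp add: rd_def mult_ac)
  finally show ?thesis .
qed

lemma model_lap_eq:
  assumes x: "x \<noteq> 0"
  shows "model_lap \<psi> u x = ev (mlap (cut0 u)) x"
proof -
  let ?U = "cut0 u :: 'n sfun"
  have "ediv (\<lambda>y. model_density \<psi> y *\<^sub>R model_grad \<psi> u y) x = ev (\<Sum>i\<in>UNIV. pd i (rho * grad_comp ?U i)) x"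
    unfolding ediv_def ev_sum
  proof (intro sum.cong refl)
    fix i :: 'n
    have "frechet_derivative (\<lambda>y. (model_density \<psi> y *\<^sub>R model_grad \<psi> u y) $ i) (at x) = frechet_derivative (ev (rho * grad_comp ?U i)) (at x)"
      by (rule frechet_derivative_cong_open[of "-{0}"]) (use x in \<open>auto simp: model_density_eq model_grad_eq\<close>)
    then show "frechet_derivative (\<lambda>y. (model_density \<psi> y *\<^sub>R model_grad \<psi> u y) $ i) (at x) (axis i 1) = ev (pd i (rho * grad_comp ?U i)) x"
      using x by (simp add: ev_pd pdiff_def del: pd_mult)
  qed
  also have "\<dots> = ev rho x * ev (mlap ?U) x" unfolding div_grad_comp by simp
  finally have "ediv (\<lambda>y. model_density \<psi> y *\<^sub>R model_grad \<psi> u y) x = ev rho x * ev (mlap ?U) x" .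
  moreover have "ev rho x > 0"
    using x D0_pos[of "norm x"] by (simp add: rho_def ev_dpsi ev_nrmi)
  ultimately show ?thesis unfolding model_lap_def model_density_eq[OF x] by simp
qed

end

end

theorem theorem2p11:
  fixes \<psi> :: "real \<Rightarrow> real" and D :: "nat \<Rightarrow> real \<Rightarrow> real"
    and u :: "real^'n::finite \<Rightarrow> real"
  assumes N: "CARD('n) \<ge> 5"
    and D0: "\<forall>r\<ge>0. D 0 r = \<psi> r"
    and Dk: "\<forall>k. \<forall>r\<ge>0. (D k has_real_derivative D (Suc k) r) (at r within {0..})"
    and nonneg: "\<forall>r\<ge>0. \<psi> r \<ge> 0"
    and pos: "\<forall>r>0. \<psi> r > 0"
    and d1: "D 1 0 = 1"
    and even: "\<forall>k. D (2 * k) 0 = 0"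
    and Krad: "\<forall>r>0. K_rad D r \<le> -1"
    and KH: "\<forall>r>0. K_rad D r \<ge> H_tan D r"
    and u: "Cc_infty u"
  shows "model_int \<psi> (\<lambda>x. (model_lap \<psi> u x)\<^sup>2)
           - ((real CARD('n) - 1) / 2)\<^sup>2 * model_int \<psi> (model_gradnorm2 \<psi> u)
         \<ge> 1/4 * model_int \<psi> (\<lambda>x. model_gradnorm2 \<psi> u x / (norm x)\<^sup>2)
           + ((real CARD('n))\<^sup>2 - 1) / 4 * model_int \<psi> (\<lambda>x. model_gradnorm2 \<psi> u x / (\<psi> (norm x))\<^sup>2)"
proof -
  interpret warped_model D
  proof
    fix r :: real assume r: "r > 0"
    show D0_pos: "D 0 r > 0" using D0 pos r by simp
    show "D 0 r \<le> D 2 r" using Krad[rule_format, OF r] D0_pos by (simp add: K_rad_def field_simps)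
    have "D 2 r / D 0 r \<le> ((D 1 r)\<^sup>2 - 1) / (D 0 r)\<^sup>2"
      using KH[rule_format, OF r]
      by (simp only: K_rad_def H_tan_def minus_divide_left[symmetric] neg_le_iff_le)
    then show "D 0 r * D 2 r + 1 \<le> (D 1 r)\<^sup>2"
      using D0_pos by (simp add: field_simps power2_eq_square)
  qed (use Dk even[rule_format, of 0] d1 in auto)
  let ?U = "cut0 u :: 'n sfun"
  have s: "smooth_fun u" using u by (simp add: Cc_infty_def)
  have c: "csupp ?U" by (rule csupp_cut0[OF s]) (use u in \<open>simp add: Cc_infty_def del: compact_closure\<close>)
  have o: "ord 0 (pd i ?U)" for i
    using ord_dirderiv[OF s, of "[axis i 1]"] pd_dirderiv[OF s, of i "[]"] by simp
  have psi: "\<And>r. r \<ge> 0 \<Longrightarrow> D 0 r = \<psi> r" using D0 by simp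
  note dens = model_density_eq[OF psi s] and grad = model_gradnorm2_eq[OF psi s] and lap = model_lap_eq[OF psi s]
  have i0: "model_int \<psi> (\<lambda>x. (model_lap \<psi> u x)\<^sup>2) = integ (rho * (mlap ?U * mlap ?U))"
    by (rule model_int_eq_integ) (simp add: dens lap power2_eq_square)
  have i1: "model_int \<psi> (model_gradnorm2 \<psi> u) = integ (rho * energy ?U)"
    by (rule model_int_eq_integ) (simp add: dens grad)
  have i2: "model_int \<psi> (\<lambda>x. model_gradnorm2 \<psi> u x / (norm x)\<^sup>2) = integ (rho * (nrmi * nrmi * energy ?U))"
    by (rule model_int_eq_integ) (simp add: dens grad ev_nrmi power2_eq_square divide_inverse)
  have i3: "model_int \<psi> (\<lambda>x. model_gradnorm2 \<psi> u x / (\<psi> (norm x))\<^sup>2) = integ (rho * (w * energy ?U))"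
    by (rule model_int_eq_integ) (simp add: dens grad w_def ev_psi_inv psi power2_eq_square divide_inverse)
  show ?thesis
    using rellich_integrated[OF N c o] unfolding i0 i1 i2 i3 by (simp add: power_divide)
qed

end
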